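(* Suppose $V$ is convex and $\beta$-smooth ($\beta>0$), let $\hat\pi=\mathcal N(\hat m,\hat\Sigma)$ be a minimizer of $\mathcal F$ over $\mathsf{BW}(\mathbb R^d)$, let $0<\eta\le\frac1{2\beta}$, and set $c:=24\beta^3\lambda_{\max}(\hat\Sigma)$. Then the iterates of Stochastic FB--GVI satisfy, for every $N\ge1$, $$\mathbb E\Big[\min_{k\in\{1,\dots,N\}}\mathcal F(p_k)\Big]-\mathcal F(\hat\pi)\le\frac{2W_2^2(p_0,\hat\pi)}{N\eta}+2c\eta\,W_2^2(p_0,\hat\pi)+12\beta\eta d.$$
   Context: $\mathsf{BW}(\mathbb R^d)$ is the set of Gaussian distributions $\mathcal N(m,\Sigma)$ on $\mathbb R^d$ with $m\in\mathbb R^d$ and $\Sigma$ symmetric positive definite, endowed with the 2-Wasserstein distance $W_2$. $V:\mathbb R^d\to\mathbb R$ is twice continuously differentiable; it is $\beta$-smooth if $-\beta I\preceq\nabla^2V(x)\preceq\beta I$ for all $x$, and convex if $\nabla^2 V(x)\succeq0$ for all $x$. Potential $\mathcal V(\mu)=\int V\,d\mu$, entropy $\mathcal H(\mu)=\int\log\mu(x)\,d\mu(x)$ (identifying $\mu$ with its Lebesgue density), $\mathcal F=\mathcal V+\mathcal H$. Stochastic FB--GVI with step size $\eta>0$ and initialization $p_0=\mathcal N(m_0,\Sigma_0)\in\mathsf{BW}(\mathbb R^d)$: given $p_k=\mathcal N(m_k,\Sigma_k)$, draw $\hat X_k\sim p_k$ independently of everything else conditionally on the past, set $b_k=\nabla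 V(\hat X_k)$, $S_k=\nabla^2V(\hat X_k)$, $m_{k+1}=m_k-\eta b_k$, $\Sigma_{k+1/2}=(I-\eta S_k)\Sigma_k(I-\eta S_k)$, $\Sigma_{k+1}=\tfrac12\big(\Sigma_{k+1/2}+2\eta I+[\Sigma_{k+1/2}(\Sigma_{k+1/2}+4\eta I)]^{1/2}\big)$ (principal PSD square root; the two factors commute), and $p_{k+1}=\mathcal N(m_{k+1},\Sigma_{k+1})$ (a random Gaussian). Expectations are over all the randomness of the samples. *)

theory Defs
  imports "HOL-Probability.Probability"
begin

definition psd :: "real^'n^'n \<Rightarrow> bool" where
  "psd A \<longleftrightarrow> (\<forall>h. 0 \<le> h \<bullet> (A *v h))"

definition spd :: "real^'n^'n \<Rightarrow> bool" where
  "spd A \<longleftrightarrow> transpose A = A \<and> (\<forall>h. h \<noteq> 0 \<longrightarrow> 0 < h \<bullet> (A *v h))"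

definition loewner_le :: "real^'n^'n \<Rightarrow> real^'n^'n \<Rightarrow> bool" where
  "loewner_le A B \<longleftrightarrow> psd (B - A)"

definition psd_sqrt :: "real^'n^'n \<Rightarrow> real^'n^'n" where
  "psd_sqrt A = (THE S. transpose S = S \<and> psd S \<and> S ** S = A)"

definition eigenvalues :: "real^'n^'n \<Rightarrow> real set" where
  "eigenvalues A = {l. \<exists>v. v \<noteq> 0 \<and> A *v v = l *\<^sub>R v}"

definition lambda_max :: "real^'n^'n \<Rightarrow> real" where
  "lambda_max A = Max (eigenvalues A)"

definition gdens :: "real^'n \<Rightarrow> real^'n^'n \<Rightarrow> real^'n \<Rightarrow> real" where
  "gdens m S x = exp (- (1/2) * ((x - m) \<bullet> (matrix_inv S *v (x - m))))
                 / sqrt ((2 * pi) ^ CARD('n) * det S)"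

definition gauss :: "real^'n \<Rightarrow> real^'n^'n \<Rightarrow> (real^'n) measure" where
  "gauss m S = density lborel (\<lambda>x. ennreal (gdens m S x))"

definition potential :: "(real^'n \<Rightarrow> real) \<Rightarrow> (real^'n) measure \<Rightarrow> real" where
  "potential V \<mu> = (\<integral>x. V x \<partial>\<mu>)"

definition entropy_dens :: "(real^'n \<Rightarrow> real) \<Rightarrow> real" where
  "entropy_dens f = (\<integral>x. f x * ln (f x) \<partial>lborel)"

definition FG :: "(real^'n \<Rightarrow> real) \<Rightarrow> real^'n \<Rightarrow> real^'n^'n \<Rightarrow> real" where
  "FG V m S = potential V (gauss m S) + entropy_dens (gdens m S)"

definition couplings :: "'a::euclidean_space measure \<Rightarrow> 'a measure \<Rightarrow> ('a \<times> 'a) measure set" where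
  "couplings \<mu> \<nu> = {\<gamma>. sets \<gamma> = sets borel \<and> distr \<gamma> borel fst = \<mu> \<and> distr \<gamma> borel snd = \<nu>}"

definition W2sq :: "'a::euclidean_space measure \<Rightarrow> 'a measure \<Rightarrow> ennreal" where
  "W2sq \<mu> \<nu> = (INF \<gamma>\<in>couplings \<mu> \<nu>. \<integral>\<^sup>+ p. ennreal ((norm (fst p - snd p))\<^sup>2) \<partial>\<gamma>)"

type_synonym 'n state = "(real^'n) \<times> (real^'n^'n)"

definition fbgvi_step :: "real \<Rightarrow> (real^'n \<Rightarrow> real^'n) \<Rightarrow> (real^'n \<Rightarrow> real^'n^'n)
      \<Rightarrow> 'n state \<Rightarrow> real^'n \<Rightarrow> 'n state" where
  "fbgvi_step \<eta> gradV hessV s X =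
     (let m = fst s; S = snd s; b = gradV X; H = hessV X;
          Sh = (mat 1 - \<eta> *\<^sub>R H) ** S ** (mat 1 - \<eta> *\<^sub>R H)
      in (m - \<eta> *\<^sub>R b,
          (1/2) *\<^sub>R (Sh + (2 * \<eta>) *\<^sub>R mat 1 + psd_sqrt (Sh ** (Sh + (4 * \<eta>) *\<^sub>R mat 1)))))"

definition traj_space :: "(nat \<Rightarrow> ('n::finite) state) measure" where
  "traj_space = PiM UNIV (\<lambda>_. borel)"

text \<open>Law of the trajectory (p_0, ..., p_k) (entries with index > k stay equal to the
  initial state): at step k, draw X_k ~ p_k independently given the past.\<close>
fun fbgvi_traj :: "real \<Rightarrow> (real^'n \<Rightarrow> real^'n) \<Rightarrow> (real^'n \<Rightarrow> real^'n^'n)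
      \<Rightarrow> 'n state \<Rightarrow> nat \<Rightarrow> (nat \<Rightarrow> 'n state) measure" where
  "fbgvi_traj \<eta> gradV hessV s0 0 = return traj_space (\<lambda>_. s0)"
| "fbgvi_traj \<eta> gradV hessV s0 (Suc k) =
     fbgvi_traj \<eta> gradV hessV s0 k \<bind>
       (\<lambda>\<omega>. distr (gauss (fst (\<omega> k)) (snd (\<omega> k))) traj_space
               (\<lambda>X. fun_upd \<omega> (Suc k) (fbgvi_step \<eta> gradV hessV (\<omega> k) X)))"

end

theory Submission
  imports Defs
begin

text \<open>A Gaussian \<open>\<N>(m, B B\<^sup>T)\<close> is lifted to the pair \<open>(m, B)\<close>, that is, to the random vector
  \<open>m + B \<xi>\<close> with \<open>\<xi>\<close> standard Gaussian; on such pairs the \<open>L\<^sup>2\<close> inner product is the Euclidean one.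
  In the lift the potential is convex and \<open>\<beta>\<close>-smooth, and by Stein's identity its gradient is the mean
  of the stochastic gradient \<open>(\<nabla>V(X), \<nabla>\<^sup>2V(X) B)\<close>, so a step is a stochastic proximal gradient step.
  The entropy is convex along the segment to the minimizer only if the latter is optimally coupled
  to the argument of the proximal map; therefore the coupling is re-optimized at each half step, which
  can only decrease the Bures distance. Co-coercivity of \<open>\<nabla>V\<close>, \<open>(\<nabla>\<^sup>2V)\<^sup>2 \<le> \<beta> \<nabla>\<^sup>2V\<close> and the stationarity of the
  minimizer under dilations bound the variance by \<open>4 \<beta> d + 4 \<beta>\<^sup>3 \<lambda>\<^sub>m\<^sub>a\<^sub>x W\<^sub>2\<^sup>2\<close>. The resulting recursion
  \<open>E[W\<^sub>2\<^sup>2(p\<^sub>k\<^sub>+\<^sub>1)] + 2 \<eta> E[F(p\<^sub>k\<^sub>+\<^sub>1) - F(\<pi>)] \<le> (1 + \<delta>) W\<^sub>2\<^sup>2(p\<^sub>k) + C\<close> is summed with weights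
  \<open>(1 + \<delta>)\<^sup>-\<^sup>k\<close>.\<close>

section \<open>Symmetric matrices\<close>

text \<open>On factors \<open>B\<close> the entropy is \<open>- ln \<bar>det B\<bar>\<close> up to a
  constant. This is not convex, and the inequality needed survives only towards a factor
  \<open>T B\<close> with \<open>T\<close> positive definite. The forward step turns
  \<open>B\<close> into \<open>P B\<close> with a random \<open>P\<close>, so a factor of the target
  fitted to \<open>B\<close> is not fitted to \<open>P B\<close>. Two factors of the target may
  nevertheless be used side by side, because potential and entropy depend on a factor only through
  the covariance. The proximal step gains the square of the displacement. For
  \<open>\<eta> * \<beta> \<le> 1 / 2\<close> one half of it pays for the smoothness error; the
  other half pays for the product of noise and displacement, which has no reason to vanish in mean
  since the displacement depends on the same sample. The variance bound grows with the distance to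
  the minimizer. Plain iteration of the recursion would therefore cost a factor exponential in the
  number of steps, whereas the discounted sum replaces \<open>1 / N\<close> merely by
  \<open>1 / N + \<delta>\<close>. After division by \<open>2 * \<eta>\<close> the coefficients are
  \<open>1 / (2 * N * \<eta>)\<close>, \<open>4 * \<beta> ^ 3 * \<lambda> * \<eta>\<close> and
  \<open>4 * \<beta> * \<eta> * d\<close>, all below those claimed.\<close>

lemma matrix_inv_unique:
  fixes A B :: "real^'n^'n"
  assumes "A ** B = mat 1"
  shows "matrix_inv A = B"
proof -
  have BA: "B ** A = mat 1"
    using assms matrix_left_right_inverse by blast
  have "A ** matrix_inv A = mat 1"
    unfolding matrix_inv_def by (rule someI2[where a = B]) (use assms BA in auto)
  then show ?thesis
    by (metis BA matrix_mul_assoc matrix_mul_lid matrix_mul_rid)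
qed

lemma inner_matrix_vector_transpose:
  fixes A :: "real^'n^'m"
  shows "x \<bullet> (A *v y) = (transpose A *v x) \<bullet> y"
  by (simp add: dot_lmul_matrix)

lemma symmetric_inner_matrix:
  fixes A :: "real^'n^'n"
  assumes "transpose A = A"
  shows "x \<bullet> (A *v y) = (A *v x) \<bullet> y"
  using inner_matrix_vector_transpose[of x A y] assms by simp

lemma inner_matrix_trace:
  fixes A B :: "real^'n^'m"
  shows "A \<bullet> B = trace (A ** transpose B)"
  by (simp add: inner_vec_def trace_def matrix_matrix_mult_def transpose_def)

lemma matrix_add_rdistrib_real:
  fixes A B :: "real^'n^'m" and C :: "real^'k^'n"
  shows "(A + B) ** C = A ** C + B ** C"
  by (simp add: matrix_matrix_mult_def vec_eq_iff distrib_right sum.distrib)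

text \<open>A maximizer \<open>x\<close> of the quadratic form on the unit sphere of
  \<open>W\<close> is an eigenvector: \<open>q\<close> is nonnegative on \<open>W\<close> and
  vanishes at \<open>x\<close>, so its first variation vanishes there. Invariance of
  \<open>W\<close> puts the residual \<open>r\<close> into \<open>W\<close>, and in direction
  \<open>r\<close> that variation is \<open>2 * (r \<bullet> r)\<close>.\<close>

lemma eigenvector_in_invariant_subspace:
  fixes A :: "real^'n^'n"
  assumes sym: "transpose A = A" and W: "subspace W" and inv: "\<And>x. x \<in> W \<Longrightarrow> A *v x \<in> W"
    and ne: "w \<in> W" "w \<noteq> 0"
  obtains l v where "v \<in> W" "norm v = 1" "A *v v = l *\<^sub>R v"
proof -
  let ?S = "sphere 0 1 \<inter> W"
  have "compact ?S"
    by (simp add: W closed_subspace compact_Int_closed)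
  moreover have "w /\<^sub>R norm w \<in> ?S"
    using ne W by (simp add: subspace_scale)
  moreover have "continuous_on ?S (\<lambda>y. y \<bullet> (A *v y))"
    by (intro continuous_intros matrix_vector_mult_linear_continuous_on)
  ultimately obtain x where x: "x \<in> ?S" and mx: "\<And>y. y \<in> ?S \<Longrightarrow> y \<bullet> (A *v y) \<le> x \<bullet> (A *v x)"
    using continuous_attains_sup[of ?S "\<lambda>y. y \<bullet> (A *v y)"] by fastforce
  define l where "l = x \<bullet> (A *v x)"
  define q where "q y = l * (y \<bullet> y) - y \<bullet> (A *v y)" for y
  have q0: "0 \<le> q y" if "y \<in> W" for y
  proof (cases "y = 0")
    case False
    then have "y /\<^sub>R norm y \<in> ?S"
      using that W by (simp add: subspace_scale)
    from mx[OF this] have "(y \<bullet> (A *v y)) / (norm y)\<^sup>2 \<le> l"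
      by (simp add: l_def matrix_vector_mult_scaleR field_simps power2_eq_square)
    then show ?thesis
      using False by (simp add: q_def field_simps power2_norm_eq_inner)
  qed (simp add: q_def)
  define r where "r = l *\<^sub>R x - A *v x"
  have r: "r \<in> W"
    using x W inv by (auto simp: r_def intro: subspace_diff subspace_scale)
  have "q (x + t *\<^sub>R r) = 2 * t * (r \<bullet> r) + t\<^sup>2 * q r" for t
    using x symmetric_inner_matrix[OF sym, of x r]
    by (simp add: q_def r_def l_def algebra_simps power2_eq_square inner_commute norm_eq_1)
  then have *: "0 \<le> 2 * t * (r \<bullet> r) + t\<^sup>2 * q r" for t
    using q0[of "x + t *\<^sub>R r"] x r W by (simp add: subspace_add subspace_scale)
  have "r \<bullet> r \<le> 0"
  proof (rule ccontr)
    assume "\<not> r \<bullet> r \<le> 0"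
    then have p: "r \<bullet> r > 0" by linarith
    have qr: "q r \<ge> 0" using q0 r by simp
    \<comment> \<open>A negative \<open>t\<close> so small that the linear term beats the quadratic
      one; the \<open>+ 1\<close> keeps the denominator positive when
      \<open>q r = 0\<close>.\<close>
    define t where "t = - (r \<bullet> r) / (q r + 1)"
    have "2 * t * (r \<bullet> r) + t\<^sup>2 * q r = t * (2 * (r \<bullet> r) + t * q r)"
      by (simp add: power2_eq_square algebra_simps)
    moreover have "t < 0" using p qr by (simp add: t_def divide_neg_pos)
    moreover have "2 * (r \<bullet> r) + t * q r > 0"
    proof -
      have "(r \<bullet> r) * q r / (q r + 1) \<le> r \<bullet> r"
        using p qr by (simp add: field_simps)
      then have "2 * (r \<bullet> r) - (r \<bullet> r) * q r / (q r + 1) > 0" using p by linarith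
      then show ?thesis by (simp add: t_def)
    qed
    ultimately show False
      using *[of t] mult_neg_pos[of t] by (metis not_le)
  qed
  then have "r = 0"
    by (metis inner_eq_zero_iff inner_ge_zero order_antisym)
  then have "A *v x = l *\<^sub>R x"
    by (simp add: r_def)
  with x show thesis
    using that by auto
qed

section \<open>Diagonal matrices and orthogonal diagonalization\<close>

definition diagm :: "('n \<Rightarrow> real) \<Rightarrow> real^'n^'n" where
  "diagm f = (\<chi> i j. if i = j then f i else 0)"

lemma diagm_mult: "diagm f ** diagm g = diagm (\<lambda>i. f i * g i)"
proof -
  have "(diagm f ** diagm g) $ i $ j = (\<Sum>k\<in>UNIV. if k = i then (if i = j then f i * g i else 0) else 0)" for i j
    unfolding matrix_matrix_mult_def vec_lambda_beta by (rule sum.cong) (auto simp: diagm_def)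
  then show ?thesis by (simp add: vec_eq_iff diagm_def)
qed

lemma diagm_add: "diagm f + diagm g = diagm (\<lambda>i. f i + g i)"
  by (simp add: diagm_def vec_eq_iff)

lemma diagm_scaleR: "c *\<^sub>R diagm f = diagm (\<lambda>i. c * f i)"
  by (simp add: diagm_def vec_eq_iff)

lemma diagm_1: "mat 1 = diagm (\<lambda>_. 1)"
  by (simp add: diagm_def vec_eq_iff mat_def)

lemma transpose_diagm: "transpose (diagm f) = diagm f"
  by (auto simp: diagm_def vec_eq_iff transpose_def)

lemma diagm_mult_vec: "(diagm f *v x) $ i = f i * x $ i"
  by (simp add: diagm_def matrix_vector_mult_def if_distrib if_distribR cong: if_cong)

lemma trace_diagm: "trace (diagm f) = sum f UNIV"
  by (simp add: trace_def diagm_def)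

lemma det_diagm: "det (diagm f) = prod f UNIV"
  by (subst det_diagonal) (auto simp: diagm_def)

text \<open>An orthonormal family of eigenvectors of maximal cardinality is a basis: otherwise its
  orthogonal complement is a nonzero subspace, invariant because \<open>A\<close> is symmetric, and
  it contains one more unit eigenvector.\<close>

lemma orthonormal_eigenbasis:
  fixes A :: "real^'n^'n"
  assumes sym: "transpose A = A"
  obtains S where "pairwise orthogonal S" "\<And>x. x \<in> S \<Longrightarrow> norm x = 1"
    "\<And>x. x \<in> S \<Longrightarrow> \<exists>l. A *v x = l *\<^sub>R x" "finite S" "card S = CARD('n)"
proof -
  define P where "P S \<longleftrightarrow> pairwise orthogonal S \<and> (\<forall>x\<in>S. norm x = 1 \<and> (\<exists>l. A *v x = l *\<^sub>R x))"
    for S :: "(real^'n) set"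
  have indep: "independent S" if "P S" for S
    using that by (intro pairwise_orthogonal_independent) (auto simp: P_def)
  have bnd: "finite S \<and> card S \<le> CARD('n)" if "P S" for S
    using independent_bound[OF indep[OF that]] by simp
  define k where "k = (GREATEST k. \<exists>S. P S \<and> card S = k)"
  have ex0: "\<exists>S. P S \<and> card S = 0"
    by (rule exI[of _ "{}"]) (simp add: P_def)
  have "\<exists>S. P S \<and> card S = k"
    unfolding k_def by (rule GreatestI_ex_nat[where b = "CARD('n)"]) (use ex0 bnd in auto)
  then obtain S where S: "P S" "card S = k" by auto
  have kmax: "card T \<le> k" if "P T" for T
    unfolding k_def using that bnd by (intro Greatest_le_nat[where b = "CARD('n)"]) auto
  have "card S = CARD('n)"
  proof (rule ccontr)
    assume "card S \<noteq> CARD('n)"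
    then have lt: "card S < CARD('n)" using bnd[OF S(1)] by simp
    define W where "W = {y. \<forall>x\<in>S. orthogonal x y}"
    have W: "subspace W" unfolding W_def by (rule subspace_orthogonal_to_vectors)
    have "dim S < DIM(real^'n)"
      using lt indep[OF S(1)] by (simp add: dim_eq_card_independent)
    then obtain w where w: "w \<noteq> 0" "\<And>y. y \<in> span S \<Longrightarrow> orthogonal w y"
      using orthogonal_to_subspace_exists[of S] by auto
    then have wW: "w \<in> W"
      by (auto simp: W_def orthogonal_commute span_base)
    have inv: "A *v x \<in> W" if "x \<in> W" for x
      unfolding W_def
    proof safe
      fix y assume y: "y \<in> S"
      then obtain l where "A *v y = l *\<^sub>R y" using S(1) by (auto simp: P_def)
      then show "orthogonal y (A *v x)"
        using that y symmetric_inner_matrix[OF sym, of y x] by (auto simp: orthogonal_def W_def)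
    qed
    obtain l v where v: "v \<in> W" "norm v = 1" "A *v v = l *\<^sub>R v"
      using eigenvector_in_invariant_subspace[OF sym W inv wW w(1)] by blast
    have "v \<notin> S"
      using v by (auto simp: W_def orthogonal_def norm_eq_1)
    moreover have "P (insert v S)"
      using S(1) v unfolding P_def pairwise_insert
      by (auto simp: W_def orthogonal_commute)
    ultimately show False
      using kmax[of "insert v S"] bnd[OF S(1)] S(2) by simp
  qed
  then show thesis
    using S(1) bnd[OF S(1)] by (intro that[of S]) (auto simp: P_def)
qed

theorem spectral_decomposition:
  fixes A :: "real^'n^'n"
  assumes sym: "transpose A = A"
  obtains Q l where "orthogonal_matrix Q" "A = Q ** diagm l ** transpose Q"
proof -
  obtain S where S: "pairwise orthogonal S" "\<And>x. x \<in> S \<Longrightarrow> norm x = 1"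
    "\<And>x. x \<in> S \<Longrightarrow> \<exists>l. A *v x = l *\<^sub>R x" "finite S" "card S = CARD('n)"
    using orthonormal_eigenbasis[OF sym] by blast
  obtain e where e: "bij_betw e (UNIV :: 'n set) S"
    using S(4,5) by (metis finite_same_card_bij finite_class.finite_UNIV)
  then have eS: "e i \<in> S" for i
    by (auto simp: bij_betw_def)
  then have "\<forall>i. \<exists>l. A *v e i = l *\<^sub>R e i"
    using S(3) by blast
  from choice[OF this] obtain l where l: "\<And>i. A *v e i = l i *\<^sub>R e i"
    by blast
  define Q where "Q = (\<chi> i j. e j $ i)"
  have col: "column i Q = e i" for i
    by (simp add: Q_def column_def vec_eq_iff)
  have "orthogonal_matrix Q"
    unfolding orthogonal_matrix_orthonormal_columns col
    using S(1,2) eS e by (auto simp: pairwise_def bij_betw_def inj_eq)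
  moreover have "A ** Q = Q ** diagm l"
  proof -
    have "(A ** Q) $ i $ j = (Q ** diagm l) $ i $ j" for i j
    proof -
      have "(A ** Q) $ i $ j = (A *v e j) $ i"
        by (simp add: matrix_matrix_mult_def matrix_vector_mult_def Q_def)
      also have "\<dots> = (Q ** diagm l) $ i $ j"
        by (simp add: l matrix_matrix_mult_def Q_def diagm_def if_distrib cong: if_cong)
      finally show ?thesis .
    qed
    then show ?thesis by (simp add: vec_eq_iff)
  qed
  then have "A ** (Q ** transpose Q) = Q ** diagm l ** transpose Q"
    by (simp add: matrix_mul_assoc)
  then have "A = Q ** diagm l ** transpose Q"
    using \<open>orthogonal_matrix Q\<close> by (simp add: orthogonal_matrix_def)
  ultimately show thesis using that by blast
qed

text \<open>Functional calculus: for fixed orthogonal \<open>Q\<close>, sums, products, inverses and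
  square roots act pointwise on \<open>f\<close>, so identities between commuting symmetric matrices
  become scalar ones.\<close>

definition conj_diag :: "real^'n^'n \<Rightarrow> ('n \<Rightarrow> real) \<Rightarrow> real^'n^'n" where
  "conj_diag Q f = Q ** diagm f ** transpose Q"

context
  fixes Q :: "real^'n^'n"
  assumes Q: "orthogonal_matrix Q"
begin

lemma conj_diag_mult: "conj_diag Q f ** conj_diag Q g = conj_diag Q (\<lambda>i. f i * g i)"
proof -
  have "conj_diag Q f ** conj_diag Q g = Q ** diagm f ** (transpose Q ** Q) ** diagm g ** transpose Q"
    by (simp add: conj_diag_def matrix_mul_assoc)
  also have "\<dots> = Q ** (diagm f ** diagm g) ** transpose Q"
    using Q by (simp add: orthogonal_matrix_def matrix_mul_assoc)
  finally show ?thesis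
    by (simp add: diagm_mult conj_diag_def)
qed

lemma conj_diag_add: "conj_diag Q f + conj_diag Q g = conj_diag Q (\<lambda>i. f i + g i)"
  by (simp add: conj_diag_def diagm_add[symmetric] matrix_add_ldistrib matrix_add_rdistrib_real)

lemma conj_diag_scaleR: "c *\<^sub>R conj_diag Q f = conj_diag Q (\<lambda>i. c * f i)"
  by (simp add: conj_diag_def diagm_scaleR[symmetric] matrix_scalar_ac scalar_matrix_assoc[symmetric])

lemma conj_diag_diff: "conj_diag Q f - conj_diag Q g = conj_diag Q (\<lambda>i. f i - g i)"
  using conj_diag_add[of "\<lambda>i. f i - g i" g] by (simp add: algebra_simps)

lemma conj_diag_1: "mat 1 = conj_diag Q (\<lambda>_. 1)"
  using Q by (simp add: conj_diag_def diagm_1[symmetric] orthogonal_matrix_def)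

lemma transpose_conj_diag: "transpose (conj_diag Q f) = conj_diag Q f"
  by (simp add: conj_diag_def matrix_transpose_mul transpose_diagm matrix_mul_assoc)

lemma inner_conj_diag: "x \<bullet> (conj_diag Q f *v x) = (\<Sum>i\<in>UNIV. f i * ((transpose Q *v x) $ i)\<^sup>2)"
proof -
  have "x \<bullet> (conj_diag Q f *v x) = (transpose Q *v x) \<bullet> (diagm f *v (transpose Q *v x))"
    by (simp only: conj_diag_def matrix_vector_mul_assoc[symmetric] inner_matrix_vector_transpose[of x Q])
  then show ?thesis
    by (simp add: inner_vec_def diagm_mult_vec power2_eq_square mult_ac del: transpose_matrix_vector)
qed

lemma trace_conj_diag: "trace (conj_diag Q f) = sum f UNIV"
proof -
  have "trace (conj_diag Q f) = trace (transpose Q ** (Q ** diagm f))"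
    unfolding conj_diag_def by (rule trace_mul_sym)
  then show ?thesis
    using Q by (simp add: matrix_mul_assoc orthogonal_matrix_def trace_diagm)
qed

lemma det_conj_diag: "det (conj_diag Q f) = prod f UNIV"
proof -
  have "det Q * det Q = 1"
    using Q det_orthogonal_matrix[OF Q] by auto
  then show ?thesis
    by (simp add: conj_diag_def det_mul det_diagm)
qed

lemma conj_diag_eigenvector: "conj_diag Q f *v column i Q = f i *\<^sub>R column i Q" "column i Q \<noteq> 0"
proof -
  have *: "transpose Q *v column i Q = axis i 1"
  proof -
    have "transpose Q *v (Q *v axis i 1) = axis i 1"
      using Q by (simp only: matrix_vector_mul_assoc) (simp add: orthogonal_matrix_def)
    moreover have "Q *v axis i 1 = column i Q"
      by (simp add: matrix_vector_mul_component vec_eq_iff column_def inner_axis)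
    ultimately show ?thesis by simp
  qed
  have "diagm f *v axis i 1 = f i *\<^sub>R axis i 1"
    by (simp add: vec_eq_iff diagm_mult_vec axis_def)
  moreover have "Q *v axis i 1 = column i Q"
    by (simp add: matrix_vector_mul_component vec_eq_iff column_def inner_axis)
  ultimately show "conj_diag Q f *v column i Q = f i *\<^sub>R column i Q"
    by (simp only: conj_diag_def matrix_vector_mul_assoc[symmetric] * matrix_vector_mult_scaleR)
  show "column i Q \<noteq> 0"
    using * by (metis axis_eq_0_iff matrix_vector_mult_0_right zero_neq_one)
qed

lemma psd_conj_diag: "psd (conj_diag Q f) \<longleftrightarrow> (\<forall>i. 0 \<le> f i)"
proof
  assume p: "psd (conj_diag Q f)"
  show "\<forall>i. 0 \<le> f i"
  proof
    fix i
    have "0 \<le> column i Q \<bullet> (conj_diag Q f *v column i Q)"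
      using p unfolding psd_def by blast
    also have "\<dots> = f i * (column i Q \<bullet> column i Q)"
      by (simp add: conj_diag_eigenvector)
    finally show "0 \<le> f i"
      using conj_diag_eigenvector(2)[of i] by (metis inner_gt_zero_iff zero_le_mult_iff not_less)
  qed
qed (auto simp: psd_def inner_conj_diag intro!: sum_nonneg)

lemma spd_conj_diag: "spd (conj_diag Q f) \<longleftrightarrow> (\<forall>i. 0 < f i)"
proof
  assume p: "spd (conj_diag Q f)"
  show "\<forall>i. 0 < f i"
  proof
    fix i
    have "0 < column i Q \<bullet> (conj_diag Q f *v column i Q)"
      using p conj_diag_eigenvector(2) unfolding spd_def by blast
    also have "\<dots> = f i * (column i Q \<bullet> column i Q)"
      by (simp add: conj_diag_eigenvector)
    finally show "0 < f i"
      by (metis inner_ge_zero zero_less_mult_pos2 mult_eq_0_iff order_le_less)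
  qed
next
  assume f: "\<forall>i. 0 < f i"
  have "0 < h \<bullet> (conj_diag Q f *v h)" if "h \<noteq> 0" for h
  proof -
    have "Q *v (transpose Q *v h) = h"
      using Q by (simp only: matrix_vector_mul_assoc) (simp add: orthogonal_matrix_def)
    then have "transpose Q *v h \<noteq> 0"
      using that by (metis matrix_vector_mult_0_right)
    then obtain i where "(transpose Q *v h) $ i \<noteq> 0"
      by (auto simp: vec_eq_iff)
    then show ?thesis
      unfolding inner_conj_diag using f
      by (intro sum_pos2[of _ i]) (auto simp: less_imp_le)
  qed
  then show "spd (conj_diag Q f)"
    by (simp add: spd_def transpose_conj_diag)
qed

lemma eigenvalues_conj_diag: "eigenvalues (conj_diag Q f) = range f"
proof
  show "range f \<subseteq> eigenvalues (conj_diag Q f)"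
    using conj_diag_eigenvector by (auto simp: eigenvalues_def)
  show "eigenvalues (conj_diag Q f) \<subseteq> range f"
  proof
    fix l assume "l \<in> eigenvalues (conj_diag Q f)"
    then obtain v where v: "v \<noteq> 0" "conj_diag Q f *v v = l *\<^sub>R v"
      by (auto simp: eigenvalues_def)
    define w where "w = transpose Q *v v"
    have "Q *v w = v"
      unfolding w_def using Q by (simp only: matrix_vector_mul_assoc) (simp add: orthogonal_matrix_def)
    then have "w \<noteq> 0"
      using v(1) by (metis matrix_vector_mult_0_right)
    then obtain i where i: "w $ i \<noteq> 0"
      by (auto simp: vec_eq_iff)
    have "transpose Q *v (conj_diag Q f *v v) = (transpose Q ** Q) *v (diagm f *v w)"
      by (simp only: conj_diag_def w_def matrix_vector_mul_assoc matrix_mul_assoc)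
    then have "l *\<^sub>R w = diagm f *v w"
      using Q unfolding v(2) matrix_vector_mult_scaleR w_def[symmetric]
      by (simp only: orthogonal_matrix_def matrix_vector_mul_lid)
    from arg_cong[OF this, of "\<lambda>u. u $ i"] have "l * w $ i = f i * w $ i"
      by (simp add: diagm_mult_vec)
    with i show "l \<in> range f" by auto
  qed
qed

lemma conj_diag_inverse:
  assumes "\<And>i. f i \<noteq> 0"
  shows "conj_diag Q f ** conj_diag Q (\<lambda>i. inverse (f i)) = mat 1"
    and "matrix_inv (conj_diag Q f) = conj_diag Q (\<lambda>i. inverse (f i))"
proof -
  show *: "conj_diag Q f ** conj_diag Q (\<lambda>i. inverse (f i)) = mat 1"
    by (simp add: conj_diag_mult assms conj_diag_1)
  show "matrix_inv (conj_diag Q f) = conj_diag Q (\<lambda>i. inverse (f i))"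
    by (rule matrix_inv_unique[OF *])
qed

end

section \<open>Positive definite matrices: square roots, inverses, determinants and traces\<close>

lemma symmetric_conj_diag:
  fixes A :: "real^'n^'n"
  assumes "transpose A = A"
  obtains Q f where "orthogonal_matrix Q" "A = conj_diag Q f"
  using spectral_decomposition[OF assms] unfolding conj_diag_def by metis

lemma spd_conj_diagE:
  assumes "spd A"
  obtains Q f where "orthogonal_matrix Q" "A = conj_diag Q f" "\<And>i. 0 < f i"
proof -
  obtain Q f where Q: "orthogonal_matrix Q" "A = conj_diag Q f"
    using assms symmetric_conj_diag[of A] by (auto simp: spd_def)
  then show thesis using that assms spd_conj_diag[OF Q(1)] by metis
qed

text \<open>On an eigenvector \<open>v\<close> of \<open>S\<close> with eigenvalue
  \<open>f i\<close> one has \<open>(R + f i) (R - f i) v = 0\<close>. If \<open>f i > 0\<close> the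
  first factor is positive definite and hence injective; if \<open>f i = 0\<close> then
  \<open>R v\<close> has norm zero. So \<open>R\<close> agrees with \<open>S\<close> on an
  eigenbasis. Uniqueness is what gives the definite description in \<open>psd_sqrt\<close> its
  value.\<close>

lemma psd_square_root_unique:
  fixes S R :: "real^'n^'n"
  assumes S: "transpose S = S" "psd S" and R: "transpose R = R" "psd R" and eq: "S ** S = R ** R"
  shows "S = R"
proof -
  obtain Q f where Q: "orthogonal_matrix Q" and Sf: "S = conj_diag Q f"
    using symmetric_conj_diag[OF S(1)] by blast
  have f: "0 \<le> f i" for i
    using S(2) psd_conj_diag[OF Q] Sf by simp
  have Rv: "R *v column i Q = f i *\<^sub>R column i Q" for i
  proof -
    let ?v = "column i Q"
    have Sv: "S *v ?v = f i *\<^sub>R ?v" using conj_diag_eigenvector[OF Q] Sf by simp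
    have RR: "R *v (R *v ?v) = (f i * f i) *\<^sub>R ?v"
      using Sv by (simp only: matrix_vector_mul_assoc eq[symmetric])
         (simp add: matrix_vector_mul_assoc[symmetric] matrix_vector_mult_scaleR)
    define w where "w = R *v ?v - f i *\<^sub>R ?v"
    have "R *v w + f i *\<^sub>R w = 0"
      by (simp add: w_def RR algebra_simps)
    then have "w \<bullet> (R *v w) + f i * (w \<bullet> w) = 0"
      by (metis inner_add_right inner_scaleR_right inner_zero_right)
    moreover have "0 \<le> w \<bullet> (R *v w)" "0 \<le> f i * (w \<bullet> w)"
      using R(2) f by (auto simp: psd_def)
    ultimately have "f i * (w \<bullet> w) = 0" by linarith
    then consider "f i = 0" | "w = 0" by auto
    then show ?thesis
    proof cases
      case 1
      then have "(R *v ?v) \<bullet> (R *v ?v) = 0"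
        using RR symmetric_inner_matrix[OF R(1), of "?v" "R *v ?v"] by simp
      then show ?thesis using 1 by simp
    qed (simp add: w_def)
  qed
  have "R ** Q = Q ** diagm f"
  proof -
    have "(R ** Q) $ i $ j = (R *v column j Q) $ i" for i j
      by (simp add: matrix_matrix_mult_def matrix_vector_mult_def column_def)
    then show ?thesis
      by (simp add: vec_eq_iff Rv) (simp add: matrix_matrix_mult_def column_def diagm_def if_distrib cong: if_cong)
  qed
  then have "R ** (Q ** transpose Q) = Q ** diagm f ** transpose Q"
    by (simp add: matrix_mul_assoc)
  then have "R = Q ** diagm f ** transpose Q"
    using Q by (simp add: orthogonal_matrix_def)
  then show ?thesis by (simp add: Sf conj_diag_def)
qed

lemma psd_sqrt_eqI:
  assumes "transpose S = S" "psd S" "S ** S = A"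
  shows "psd_sqrt A = S"
  unfolding psd_sqrt_def
proof (rule the_equality)
  fix R assume "transpose R = R \<and> psd R \<and> R ** R = A"
  then show "R = S"
    using assms by (auto intro: psd_square_root_unique[of R S])
qed (use assms in auto)

lemma psd_sqrt_conj_diag:
  assumes Q: "orthogonal_matrix Q" and f: "\<And>i. 0 \<le> f i"
  shows "psd_sqrt (conj_diag Q f) = conj_diag Q (\<lambda>i. sqrt (f i))"
  by (rule psd_sqrt_eqI)
     (auto simp: transpose_conj_diag[OF Q] psd_conj_diag[OF Q] conj_diag_mult[OF Q] f)

lemma psd_sqrt_square:
  assumes "transpose A = A" "psd A"
  shows "transpose (psd_sqrt A) = psd_sqrt A" "psd (psd_sqrt A)" "psd_sqrt A ** psd_sqrt A = A"
proof -
  obtain Q f where Q: "orthogonal_matrix Q" and A: "A = conj_diag Q f"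
    using symmetric_conj_diag[OF assms(1)] by blast
  have f: "0 \<le> f i" for i
    using assms(2) psd_conj_diag[OF Q] A by simp
  show "transpose (psd_sqrt A) = psd_sqrt A" "psd (psd_sqrt A)" "psd_sqrt A ** psd_sqrt A = A"
    unfolding A psd_sqrt_conj_diag[OF Q f]
    by (auto simp: transpose_conj_diag[OF Q] psd_conj_diag[OF Q] conj_diag_mult[OF Q] f)
qed

lemma spd_imp_psd: "spd A \<Longrightarrow> psd A"
  unfolding spd_def psd_def by (metis inner_zero_left less_eq_real_def)

lemma spd_sqrt:
  assumes "spd A"
  shows "spd (psd_sqrt A)" "psd_sqrt A ** psd_sqrt A = A"
proof -
  obtain Q f where Q: "orthogonal_matrix Q" and A: "A = conj_diag Q f" and f: "\<And>i. 0 < f i"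
    using spd_conj_diagE[OF assms] by blast
  show "spd (psd_sqrt A)" "psd_sqrt A ** psd_sqrt A = A"
    unfolding A psd_sqrt_conj_diag[OF Q less_imp_le[OF f]]
    by (auto simp: conj_diag_mult[OF Q] spd_conj_diag[OF Q] f less_imp_le)
qed

lemma det_spd: "spd A \<Longrightarrow> 0 < det A"
  by (erule spd_conj_diagE) (auto simp: det_conj_diag intro: prod_pos)

lemma spd_matrix_inv:
  assumes "spd A"
  shows "spd (matrix_inv A)" "A ** matrix_inv A = mat 1" "matrix_inv A ** A = mat 1"
proof -
  obtain Q f where Q: "orthogonal_matrix Q" and A: "A = conj_diag Q f" and f: "\<And>i. 0 < f i"
    using spd_conj_diagE[OF assms] by blast
  have "f i \<noteq> 0" for i using f[of i] by simp
  note inv = conj_diag_inverse[OF Q this]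
  show "spd (matrix_inv A)" "A ** matrix_inv A = mat 1"
    using inv f by (auto simp: A spd_conj_diag[OF Q])
  then show "matrix_inv A ** A = mat 1"
    using matrix_left_right_inverse by blast
qed

lemma spd_congruence:
  fixes A B :: "real^'n^'n"
  assumes "spd A" "det B \<noteq> 0"
  shows "spd (B ** A ** transpose B)"
  unfolding spd_def
proof safe
  show "transpose (B ** A ** transpose B) = B ** A ** transpose B"
    using assms(1) by (simp add: spd_def matrix_transpose_mul matrix_mul_assoc)
  fix h :: "real^'n" assume "h \<noteq> 0"
  have "invertible (transpose B)"
    using assms(2) by (simp add: invertible_det_nz)
  then have "transpose B *v h \<noteq> 0"
    using \<open>h \<noteq> 0\<close> by (metis invertible_def matrix_vector_mul_assoc matrix_vector_mul_lid matrix_vector_mult_0_right)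
  then have "0 < (transpose B *v h) \<bullet> (A *v (transpose B *v h))"
    using assms(1) unfolding spd_def by blast
  also have "\<dots> = h \<bullet> ((B ** A ** transpose B) *v h)"
    by (simp only: matrix_vector_mul_assoc[symmetric] inner_matrix_vector_transpose[of h B])
  finally show "0 < h \<bullet> ((B ** A ** transpose B) *v h)" .
qed

lemma spd_mat_1: "spd (mat 1 :: real^'n^'n)"
  by (simp add: spd_def)

lemma spd_mult_transpose:
  fixes B :: "real^'n^'n"
  assumes "det B \<noteq> 0"
  shows "spd (B ** transpose B)"
  using spd_congruence[OF spd_mat_1 assms] by simp

lemma ln_det_le_trace:
  fixes A :: "real^'n^'n"
  assumes "spd A"
  shows "ln (det A) \<le> trace A - CARD('n)"
proof -
  obtain Q f where Q: "orthogonal_matrix Q" and A: "A = conj_diag Q f" and f: "\<And>i. 0 < f i"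
    using spd_conj_diagE[OF assms] by blast
  have "ln (det A) = (\<Sum>i\<in>UNIV. ln (f i))"
    unfolding A det_conj_diag[OF Q] by (intro ln_prod) (auto simp: f[THEN less_imp_neq, symmetric])
  also have "\<dots> \<le> (\<Sum>i\<in>UNIV. f i - 1)"
    using f by (intro sum_mono ln_le_minus_one) auto
  finally show ?thesis
    by (simp add: A trace_conj_diag[OF Q] sum_subtractf)
qed

text \<open>\<open>A ** B\<close> need not be symmetric, but with \<open>R\<close> the root of
  \<open>A\<close> it is similar to the positive definite \<open>R ** B ** R\<close>, which has the
  same determinant and trace.\<close>

lemma ln_det_mult_le_trace:
  fixes A B :: "real^'n^'n"
  assumes "spd A" "spd B"
  shows "ln (det (A ** B)) \<le> trace (A ** B) - CARD('n)"
proof -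
  let ?R = "psd_sqrt A"
  note R = spd_sqrt[OF assms(1)]
  have "spd (?R ** B ** transpose ?R)"
    using spd_congruence[OF assms(2)] det_spd[OF R(1)] by simp
  then have s: "spd (?R ** B ** ?R)"
    using R(1) by (simp add: spd_def)
  have "det (?R ** B ** ?R) = det (?R ** ?R ** B)"
    by (simp add: det_mul)
  moreover have "trace (?R ** B ** ?R) = trace (?R ** (?R ** B))"
    by (rule trace_mul_sym)
  ultimately show ?thesis
    using ln_det_le_trace[OF s] R(2) by (simp add: matrix_mul_assoc)
qed

lemma trace_le_lambda_max:
  fixes A :: "real^'n^'n"
  assumes "spd A"
  shows "trace A \<le> CARD('n) * lambda_max A" "0 < lambda_max A"
proof -
  obtain Q f where Q: "orthogonal_matrix Q" and A: "A = conj_diag Q f" and f: "\<And>i. 0 < f i"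
    using spd_conj_diagE[OF assms] by blast
  have le: "f i \<le> lambda_max A" for i
    by (simp add: A lambda_max_def eigenvalues_conj_diag[OF Q])
  show "trace A \<le> CARD('n) * lambda_max A"
    unfolding A trace_conj_diag[OF Q] using sum_bounded_above[of UNIV f "lambda_max A"] le A by simp
  show "0 < lambda_max A"
    using f le by (rule less_le_trans)
qed

section \<open>Continuity and Borel measurability of matrix operations\<close>

lemma bilinear_matrix_matrix_mult:
  "bounded_bilinear ((**) :: real^'m^'n \<Rightarrow> real^'k^'m \<Rightarrow> real^'k^'n)"
proof -
  have "bilinear ((**) :: real^'m^'n \<Rightarrow> real^'k^'m \<Rightarrow> real^'k^'n)"
    unfolding bilinear_def linear_iff
    by (auto simp: matrix_add_ldistrib matrix_add_rdistrib_real matrix_scalar_ac scalar_matrix_assoc)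
  then show ?thesis
    by (simp add: bilinear_conv_bounded_bilinear)
qed

lemma bilinear_matrix_vector_mult:
  "bounded_bilinear ((*v) :: real^'m^'n \<Rightarrow> real^'m \<Rightarrow> real^'n)"
proof -
  have "bilinear ((*v) :: real^'m^'n \<Rightarrow> real^'m \<Rightarrow> real^'n)"
    unfolding bilinear_def linear_iff
    by (auto simp: matrix_vector_mult_add_rdistrib matrix_vector_right_distrib
        matrix_vector_mult_scaleR scaleR_matrix_vector_assoc)
  then show ?thesis
    by (simp add: bilinear_conv_bounded_bilinear)
qed

lemmas continuous_on_matrix_mult [continuous_intros] =
  bounded_bilinear.continuous_on[OF bilinear_matrix_matrix_mult]
lemmas continuous_on_matrix_vector_mult [continuous_intros] =
  bounded_bilinear.continuous_on[OF bilinear_matrix_vector_mult]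

lemma continuous_on_transpose [continuous_intros]:
  fixes f :: "'a::topological_space \<Rightarrow> real^'n^'m"
  assumes "continuous_on S f"
  shows "continuous_on S (\<lambda>x. transpose (f x))"
  unfolding transpose_def by (intro continuous_intros assms)

lemma continuous_on_trace [continuous_intros]:
  fixes f :: "'a::topological_space \<Rightarrow> real^'n^'n"
  assumes "continuous_on S f"
  shows "continuous_on S (\<lambda>x. trace (f x))"
  unfolding trace_def by (intro continuous_intros assms)

lemma continuous_on_det [continuous_intros]:
  fixes f :: "'a::topological_space \<Rightarrow> real^'n^'n"
  assumes "continuous_on S f"
  shows "continuous_on S (\<lambda>x. det (f x))"
  unfolding det_def by (intro continuous_intros assms)

lemma measurable_matrix_mult [measurable (raw)]:
  fixes f :: "'a \<Rightarrow> real^'m^'n" and g :: "'a \<Rightarrow> real^'k^'m"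
  assumes "f \<in> borel_measurable M" "g \<in> borel_measurable M"
  shows "(\<lambda>x. f x ** g x) \<in> borel_measurable M"
  by (rule borel_measurable_continuous_Pair[OF assms]) (intro continuous_intros)

lemma measurable_matrix_vector_mult [measurable (raw)]:
  fixes f :: "'a \<Rightarrow> real^'m^'n" and g :: "'a \<Rightarrow> real^'m"
  assumes "f \<in> borel_measurable M" "g \<in> borel_measurable M"
  shows "(\<lambda>x. f x *v g x) \<in> borel_measurable M"
  by (rule borel_measurable_continuous_Pair[OF assms]) (intro continuous_intros)

lemma measurable_trace [measurable (raw)]:
  fixes f :: "'a \<Rightarrow> real^'n^'n"
  assumes "f \<in> borel_measurable M"
  shows "(\<lambda>x. trace (f x)) \<in> borel_measurable M"
  by (rule borel_measurable_continuous_on[OF _ assms]) (intro continuous_intros)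

lemma measurable_det [measurable (raw)]:
  fixes f :: "'a \<Rightarrow> real^'n^'n"
  assumes "f \<in> borel_measurable M"
  shows "(\<lambda>x. det (f x)) \<in> borel_measurable M"
  by (rule borel_measurable_continuous_on[OF _ assms]) (intro continuous_intros)

text \<open>Squaring is a continuous bijection of the closed cone of symmetric positive semidefinite
  matrices, and that cone is \<sigma>-compact, so the inverse is Borel; off the cone the definite
  description denotes one fixed matrix.\<close>
lemma measurable_psd_sqrt [measurable]:
  "(psd_sqrt :: real^'n^'n \<Rightarrow> real^'n^'n) \<in> borel_measurable borel"
proof -
  define K where "K = {S :: real^'n^'n. transpose S = S \<and> psd S}"
  define c where "c = (THE S :: real^'n^'n. False)"
  let ?sq = "\<lambda>S :: real^'n^'n. S ** S"
  have K_eq: "K = {S. transpose S = S} \<inter> (\<Inter>h. {S. 0 \<le> h \<bullet> (S *v h)})"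
    by (auto simp: K_def psd_def)
  have "closed K"
    unfolding K_eq by (intro closed_Int closed_INT closed_Collect_eq closed_Collect_le ballI continuous_intros)
  have im: "?sq ` (C \<inter> K) \<in> sets borel" if "closed C" for C
  proof -
    have eq: "?sq ` (C \<inter> K) = (\<Union>n::nat. ?sq ` (C \<inter> K \<inter> cball 0 (real n)))"
    proof -
      have "(\<Union>n::nat. cball (0::real^'n^'n) (real n)) = UNIV"
        using real_arch_simple by auto
      then show ?thesis by blast
    qed
    have "compact (?sq ` (C \<inter> K \<inter> cball 0 (real n)))" for n
      using that \<open>closed K\<close>
      by (intro compact_continuous_image continuous_intros closed_Int_compact closed_Int) auto
    then show ?thesis
      unfolding eq by (intro sets.countable_UN image_subsetI borel_compact)
  qed
  have sq_K: "?sq ` K = {A. transpose A = A \<and> psd A}"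
  proof safe
    fix S assume S: "S \<in> K"
    then show "transpose (S ** S) = S ** S"
      by (simp add: K_def matrix_transpose_mul)
    have "h \<bullet> ((S ** S) *v h) = (S *v h) \<bullet> (S *v h)" for h
      using S symmetric_inner_matrix[of S h "S *v h"] by (simp add: K_def matrix_vector_mul_assoc)
    then show "psd (S ** S)"
      by (simp add: psd_def)
  next
    fix A :: "real^'n^'n" assume "transpose A = A" "psd A"
    then show "A \<in> ?sq ` K"
      using psd_sqrt_square[of A] by (intro image_eqI[of _ _ "psd_sqrt A"]) (auto simp: K_def)
  qed
  have off: "psd_sqrt A = c" if "A \<notin> ?sq ` K" for A
  proof -
    have "(\<lambda>S. transpose S = S \<and> psd S \<and> S ** S = A) = (\<lambda>S. False)"
      using that by (auto simp: K_def)
    then show ?thesis unfolding psd_sqrt_def c_def by simp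
  qed
  have on: "psd_sqrt (S ** S) = S" if "S \<in> K" for S
    using that by (intro psd_sqrt_eqI) (auto simp: K_def)
  have vim: "psd_sqrt -` C = ?sq ` (C \<inter> K) \<union> (if c \<in> C then - ?sq ` K else {})" for C
  proof (rule set_eqI)
    fix A
    show "A \<in> psd_sqrt -` C \<longleftrightarrow> A \<in> ?sq ` (C \<inter> K) \<union> (if c \<in> C then - ?sq ` K else {})"
    proof (cases "A \<in> ?sq ` K")
      case True
      then obtain S where S: "S \<in> K" "A = S ** S" by blast
      have "A \<in> ?sq ` (C \<inter> K) \<longleftrightarrow> S \<in> C"
      proof
        assume "A \<in> ?sq ` (C \<inter> K)"
        then obtain S' where S': "S' \<in> C" "S' \<in> K" "A = S' ** S'" by blast
        have "psd_sqrt A = S'" "psd_sqrt A = S"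
          unfolding S'(3) by (rule on[OF S'(2)]) (unfold S'(3)[symmetric] S(2), rule on[OF S(1)])
        then show "S \<in> C" using S'(1) by simp
      qed (use S in blast)
      moreover have "psd_sqrt A = S"
        unfolding S(2) by (rule on[OF S(1)])
      ultimately show ?thesis using True by simp
    next
      case False
      then have "A \<notin> ?sq ` (C \<inter> K)" by blast
      then show ?thesis using False off[OF False] by simp
    qed
  qed
  show ?thesis
    unfolding borel_eq_closed
  proof (rule measurable_measure_of)
    fix C :: "(real^'n^'n) set" assume "C \<in> Collect closed"
    then have "?sq ` (C \<inter> K) \<in> sets borel" "?sq ` K \<in> sets borel"
      using im[of C] im[of UNIV] by auto
    then show "psd_sqrt -` C \<inter> space (sigma UNIV (Collect closed)) \<in> sets (sigma UNIV (Collect closed))"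
      unfolding vim borel_eq_closed[symmetric] by auto
  qed auto
qed

text \<open>Strict positivity over uncountably many vectors is replaced by weak positivity, a closed
  condition, together with a nonzero determinant, an open one.\<close>

lemma measurable_spd [measurable]: "Measurable.pred borel (spd :: real^'n^'n \<Rightarrow> bool)"
proof -
  have "spd A \<longleftrightarrow> transpose A = A \<and> psd A \<and> det A \<noteq> 0" for A :: "real^'n^'n"
  proof
    assume A: "transpose A = A \<and> psd A \<and> det A \<noteq> 0"
    then obtain Q f where Q: "orthogonal_matrix Q" "A = conj_diag Q f"
      using symmetric_conj_diag[of A] by blast
    then have "f i \<ge> 0" "f i \<noteq> 0" for i
      using A psd_conj_diag[OF Q(1), of f] det_conj_diag[OF Q(1), of f] by auto
    then show "spd A"
      using spd_conj_diag[OF Q(1)] Q(2) by (simp add: order_less_le)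
  qed (use det_spd[of A] spd_imp_psd[of A] in \<open>auto simp: spd_def\<close>)
  then have "{A. spd A} = {A :: real^'n^'n. transpose A = A} \<inter> (\<Inter>h. {A. 0 \<le> h \<bullet> (A *v h)}) \<inter> - {A. det A = 0}"
    by (auto simp: psd_def)
  also have "\<dots> \<in> sets borel"
    by (intro sets.Int borel_closed borel_comp closed_Collect_eq closed_INT ballI closed_Collect_le continuous_intros)
  finally show ?thesis
    by (simp add: pred_def)
qed

section \<open>Bures distance and the entropic proximal step\<close>

lemma inner_matrix_mult_left:
  fixes A :: "real^'m^'n" and B :: "real^'k^'m" and C :: "real^'k^'n"
  shows "(A ** B) \<bullet> C = B \<bullet> (transpose A ** C)"
proof -
  have "(A ** B) \<bullet> C = trace (A ** (B ** transpose C))"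
    by (simp add: inner_matrix_trace matrix_mul_assoc)
  also have "\<dots> = trace ((B ** transpose C) ** A)"
    by (rule trace_mul_sym)
  finally show ?thesis
    by (simp add: inner_matrix_trace matrix_transpose_mul matrix_mul_assoc)
qed

lemma inner_matrix_mult_self:
  fixes T B :: "real^'n^'n"
  assumes "transpose T = T"
  shows "B \<bullet> (T ** B) = trace (T ** (B ** transpose B))"
  using assms trace_mul_sym[of "B ** transpose B" T]
  by (simp add: inner_matrix_trace matrix_transpose_mul matrix_mul_assoc)

text \<open>The squared Bures distance, that is, the covariance part of the squared 2-Wasserstein
  distance of Gaussians. The first argument will be the covariance of the minimizer.\<close>

definition bures :: "real^'n^'n \<Rightarrow> real^'n^'n \<Rightarrow> real" where
  "bures C S = trace S + trace C - 2 * trace (psd_sqrt (psd_sqrt C ** S ** psd_sqrt C))"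

lemma transport_matrix:
  fixes C S :: "real^'n^'n"
  assumes "spd C" "spd S"
  obtains T where "spd T" "T ** S ** T = C" "bures C S = trace S + trace C - 2 * trace (T ** S)"
proof -
  define R where "R = psd_sqrt C"
  have R: "spd R" "R ** R = C" "transpose R = R"
    using spd_sqrt[OF assms(1)] by (auto simp: R_def spd_def)
  define M where "M = psd_sqrt (R ** S ** R)"
  have RSR: "spd (R ** S ** R)"
    using spd_congruence[OF assms(2), of R] R det_spd[OF R(1)] by simp
  have M: "spd M" "M ** M = R ** S ** R"
    using spd_sqrt[OF RSR] by (auto simp: M_def)
  define N where "N = matrix_inv M"
  have N: "spd N" "M ** N = mat 1" "N ** M = mat 1"
    using spd_matrix_inv[OF M(1)] by (auto simp: N_def)
  have T: "spd (R ** N ** R)"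
    using spd_congruence[OF N(1), of R] R det_spd[OF R(1)] by simp
  have "(R ** N ** R) ** S ** (R ** N ** R) = R ** N ** (R ** S ** R) ** N ** R"
    by (simp add: matrix_mul_assoc)
  also have "\<dots> = R ** (N ** M) ** (M ** N) ** R"
    by (simp add: M(2)[symmetric] matrix_mul_assoc)
  finally have "(R ** N ** R) ** S ** (R ** N ** R) = C"
    using R(2) N by simp
  moreover have "trace (R ** N ** R ** S) = trace M"
  proof -
    have "trace (R ** N ** R ** S) = trace (R ** (N ** R ** S))"
      by (simp add: matrix_mul_assoc)
    also have "\<dots> = trace (N ** (R ** S ** R))"
      by (subst trace_mul_sym) (simp add: matrix_mul_assoc)
    also have "\<dots> = trace M"
      by (simp add: M(2)[symmetric] matrix_mul_assoc N)
    finally show ?thesis .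
  qed
  ultimately show thesis
    using T that by (simp add: bures_def M_def R_def)
qed

lemma transport_matrix_inverse_trace:
  fixes C S T :: "real^'n^'n"
  assumes "spd T" "T ** S ** T = C"
  shows "trace (matrix_inv T ** C) = trace (T ** S)"
  using spd_matrix_inv[OF assms(1)] trace_mul_sym[of T S]
  by (simp add: assms(2)[symmetric] matrix_mul_assoc)

text \<open>Expand the square of \<open>U x - W y\<close>, where \<open>U\<close> is the root of
  \<open>T\<close> and \<open>W\<close> its inverse; the matrix version is the same computation in
  the Frobenius inner product. The two versions serve weak duality, for couplings of measures and
  for pairs of factors respectively.\<close>

lemma young_spd:
  assumes "spd T"
  shows "2 * (x \<bullet> y) \<le> x \<bullet> (T *v x) + y \<bullet> (matrix_inv T *v y)"
    and "2 * (B \<bullet> D) \<le> B \<bullet> (T ** B) + D \<bullet> (matrix_inv T ** D)"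
proof -
  define U where "U = psd_sqrt T"
  define W where "W = matrix_inv U"
  have U: "spd U" "U ** U = T" "transpose U = U"
    using spd_sqrt[OF assms] by (auto simp: U_def spd_def)
  have W: "U ** W = mat 1" "W ** U = mat 1" "transpose W = W"
    using spd_matrix_inv[OF U(1)] by (auto simp: W_def spd_def)
  have "T ** (W ** W) = U ** (U ** W) ** W"
    by (simp add: U(2)[symmetric] matrix_mul_assoc)
  then have "matrix_inv T = W ** W"
    using W by (intro matrix_inv_unique) simp
  note inv = this U(2)[symmetric]
  have "0 \<le> (U *v x - W *v y) \<bullet> (U *v x - W *v y)" by simp
  moreover have "(U *v x) \<bullet> (W *v y) = x \<bullet> y"
    by (metis U(3) W(1) symmetric_inner_matrix matrix_vector_mul_assoc matrix_vector_mul_lid)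
  moreover have "(U *v x) \<bullet> (U *v x) = x \<bullet> (T *v x)"
    by (metis U(3) inv(2) symmetric_inner_matrix matrix_vector_mul_assoc)
  moreover have "(W *v y) \<bullet> (W *v y) = y \<bullet> (matrix_inv T *v y)"
    by (metis W(3) inv(1) symmetric_inner_matrix matrix_vector_mul_assoc)
  ultimately show "2 * (x \<bullet> y) \<le> x \<bullet> (T *v x) + y \<bullet> (matrix_inv T *v y)"
    by (simp add: inner_diff_left inner_diff_right inner_commute)
  have "0 \<le> (U ** B - W ** D) \<bullet> (U ** B - W ** D)" by simp
  moreover have "(U ** B) \<bullet> (W ** D) = B \<bullet> D"
    by (simp add: inner_matrix_mult_left U(3) matrix_mul_assoc W)
  moreover have "(U ** B) \<bullet> (U ** B) = B \<bullet> (T ** B)"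
    by (simp add: inner_matrix_mult_left U matrix_mul_assoc)
  moreover have "(W ** D) \<bullet> (W ** D) = D \<bullet> (matrix_inv T ** D)"
    by (simp add: inner_matrix_mult_left W inv(1) matrix_mul_assoc)
  ultimately show "2 * (B \<bullet> D) \<le> B \<bullet> (T ** B) + D \<bullet> (matrix_inv T ** D)"
    by (simp add: inner_diff_left inner_diff_right inner_commute)
qed

text \<open>Weak duality: the matrix form of Young's inequality bounds
  \<open>2 * (B \<bullet> D)\<close> by the trace of \<open>T ** S\<close> plus that of
  \<open>matrix_inv T ** C\<close>. These two traces are equal, whatever the choice of the
  factors.\<close>

lemma bures_le_norm_diff:
  fixes B D :: "real^'n^'n"
  assumes "spd C" "spd S" and B: "B ** transpose B = S" and D: "D ** transpose D = C"
  shows "bures C S \<le> (norm (B - D))\<^sup>2"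
proof -
  obtain T where T: "spd T" "T ** S ** T = C" "bures C S = trace S + trace C - 2 * trace (T ** S)"
    using transport_matrix[OF assms(1,2)] .
  have sym: "transpose T = T" "transpose (matrix_inv T) = matrix_inv T"
    using T(1) spd_matrix_inv(1)[OF T(1)] by (auto simp: spd_def)
  have "(norm (B - D))\<^sup>2 = trace S + trace C - 2 * (B \<bullet> D)"
    by (simp add: power2_norm_eq_inner inner_diff_left inner_diff_right inner_commute)
       (simp add: inner_matrix_trace B D)
  moreover have "2 * (B \<bullet> D) \<le> trace (T ** S) + trace (matrix_inv T ** C)"
    using young_spd(2)[OF T(1), of B D] by (simp add: inner_matrix_mult_self sym B D)
  ultimately show ?thesis
    using T(3) transport_matrix_inverse_trace[OF T(1,2)] by simp
qed

lemma bures_attained: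
  fixes B T :: "real^'n^'n"
  assumes T: "spd T" "T ** S ** T = C" "bures C S = trace S + trace C - 2 * trace (T ** S)"
    and B: "B ** transpose B = S"
  shows "(T ** B) ** transpose (T ** B) = C" "bures C S = (norm (B - T ** B))\<^sup>2"
proof -
  have sym: "transpose T = T" using T(1) by (simp add: spd_def)
  have "(T ** B) ** transpose (T ** B) = T ** (B ** transpose B) ** T"
    by (simp add: matrix_transpose_mul sym matrix_mul_assoc)
  then show D: "(T ** B) ** transpose (T ** B) = C"
    using B T(2) by simp
  have "(norm (B - T ** B))\<^sup>2 = trace S + trace C - 2 * (B \<bullet> (T ** B))"
    by (simp add: power2_norm_eq_inner inner_diff_left inner_diff_right inner_commute)
       (simp add: inner_matrix_trace[of B B] inner_matrix_trace[of "T ** B" "T ** B"] B D)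
  then show "bures C S = (norm (B - T ** B))\<^sup>2"
    using T(3) by (simp add: inner_matrix_mult_self sym B)
qed

text \<open>On an eigenvalue \<open>f\<close> of \<open>S\<close> this is the larger root
  \<open>g\<close> of \<open>g\<^sup>2 - (f + 2 * \<eta>) * g + \<eta>\<^sup>2 = 0\<close>,
  equivalently of \<open>(1 - \<eta> / g)\<^sup>2 * g = f\<close>.\<close>

definition entropy_prox :: "real \<Rightarrow> real^'n^'n \<Rightarrow> real^'n^'n" where
  "entropy_prox \<eta> S = (1/2) *\<^sub>R (S + (2 * \<eta>) *\<^sub>R mat 1 + psd_sqrt (S ** (S + (4 * \<eta>) *\<^sub>R mat 1)))"

text \<open>The optimality condition of the proximal map: the gradient of
  \<open>- ln \<bar>det B\<bar>\<close> is \<open>- matrix_inv (B ** transpose B) ** B\<close>, so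
  the argument of the map is recovered from its value by \<open>P\<close>. The two roots of the
  quadratic have product \<open>\<eta>\<^sup>2\<close>; the larger one exceeds
  \<open>\<eta>\<close>, and this makes \<open>P\<close> positive definite.\<close>

lemma entropy_prox:
  fixes S :: "real^'n^'n"
  assumes "spd S" "0 < \<eta>"
  defines "S1 \<equiv> entropy_prox \<eta> S"
  defines "P \<equiv> mat 1 - \<eta> *\<^sub>R matrix_inv S1"
  shows "spd S1" "spd P" "P ** S1 ** P = S"
proof -
  obtain Q f where Q: "orthogonal_matrix Q" and S: "S = conj_diag Q f" and f: "\<And>i. 0 < f i"
    using spd_conj_diagE[OF assms(1)] by blast
  define g where "g = (\<lambda>i. (1/2) * (f i + 2 * \<eta> + sqrt (f i * (f i + 4 * \<eta>))))"
  have nn: "0 \<le> f i * (f i + 4 * \<eta>)" for i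
    using f[of i] assms(2) by simp
  have S1: "S1 = conj_diag Q g"
    unfolding S1_def entropy_prox_def S conj_diag_1[OF Q]
    by (simp add: conj_diag_scaleR[OF Q] conj_diag_add[OF Q] conj_diag_mult[OF Q]
        psd_sqrt_conj_diag[OF Q nn] g_def)
  have g: "\<eta> < g i" for i
    using add_pos_nonneg[OF f[of i] real_sqrt_ge_zero[OF nn[of i]]] by (simp add: g_def)
  have g0: "0 < g i" for i
    using g[of i] assms(2) by simp
  then have gn: "g i \<noteq> 0" for i by (metis less_irrefl)
  have P: "P = conj_diag Q (\<lambda>i. 1 - \<eta> * inverse (g i))"
    unfolding P_def S1 conj_diag_inverse(2)[OF Q gn]
    by (simp add: conj_diag_1[OF Q] conj_diag_scaleR[OF Q] conj_diag_diff[OF Q])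
  show "spd S1"
    using g0 by (simp add: S1 spd_conj_diag[OF Q])
  show "spd P"
    using g g0 by (simp add: P spd_conj_diag[OF Q] field_simps)
  have "(1 - \<eta> * inverse (g i)) * g i * (1 - \<eta> * inverse (g i)) = f i" for i
  proof -
    have "(2 * g i - f i - 2 * \<eta>)\<^sup>2 = f i * (f i + 4 * \<eta>)"
      using nn[of i] by (simp add: g_def add_divide_distrib)
    then have *: "g i * g i - 2 * \<eta> * g i + \<eta> * \<eta> = f i * g i"
      by (simp add: power2_eq_square algebra_simps)
    have "(1 - \<eta> * inverse (g i)) * g i * (1 - \<eta> * inverse (g i)) = (g i * g i - 2 * \<eta> * g i + \<eta> * \<eta>) / g i"
      using gn[of i] by (simp add: divide_simps) (simp add: algebra_simps)
    then show ?thesis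
      unfolding * using gn[of i] by simp
  qed
  then show "P ** S1 ** P = S"
    by (simp add: P S1 S conj_diag_mult[OF Q])
qed

text \<open>The proximal inequality compares with a point \<open>D = T B\<close> that is optimally coupled to the
  argument of the proximal map; \<open>T P\<close> is then a product of two positive definite matrices, which
  is what makes \<open>ln (det (T P)) \<le> trace (T P) - d\<close> available.\<close>
lemma bures_entropy_prox_le:
  fixes B S C :: "real^'n^'n"
  assumes C: "spd C" and S: "spd S" and \<eta>: "0 < \<eta>" and B: "B ** transpose B = S"
  defines "S1 \<equiv> entropy_prox \<eta> S"
  obtains B1 where "B1 ** transpose B1 = S1"
    "bures C S1 \<le> bures C S + \<eta> * (ln (det S1) - ln (det C)) - (norm (B1 - B))\<^sup>2"
proof -
  define J where "J = matrix_inv S1"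
  define P where "P = mat 1 - \<eta> *\<^sub>R J"
  have S1: "spd S1" and P: "spd P" and PSP: "P ** S1 ** P = S"
    using entropy_prox[OF S \<eta>] by (auto simp: S1_def P_def J_def)
  have J: "spd J" "S1 ** J = mat 1" "J ** S1 = mat 1"
    using spd_matrix_inv[OF S1] by (auto simp: J_def)
  have sP: "transpose P = P" and sJ: "transpose J = J"
    using P J by (auto simp: spd_def)
  define K where "K = matrix_inv P"
  have K: "spd K" "P ** K = mat 1" "K ** P = mat 1" "transpose K = K"
    using spd_matrix_inv[OF P] by (auto simp: K_def spd_def)
  define B1 where "B1 = K ** B"
  have PB1: "P ** B1 = B"
    by (simp add: B1_def matrix_mul_assoc K)
  have "B1 ** transpose B1 = K ** (B ** transpose B) ** K"
    by (simp add: B1_def matrix_transpose_mul matrix_mul_assoc K)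
  also have "\<dots> = (K ** P) ** S1 ** (P ** K)"
    by (simp add: B PSP[symmetric] matrix_mul_assoc)
  finally have B1: "B1 ** transpose B1 = S1"
    using K by simp
  obtain T where T: "spd T" "T ** S ** T = C" "bures C S = trace S + trace C - 2 * trace (T ** S)"
    using transport_matrix[OF C S] .
  define D where "D = T ** B"
  have D: "D ** transpose D = C" "bures C S = (norm (B - D))\<^sup>2"
    using bures_attained[OF T B] by (auto simp: D_def)
  \<comment> \<open>\<open>N\<close> is minus the gradient of the lifted entropy at
    \<open>B1\<close>, and \<open>BN\<close> below is the implicit Euler equation of the entropy
    flow.\<close>
  define N where "N = J ** B1"
  have BN: "B = B1 - \<eta> *\<^sub>R N"
    unfolding PB1[symmetric] P_def N_def
    using bounded_bilinear.diff_left[OF bilinear_matrix_matrix_mult, of "mat 1" "\<eta> *\<^sub>R J" B1]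
    by (simp add: scalar_matrix_assoc)
  have B1N: "B1 \<bullet> N = CARD('n)"
    using J by (simp add: N_def inner_matrix_mult_self sJ B1 trace_I)
  have "D \<bullet> N = trace (T ** (P ** (B1 ** transpose B1) ** J))"
    unfolding D_def N_def PB1[symmetric] inner_matrix_trace
    by (simp add: matrix_transpose_mul sJ matrix_mul_assoc)
  also have "\<dots> = trace (T ** (P ** (S1 ** J)))"
    by (simp add: B1 matrix_mul_assoc)
  finally have DN: "D \<bullet> N = trace (T ** P)"
    by (simp add: J)
  have dets: "0 < det T" "0 < det P" "0 < det S1" "0 < det C" "0 < det S"
    using det_spd T P S1 C S by auto
  have "det C = det T * det T * (det P * det P * det S1)"
    by (simp add: T(2)[symmetric] PSP[symmetric] det_mul)
  then have "ln (det C) = 2 * ln (det T) + 2 * ln (det P) + ln (det S1)"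
    using dets by (simp add: ln_mult)
  moreover have "ln (det (T ** P)) = ln (det T) + ln (det P)"
    using dets by (simp add: ln_mult det_mul)
  ultimately have "ln (det C) - ln (det S1) \<le> 2 * (D \<bullet> N - CARD('n))"
    using ln_det_mult_le_trace[OF T(1) P] DN by simp
  then have "\<eta> * (ln (det C) - ln (det S1)) \<le> 2 * \<eta> * (D \<bullet> N - B1 \<bullet> N)"
    using \<eta> B1N by (simp add: mult_left_mono mult.assoc mult.left_commute)
  \<comment> \<open>The three-point identity of proximal maps; its middle term is what the preceding
    convexity inequality controls.\<close>
  moreover have "(norm (B - D))\<^sup>2 = (norm (B1 - D))\<^sup>2 - 2 * \<eta> * (B1 \<bullet> N - D \<bullet> N) + (norm (B1 - B))\<^sup>2"
    unfolding BN power2_norm_eq_inner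
    by (simp add: inner_diff_left inner_diff_right inner_commute algebra_simps)
  moreover have "bures C S1 \<le> (norm (B1 - D))\<^sup>2"
    by (rule bures_le_norm_diff[OF C S1 B1 D(1)])
  ultimately have "bures C S1 \<le> bures C S + \<eta> * (ln (det S1) - ln (det C)) - (norm (B1 - B))\<^sup>2"
    using D(2) by (simp add: algebra_simps)
  with B1 show thesis using that by blast
qed

section \<open>Gaussian measures\<close>

lemma nn_integral_lborel_translate:
  fixes f :: "'a::euclidean_space \<Rightarrow> ennreal"
  assumes [measurable]: "f \<in> borel_measurable borel"
  shows "(\<integral>\<^sup>+x. f (c + x) \<partial>lborel) = (\<integral>\<^sup>+x. f x \<partial>lborel)"
  by (subst (2) lborel_distr_plus[of c, symmetric]) (simp add: nn_integral_distr)

text \<open>The uniqueness argument for Haar measure: integrating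
  \<open>f (B x) * g (y - B x)\<close> over both variables in either order shows that the ratio of
  the integrals of \<open>f (B x)\<close> and \<open>f x\<close> does not depend on
  \<open>f\<close>. A Gaussian \<open>g\<close> then evaluates the ratio.\<close>

lemma nn_integral_lborel_linear_aux:
  fixes B :: "real^'n^'n" and f g :: "real^'n \<Rightarrow> ennreal"
  assumes B: "det B \<noteq> 0" and [measurable]: "f \<in> borel_measurable borel" "g \<in> borel_measurable borel"
  shows "(\<integral>\<^sup>+x. f (B *v x) \<partial>lborel) * (\<integral>\<^sup>+y. g y \<partial>lborel)
       = (\<integral>\<^sup>+x. f x \<partial>lborel) * (\<integral>\<^sup>+x. g (- (B *v x)) \<partial>lborel)"
proof -
  obtain B' where B': "B ** B' = mat 1"
    using B invertible_det_nz[of B] by (auto simp: invertible_def)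
  have "(\<integral>\<^sup>+x. f (B *v x) \<partial>lborel) * (\<integral>\<^sup>+y. g y \<partial>lborel)
      = (\<integral>\<^sup>+x. f (B *v x) * (\<integral>\<^sup>+y. g (- (B *v x) + y) \<partial>lborel) \<partial>lborel)"
    by (subst nn_integral_lborel_translate) (simp_all add: nn_integral_multc)
  also have "\<dots> = (\<integral>\<^sup>+x. (\<integral>\<^sup>+y. f (B *v x) * g (- (B *v x) + y) \<partial>lborel) \<partial>lborel)"
    by (simp add: nn_integral_cmult)
  also have "\<dots> = (\<integral>\<^sup>+y. (\<integral>\<^sup>+x. f (B *v x) * g (- (B *v x) + y) \<partial>lborel) \<partial>lborel)"
    by (rule lborel_pair.Fubini') simp
  also have "\<dots> = (\<integral>\<^sup>+y. (\<integral>\<^sup>+x. f (B *v x + y) * g (- (B *v x)) \<partial>lborel) \<partial>lborel)"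
  proof (rule nn_integral_cong)
    fix y :: "real^'n"
    \<comment> \<open>Shifting \<open>x\<close> by the preimage of \<open>y\<close> moves
      \<open>y\<close> from the argument of \<open>g\<close> to that of \<open>f\<close>.\<close>
    have BB: "B *v (B' *v y + x) = B *v x + y" for x
      using B' by (simp add: matrix_vector_right_distrib matrix_vector_mul_assoc)
    show "(\<integral>\<^sup>+x. f (B *v x) * g (- (B *v x) + y) \<partial>lborel) = (\<integral>\<^sup>+x. f (B *v x + y) * g (- (B *v x)) \<partial>lborel)"
      by (subst nn_integral_lborel_translate[of _ "B' *v y", symmetric]) (simp_all add: BB)
  qed
  also have "\<dots> = (\<integral>\<^sup>+x. (\<integral>\<^sup>+y. f (B *v x + y) * g (- (B *v x)) \<partial>lborel) \<partial>lborel)"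
    by (rule lborel_pair.Fubini'[symmetric]) simp
  also have "\<dots> = (\<integral>\<^sup>+x. f x \<partial>lborel) * (\<integral>\<^sup>+x. g (- (B *v x)) \<partial>lborel)"
    by (simp add: nn_integral_multc nn_integral_cmult nn_integral_lborel_translate)
  finally show ?thesis .
qed

lemma nn_integral_exp_square:
  assumes "0 < (l::real)"
  shows "(\<integral>\<^sup>+y. ennreal (exp (- (l * y)\<^sup>2 / 2)) \<partial>lborel) = ennreal (sqrt (2 * pi) / l)"
proof -
  have "exp (- (l * y)\<^sup>2 / 2) = sqrt (2 * pi) / l * normal_density 0 (1 / l) y" for y
    using assms by (simp add: normal_density_def real_sqrt_mult real_sqrt_divide power_divide power_mult_distrib mult.commute)
  then have "(\<integral>\<^sup>+y. ennreal (exp (- (l * y)\<^sup>2 / 2)) \<partial>lborel)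
      = (\<integral>\<^sup>+y. ennreal (sqrt (2 * pi) / l * normal_density 0 (1 / l) y) \<partial>lborel)"
    by simp
  also have "\<dots> = ennreal (\<integral>y. sqrt (2 * pi) / l * normal_density 0 (1 / l) y \<partial>lborel)"
    using assms by (intro nn_integral_eq_integral integrable_mult_right integrable_normal_density) auto
  finally show ?thesis
    using assms by simp
qed

lemma nn_integral_exp_diag:
  fixes l :: "'n::finite \<Rightarrow> real"
  assumes l: "\<And>i. 0 < l i"
  shows "(\<integral>\<^sup>+(x::real^'n). ennreal (exp (- (\<Sum>i\<in>UNIV. (l i * x $ i)\<^sup>2) / 2)) \<partial>lborel)
       = ennreal (sqrt ((2 * pi) ^ CARD('n)) / prod l UNIV)"
proof -
  define f where "f b y = ennreal (exp (- (l (axis_index b) * y)\<^sup>2 / 2))" for b :: "real^'n" and y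
  have Basis: "(\<Prod>b\<in>Basis. F b) = (\<Prod>i\<in>UNIV. F (axis i 1))" for F :: "real^'n \<Rightarrow> ennreal"
  proof -
    have "Basis = range (\<lambda>i. axis i 1 :: real^'n)"
      by (auto simp: Basis_vec_def)
    moreover have "inj (\<lambda>i. axis i 1 :: real^'n)"
      by (simp add: inj_on_def axis_eq_axis)
    ultimately show ?thesis
      by (metis (no_types, lifting) prod.reindex_cong)
  qed
  have "ennreal (exp (- (\<Sum>i\<in>UNIV. (l i * x $ i)\<^sup>2) / 2)) = (\<Prod>b\<in>Basis. f b (x \<bullet> b))" for x :: "real^'n"
    unfolding Basis f_def
    by (simp add: axis_index_axis inner_axis prod_ennreal exp_sum[symmetric] sum_negf sum_divide_distrib)
  then have "(\<integral>\<^sup>+(x::real^'n). ennreal (exp (- (\<Sum>i\<in>UNIV. (l i * x $ i)\<^sup>2) / 2)) \<partial>lborel)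
      = (\<integral>\<^sup>+x. (\<Prod>b\<in>Basis. f b (x \<bullet> b)) \<partial>lborel)"
    by simp
  also have "\<dots> = (\<Prod>b\<in>Basis. (\<integral>\<^sup>+y. f b y \<partial>lborel))"
    by (rule nn_integral_lborel_prod) (auto simp: f_def)
  also have "\<dots> = (\<Prod>i\<in>UNIV. ennreal (sqrt (2 * pi) / l i))"
    unfolding Basis f_def axis_index_axis using l by (simp only: nn_integral_exp_square)
  also have "\<dots> = ennreal (\<Prod>i\<in>UNIV. sqrt (2 * pi) / l i)"
    using l by (intro prod_ennreal) (simp add: less_imp_le)
  also have "(\<Prod>i\<in>UNIV. sqrt (2 * pi) / l i) = sqrt ((2 * pi) ^ CARD('n)) / prod l UNIV"
    by (simp only: prod_dividef real_sqrt_power prod_constant)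
  finally show ?thesis .
qed

lemma norm_vec_sum: "(norm (x::real^'n))\<^sup>2 = (\<Sum>i\<in>UNIV. (x $ i)\<^sup>2)"
  unfolding power2_norm_eq_inner inner_vec_def by (simp add: power2_eq_square)

lemma nn_integral_exp_norm:
  "0 < c \<Longrightarrow> (\<integral>\<^sup>+(x::real^'n). ennreal (exp (- (c * norm x)\<^sup>2 / 2)) \<partial>lborel)
       = ennreal (sqrt ((2 * pi) ^ CARD('n)) / c ^ CARD('n))"
  using nn_integral_exp_diag[of "\<lambda>_::'n. c"]
  by (simp add: power_mult_distrib norm_vec_sum sum_distrib_left)

text \<open>For the radial Gaussian as \<open>g\<close> both integrals of \<open>g\<close> in the
  auxiliary identity coincide, so the ratio is one.\<close>

lemma nn_integral_lborel_orthogonal: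
  fixes Q :: "real^'n^'n"
  assumes Q: "orthogonal_matrix Q" and [measurable]: "f \<in> borel_measurable borel"
  shows "(\<integral>\<^sup>+x. f (Q *v x) \<partial>lborel) = (\<integral>\<^sup>+x. f x \<partial>lborel)"
proof -
  have "det Q \<noteq> 0"
    using det_orthogonal_matrix[OF Q] by auto
  have "norm (Q *v x) = norm x" for x
    using Q orthogonal_transformation_matrix[of "(*v) Q"] by (simp add: orthogonal_transformation_norm)
  then have "(\<integral>\<^sup>+x. f (Q *v x) \<partial>lborel) * (\<integral>\<^sup>+(x::real^'n). ennreal (exp (- (1 * norm x)\<^sup>2 / 2)) \<partial>lborel)
      = (\<integral>\<^sup>+x. f x \<partial>lborel) * (\<integral>\<^sup>+(x::real^'n). ennreal (exp (- (1 * norm x)\<^sup>2 / 2)) \<partial>lborel)"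
    using nn_integral_lborel_linear_aux[OF \<open>det Q \<noteq> 0\<close>, of f "\<lambda>x. ennreal (exp (- (1 * norm x)\<^sup>2 / 2))"]
    by (simp only: norm_minus_cancel) simp
  moreover define c where "c = sqrt ((2 * pi) ^ CARD('n)) / 1 ^ CARD('n)"
  moreover have "c > 0" by (simp add: c_def)
  ultimately show ?thesis
    unfolding nn_integral_exp_norm[OF zero_less_one] c_def[symmetric]
    by (subst (asm) (1 2) mult.commute, subst (asm) ennreal_mult_cancel_left) (simp add: ennreal_eq_0_iff)
qed

text \<open>Diagonalizing \<open>transpose B ** B\<close> and rotating reduces this to the diagonal
  Gaussian integral, where the square roots of the eigenvalues multiply to
  \<open>\<bar>det B\<bar>\<close>.\<close>

lemma nn_integral_exp_linear:
  fixes B :: "real^'n^'n"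
  assumes B: "det B \<noteq> 0"
  shows "(\<integral>\<^sup>+x. ennreal (exp (- (norm (B *v x))\<^sup>2 / 2)) \<partial>lborel)
       = ennreal (sqrt ((2 * pi) ^ CARD('n)) / \<bar>det B\<bar>)"
proof -
  have "spd (transpose B ** B)"
    using spd_mult_transpose[of "transpose B"] B by simp
  then obtain Q f where Q: "orthogonal_matrix Q" and f: "transpose B ** B = conj_diag Q f" "\<And>i. 0 < f i"
    using spd_conj_diagE by blast
  have n: "(norm (B *v x))\<^sup>2 = (\<Sum>i\<in>UNIV. (sqrt (f i) * (transpose Q *v x) $ i)\<^sup>2)" for x
  proof -
    have "(norm (B *v x))\<^sup>2 = x \<bullet> ((transpose B ** B) *v x)"
      by (simp only: power2_norm_eq_inner matrix_vector_mul_assoc[symmetric]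
          inner_matrix_vector_transpose[of x "transpose B"] transpose_transpose)
    then show ?thesis
      unfolding f(1) inner_conj_diag[OF Q] using f(2)
      by (simp add: power_mult_distrib less_imp_le del: transpose_matrix_vector)
  qed
  have "prod f UNIV = (det B)\<^sup>2"
    using det_conj_diag[OF Q, of f] f(1)[symmetric] by (simp add: det_mul power2_eq_square)
  then have "(\<Prod>i\<in>UNIV. sqrt (f i)) = \<bar>det B\<bar>"
    using prod.distrib[of "\<lambda>i. sqrt (f i)" "\<lambda>i. sqrt (f i)" UNIV] f(2)
    by (simp add: less_imp_le flip: power2_eq_square)
       (metis abs_of_nonneg power2_eq_iff_nonneg prod_nonneg real_sqrt_ge_zero abs_ge_zero less_imp_le power2_abs)
  moreover have "orthogonal_matrix (transpose Q)"
    using Q by simp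
  ultimately show ?thesis
    unfolding n using nn_integral_lborel_orthogonal[of "transpose Q" "\<lambda>y. ennreal (exp (- (\<Sum>i\<in>UNIV. (sqrt (f i) * y $ i)\<^sup>2) / 2))"]
      nn_integral_exp_diag[of "\<lambda>i. sqrt (f i)"] f(2)
    by (simp del: transpose_matrix_vector)
qed

lemma nn_integral_lborel_linear:
  fixes B :: "real^'n^'n"
  assumes B: "det B \<noteq> 0" and [measurable]: "f \<in> borel_measurable borel"
  shows "(\<integral>\<^sup>+x. f (B *v x) \<partial>lborel) = ennreal (1 / \<bar>det B\<bar>) * (\<integral>\<^sup>+x. f x \<partial>lborel)"
proof -
  define c where "c = sqrt ((2 * pi) ^ CARD('n))"
  have c: "c > 0" by (simp add: c_def)
  have "(\<integral>\<^sup>+x. f (B *v x) \<partial>lborel) * ennreal c = (\<integral>\<^sup>+x. f x \<partial>lborel) * ennreal (c / \<bar>det B\<bar>)"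
    using nn_integral_lborel_linear_aux[OF B, of f "\<lambda>x. ennreal (exp (- (norm x)\<^sup>2 / 2))"]
      nn_integral_exp_linear[OF B] nn_integral_exp_norm[of 1, where ?'n = 'n]
    by (simp add: c_def)
  also have "\<dots> = (ennreal (1 / \<bar>det B\<bar>) * (\<integral>\<^sup>+x. f x \<partial>lborel)) * ennreal c"
    using c ennreal_mult[of "1 / \<bar>det B\<bar>" c] by (simp add: mult_ac)
  finally show ?thesis
    using c by (subst (asm) (1 2) mult.commute, subst (asm) ennreal_mult_cancel_left) (auto simp: ennreal_eq_0_iff)
qed

section \<open>Gaussian laws as affine images of the standard one\<close>

abbreviation stdgauss :: "(real^'n) measure" where
  "stdgauss \<equiv> gauss 0 (mat 1)"

lemma gdens_std: "gdens 0 (mat 1) (x::real^'n) = exp (- (norm x)\<^sup>2 / 2) / sqrt ((2 * pi) ^ CARD('n))"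
proof -
  have "matrix_inv (mat 1 :: real^'n^'n) = mat 1"
    by (rule matrix_inv_unique) simp
  then show ?thesis
    by (simp add: gdens_def power2_norm_eq_inner)
qed

lemma gdens_affine:
  fixes B :: "real^'n^'n"
  assumes B: "det B \<noteq> 0"
  shows "gdens m (B ** transpose B) (m + B *v x) = gdens 0 (mat 1) x / \<bar>det B\<bar>"
proof -
  obtain B' where B': "B ** B' = mat 1" "B' ** B = mat 1"
    using B invertible_det_nz[of B] by (auto simp: invertible_def)
  have "transpose B ** transpose B' = mat 1"
    using B'(2) by (metis matrix_transpose_mul transpose_mat)
  then have "(B ** transpose B) ** (transpose B' ** B') = mat 1"
    by (metis B'(1) matrix_mul_assoc matrix_mul_rid)
  then have "matrix_inv (B ** transpose B) = transpose B' ** B'"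
    by (rule matrix_inv_unique)
  moreover have "(B *v x) \<bullet> ((transpose B' ** B') *v (B *v x)) = (norm x)\<^sup>2"
  proof -
    have "(B *v x) \<bullet> ((transpose B' ** B') *v (B *v x)) = (B' *v (B *v x)) \<bullet> (B' *v (B *v x))"
      by (simp only: matrix_vector_mul_assoc[of "transpose B'" B', symmetric] inner_matrix_vector_transpose[of _ "transpose B'"] transpose_transpose)
    also have "B' *v (B *v x) = x"
      by (simp add: matrix_vector_mul_assoc B')
    finally show ?thesis by (simp add: power2_norm_eq_inner)
  qed
  ultimately show ?thesis
    unfolding gdens_std by (simp add: gdens_def det_mul real_sqrt_mult flip: power2_eq_square)
qed

lemma measurable_gdens [measurable]: "gdens m S \<in> borel_measurable borel"
  unfolding gdens_def[abs_def] by measurable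

text \<open>\<open>B\<close> is an arbitrary invertible factor, symmetric or not. This freedom
  allows the minimizer to be represented by whichever factor is coupled best to the current
  iterate.\<close>

lemma gauss_affine:
  fixes B :: "real^'n^'n"
  assumes B: "det B \<noteq> 0"
  shows "gauss m (B ** transpose B) = distr stdgauss borel (\<lambda>x. m + B *v x)"
proof (rule measure_eqI)
  show "sets (gauss m (B ** transpose B)) = sets (distr stdgauss borel (\<lambda>x. m + B *v x))"
    by (simp add: gauss_def)
  fix A assume "A \<in> sets (gauss m (B ** transpose B))"
  then have [measurable]: "A \<in> sets borel" by (simp add: gauss_def)
  let ?p = "gdens m (B ** transpose B)"
  have "(\<lambda>x. m + B *v x) \<in> measurable stdgauss borel"
    by (simp add: gauss_def)
  then have "emeasure (distr stdgauss borel (\<lambda>x. m + B *v x)) A = emeasure stdgauss ((\<lambda>x. m + B *v x) -` A)"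
    by (simp add: emeasure_distr gauss_def)
  also have "\<dots> = (\<integral>\<^sup>+x. ennreal (gdens 0 (mat 1) x) * indicator A (m + B *v x) \<partial>lborel)"
    unfolding gauss_def
    by (subst emeasure_density) (auto simp: indicator_def intro!: nn_integral_cong measurable_sets_borel[OF _ \<open>A \<in> sets borel\<close>])
  also have "\<dots> = (\<integral>\<^sup>+x. ennreal \<bar>det B\<bar> * (ennreal (?p (m + B *v x)) * indicator A (m + B *v x)) \<partial>lborel)"
    using B by (intro nn_integral_cong)
      (simp add: gdens_affine mult.assoc[symmetric] ennreal_mult'[symmetric])
  also have "\<dots> = ennreal \<bar>det B\<bar> * (\<integral>\<^sup>+x. (\<lambda>y. ennreal (?p (m + y)) * indicator A (m + y)) (B *v x) \<partial>lborel)"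
    by (subst nn_integral_cmult) auto
  also have "\<dots> = (\<integral>\<^sup>+y. ennreal (?p (m + y)) * indicator A (m + y) \<partial>lborel)"
    using B by (subst nn_integral_lborel_linear) (simp_all add: mult.assoc[symmetric] ennreal_mult[symmetric])
  also have "\<dots> = (\<integral>\<^sup>+y. ennreal (?p y) * indicator A y \<partial>lborel)"
    by (rule nn_integral_lborel_translate[of "\<lambda>y. ennreal (?p y) * indicator A y"]) simp
  also have "\<dots> = emeasure (gauss m (B ** transpose B)) A"
    by (simp add: gauss_def emeasure_density)
  finally show "emeasure (gauss m (B ** transpose B)) A = emeasure (distr stdgauss borel (\<lambda>x. m + B *v x)) A" ..
qed

lemma space_gauss [simp]: "space (gauss m S) = UNIV"
  and sets_gauss [measurable_cong, simp]: "sets (gauss m S) = sets borel"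
  by (simp_all add: gauss_def)

lemma prob_space_stdgauss: "prob_space (stdgauss :: (real^'n) measure)"
proof
  define c where "c = sqrt ((2 * pi) ^ CARD('n))"
  have c: "c > 0" by (simp add: c_def)
  have "emeasure (stdgauss :: (real^'n) measure) UNIV = (\<integral>\<^sup>+(x::real^'n). ennreal (1 / c) * ennreal (exp (- (norm x)\<^sup>2 / 2)) \<partial>lborel)"
    by (simp add: gauss_def emeasure_density gdens_std c_def ennreal_mult[symmetric])
  also have "\<dots> = ennreal (1 / c) * ennreal c"
    using nn_integral_exp_norm[of 1, where ?'n = 'n]
    by (subst nn_integral_cmult) (auto simp: c_def)
  also have "\<dots> = 1"
    using c by (simp flip: ennreal_mult)
  finally show "emeasure (stdgauss :: (real^'n) measure) (space stdgauss) = 1" by simp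
qed

lemma gauss_spd:
  assumes "spd S"
  shows "gauss m S = distr stdgauss borel (\<lambda>x. m + psd_sqrt S *v x)"
  using gauss_affine[of "psd_sqrt S" m] spd_sqrt[OF assms] det_spd[of "psd_sqrt S"] by (simp add: spd_def)

lemma prob_space_gauss:
  assumes "spd S"
  shows "prob_space (gauss m S)"
  unfolding gauss_spd[OF assms] by (rule prob_space.prob_space_distr[OF prob_space_stdgauss]) simp

lemma integrable_stdgauss:
  fixes f :: "real^'n \<Rightarrow> 'b::{banach, second_countable_topology}"
  assumes [measurable]: "f \<in> borel_measurable borel" and le: "\<And>x. norm (f x) \<le> C * (1 + (norm x)\<^sup>2)"
  shows "integrable stdgauss f"
proof -
  define c where "c = sqrt ((2 * pi) ^ CARD('n))"
  have c: "c > 0" by (simp add: c_def)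
  have "norm (f 0) \<le> C" using le[of 0] by simp
  then have C: "0 \<le> C" using norm_ge_zero order_trans by blast
  have sq: "(1 / sqrt 2 * r)\<^sup>2 = r\<^sup>2 / 2" for r :: real
    by (simp add: power_divide)
  \<comment> \<open>Half of the Gaussian exponent absorbs the quadratic growth through
    \<open>1 + r\<^sup>2 \<le> 5 * exp (r\<^sup>2 / 4)\<close>; the other half is again a Gaussian,
    with scale \<open>1 / sqrt 2\<close>.\<close>
  have bnd: "(1 + r\<^sup>2) * exp (- r\<^sup>2 / 2) \<le> 5 * exp (- (1 / sqrt 2 * r)\<^sup>2 / 2)" for r :: real
  proof -
    have "1 + r\<^sup>2 / 4 \<le> exp (r\<^sup>2 / 4)" by (rule exp_ge_add_one_self)
    moreover have "1 \<le> exp (r\<^sup>2 / 4)" by simp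
    ultimately have "1 + r\<^sup>2 \<le> 5 * exp (r\<^sup>2 / 4)" by linarith
    then have "(1 + r\<^sup>2) * exp (- r\<^sup>2 / 2) \<le> 5 * exp (r\<^sup>2 / 4) * exp (- r\<^sup>2 / 2)"
      by (rule mult_right_mono) simp
    also have "\<dots> = 5 * exp (- (1 / sqrt 2 * r)\<^sup>2 / 2)"
      unfolding sq by (simp add: mult.assoc exp_add[symmetric])
    finally show ?thesis .
  qed
  have "(\<integral>\<^sup>+x. ennreal (norm (f x)) \<partial>stdgauss) = (\<integral>\<^sup>+x. ennreal (gdens 0 (mat 1) x) * ennreal (norm (f x)) \<partial>lborel)"
    unfolding gauss_def by (rule nn_integral_density) simp_all
  also have "\<dots> \<le> (\<integral>\<^sup>+(x::real^'n). ennreal (C * 5 / c) * ennreal (exp (- (1 / sqrt 2 * norm x)\<^sup>2 / 2)) \<partial>lborel)"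
  proof (rule nn_integral_mono)
    fix x :: "real^'n"
    have "gdens 0 (mat 1) x * norm (f x) \<le> gdens 0 (mat 1) x * (C * (1 + (norm x)\<^sup>2))"
      using le[of x] by (intro mult_left_mono) (simp_all add: gdens_std)
    also have "\<dots> = C / c * ((1 + (norm x)\<^sup>2) * exp (- (norm x)\<^sup>2 / 2))"
      by (simp add: gdens_std c_def)
    also have "\<dots> \<le> C / c * (5 * exp (- (1 / sqrt 2 * norm x)\<^sup>2 / 2))"
      using C c by (intro mult_left_mono bnd) simp
    finally show "ennreal (gdens 0 (mat 1) x) * ennreal (norm (f x)) \<le> ennreal (C * 5 / c) * ennreal (exp (- (1 / sqrt 2 * norm x)\<^sup>2 / 2))"
      using C c by (simp add: ennreal_mult[symmetric] gdens_std ennreal_leI)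
  qed
  also have "\<dots> < \<infinity>"
    by (subst nn_integral_cmult, simp, subst nn_integral_exp_norm) (simp_all add: ennreal_mult_less_top)
  finally show ?thesis
    by (intro integrableI_bounded) simp_all
qed

text \<open>By translation invariance \<open>F (x + v) - F x\<close> has integral zero. Along the
  segment this difference is the integral of \<open>F' (x + t v)\<close> over \<open>t\<close> in
  \<open>[0, 1]\<close>, and Fubini with translation invariance turns that into the integral of
  \<open>F'\<close>. Integrability takes the place of decay at infinity.\<close>

lemma integral_directional_derivative_eq_0:
  fixes F F' :: "'a::euclidean_space \<Rightarrow> real"
  assumes deriv: "\<And>x. ((\<lambda>t. F (x + t *\<^sub>R v)) has_real_derivative F' x) (at 0)"
    and cont: "continuous_on UNIV F'" and F: "integrable lborel F" and F': "integrable lborel F'"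
  shows "(\<integral>x. F' x \<partial>lborel) = 0"
proof -
  have [measurable]: "F' \<in> borel_measurable borel"
    using cont by (rule borel_measurable_continuous_onI)
  have deriv': "((\<lambda>s. F (x + s *\<^sub>R v)) has_real_derivative F' (x + t *\<^sub>R v)) (at t)" for x t
    using deriv[of "x + t *\<^sub>R v"] DERIV_shift[of "\<lambda>s. F (x + s *\<^sub>R v)" "F' (x + t *\<^sub>R v)" 0 t]
    by (simp add: scaleR_add_left ac_simps)
  have shift: "integrable lborel (\<lambda>x. G (x + c))" "(\<integral>x. G (x + c) \<partial>lborel) = (\<integral>x. G x \<partial>lborel)"
    if "integrable lborel G" for G :: "'a \<Rightarrow> real" and c
  proof -
    have [measurable]: "G \<in> borel_measurable borel" using that by auto
    have "integrable (distr lborel borel ((+) c)) G" using that by (simp add: lborel_distr_plus)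
    then show "integrable lborel (\<lambda>x. G (x + c))"
      by (subst (asm) integrable_distr_eq) (auto simp: add.commute)
    have "(\<integral>x. G x \<partial>distr lborel borel ((+) c)) = (\<integral>x. G (c + x) \<partial>lborel)"
      by (rule integral_distr) auto
    then show "(\<integral>x. G (x + c) \<partial>lborel) = (\<integral>x. G x \<partial>lborel)"
      by (simp add: lborel_distr_plus add.commute)
  qed
  define f where "f t x = F' (x + t *\<^sub>R v) * indicator {0..1::real} t" for t x
  have int: "integrable (lborel \<Otimes>\<^sub>M lborel) (\<lambda>(t, x). f t x)"
  proof (rule lborel_pair.Fubini_integrable)
    show "(\<lambda>(t, x). f t x) \<in> borel_measurable (lborel \<Otimes>\<^sub>M lborel)"
      unfolding f_def by measurable
    have "(\<integral>x. norm (f t x) \<partial>lborel) = indicator {0..1} t * (\<integral>x. norm (F' x) \<partial>lborel)" for t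
      using shift(2)[OF integrable_norm[OF F'], of "t *\<^sub>R v"]
      by (simp add: f_def abs_mult)
    then show "integrable lborel (\<lambda>t. \<integral>x. norm (case (t, x) of (t, x) \<Rightarrow> f t x) \<partial>lborel)"
      by simp
    show "AE t in lborel. integrable lborel (\<lambda>x. case (t, x) of (t, x) \<Rightarrow> f t x)"
      using shift(1)[OF F'] by (simp add: f_def)
  qed
  have "(\<integral>t. (\<integral>x. f t x \<partial>lborel) \<partial>lborel) = (\<integral>x. (\<integral>t. f t x \<partial>lborel) \<partial>lborel)"
    using lborel_pair.Fubini_integral[OF int] by simp
  moreover have "(\<integral>x. f t x \<partial>lborel) = (\<integral>x. F' x \<partial>lborel) * indicator {0..1} t" for t
    using shift(2)[OF F', of "t *\<^sub>R v"] by (simp add: f_def)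
  moreover have "(\<integral>t. f t x \<partial>lborel) = F (x + v) - F x" for x
  proof -
    have "(\<integral>t. F' (x + t *\<^sub>R v) * indicator {0..1} t \<partial>lborel) = F (x + 1 *\<^sub>R v) - F (x + 0 *\<^sub>R v)"
    proof (rule integral_FTC_Icc_real)
      fix t :: real
      show "DERIV (\<lambda>t. F (x + t *\<^sub>R v)) t :> F' (x + t *\<^sub>R v)" by (rule deriv')
      have "continuous_on UNIV (\<lambda>t. F' (x + t *\<^sub>R v))"
        by (intro continuous_on_compose2[OF cont] continuous_intros) auto
      then show "isCont (\<lambda>t. F' (x + t *\<^sub>R v)) t"
        by (simp add: continuous_on_eq_continuous_at)
    qed simp
    then show ?thesis by (simp add: f_def)
  qed
  ultimately show ?thesis
    using shift[OF F, of v] F by simp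
qed

text \<open>The derivative along \<open>v\<close> of density times \<open>f\<close> has integral
  zero, and the density \<open>p\<close> satisfies \<open>p' = - (x \<bullet> v) * p\<close>. Linear
  growth of \<open>f\<close> and boundedness of \<open>G\<close> give integrability of all the
  terms.\<close>

lemma stein_identity_scalar:
  fixes f :: "real^'n \<Rightarrow> real" and G :: "real^'n \<Rightarrow> real^'n"
  assumes deriv: "\<And>x. (f has_derivative (\<lambda>h. G x \<bullet> h)) (at x)" and cont: "continuous_on UNIV G"
    and f: "\<And>x. \<bar>f x\<bar> \<le> K * (1 + norm x)" and G: "\<And>x. norm (G x) \<le> K"
  shows "(\<integral>x. f x * (x \<bullet> v) \<partial>stdgauss) = (\<integral>x. G x \<bullet> v \<partial>stdgauss)"
    and "integrable stdgauss (\<lambda>x. f x * (x \<bullet> v))" "integrable stdgauss (\<lambda>x. G x \<bullet> v)"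
proof -
  let ?p = "gdens 0 (mat 1) :: real^'n \<Rightarrow> real"
  have contf: "continuous_on UNIV f"
    using deriv by (auto simp: continuous_on_eq_continuous_at intro!: has_derivative_continuous)
  have [measurable]: "f \<in> borel_measurable borel" "G \<in> borel_measurable borel"
    using contf cont by (auto intro: borel_measurable_continuous_onI)
  have K: "0 \<le> K" using G[of 0] norm_ge_zero order_trans by blast
  have p0: "0 \<le> ?p x" for x by (simp add: gdens_std)
  have q1: "1 + r \<le> 2 * (1 + r\<^sup>2)" and q2: "(1 + r) * r \<le> 2 * (1 + r\<^sup>2)" if "0 \<le> r" for r :: real
  proof -
    have "2 * r \<le> 1 + r\<^sup>2"
      using zero_le_power2[of "r - 1"] by (simp add: power2_diff)
    moreover have "(1 + r) * r = r + r\<^sup>2" by (simp add: power2_eq_square distrib_right)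
    moreover have "0 \<le> r\<^sup>2" by simp
    ultimately show "1 + r \<le> 2 * (1 + r\<^sup>2)" "(1 + r) * r \<le> 2 * (1 + r\<^sup>2)"
      using that unfolding distrib_left by linarith+
  qed
  have I1: "integrable stdgauss f"
  proof (rule integrable_stdgauss)
    fix x :: "real^'n"
    have "\<bar>f x\<bar> \<le> K * (1 + norm x)" by (rule f)
    also have "\<dots> \<le> K * (2 * (1 + (norm x)\<^sup>2))" by (intro mult_left_mono q1 K) simp
    finally show "norm (f x) \<le> 2 * K * (1 + (norm x)\<^sup>2)" by (simp add: algebra_simps)
  qed simp
  show I2: "integrable stdgauss (\<lambda>x. f x * (x \<bullet> v))"
  proof (rule integrable_stdgauss)
    fix x :: "real^'n"
    have "\<bar>f x * (x \<bullet> v)\<bar> \<le> (K * (1 + norm x)) * (norm x * norm v)"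
      unfolding abs_mult using f[of x] Cauchy_Schwarz_ineq2[of x v] K by (intro mult_mono) auto
    also have "\<dots> = K * norm v * ((1 + norm x) * norm x)" by simp
    also have "\<dots> \<le> K * norm v * (2 * (1 + (norm x)\<^sup>2))" by (intro mult_left_mono q2) (simp_all add: K)
    finally show "norm (f x * (x \<bullet> v)) \<le> 2 * K * norm v * (1 + (norm x)\<^sup>2)" by (simp add: algebra_simps)
  qed simp
  show I3: "integrable stdgauss (\<lambda>x. G x \<bullet> v)"
  proof (rule integrable_stdgauss)
    fix x :: "real^'n"
    have "\<bar>G x \<bullet> v\<bar> \<le> norm (G x) * norm v" by (rule Cauchy_Schwarz_ineq2)
    also have "\<dots> \<le> K * norm v" by (intro mult_right_mono G) simp
    also have "\<dots> \<le> K * norm v * (1 + (norm x)\<^sup>2)" using K by (simp add: distrib_left)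
    finally show "norm (G x \<bullet> v) \<le> K * norm v * (1 + (norm x)\<^sup>2)" by simp
  qed simp
  have I: "integrable lborel (\<lambda>x. ?p x * g x)" if "integrable stdgauss g" for g :: "real^'n \<Rightarrow> real"
  proof -
    have [measurable]: "g \<in> borel_measurable borel"
      using borel_measurable_integrable[OF that] by (simp add: gauss_def)
    show ?thesis
      using that unfolding gauss_def by (subst (asm) integrable_density) (auto simp: p0)
  qed
  define F where "F x = ?p x * f x" for x
  define F' where "F' x = ?p x * (G x \<bullet> v - f x * (x \<bullet> v))" for x
  have "(\<integral>x. F' x \<partial>lborel) = 0"
  proof (rule integral_directional_derivative_eq_0)
    show "integrable lborel F" "integrable lborel F'"
      unfolding F_def F'_def using I1 I2 I3 by (auto intro!: I)
    show "continuous_on UNIV F'"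
      unfolding F'_def gdens_std by (intro continuous_intros contf cont) auto
    fix x :: "real^'n"
    have fd: "((\<lambda>t. f (x + t *\<^sub>R v)) has_real_derivative G x \<bullet> v) (at 0)"
    proof -
      have "((\<lambda>t. x + t *\<^sub>R v) has_derivative (\<lambda>t. t *\<^sub>R v)) (at 0)"
        by (auto intro!: derivative_eq_intros)
      from has_derivative_compose[OF this, of f "\<lambda>h. G x \<bullet> h"] deriv[of x]
      show ?thesis by (simp add: has_field_derivative_def mult.commute[of _ "G x \<bullet> v"])
    qed
    have "((\<lambda>t. exp (- ((x \<bullet> x + 2 * t * (x \<bullet> v) + t\<^sup>2 * (v \<bullet> v)) / 2)))
        has_real_derivative - (x \<bullet> v) * exp (- (norm x)\<^sup>2 / 2)) (at 0)"
      by (auto intro!: derivative_eq_intros simp: power2_norm_eq_inner)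
    from DERIV_cdivide[OF this, of "sqrt ((2 * pi) ^ CARD('n))"]
    have "((\<lambda>t. exp (- ((x \<bullet> x + 2 * t * (x \<bullet> v) + t\<^sup>2 * (v \<bullet> v)) / 2)) / sqrt ((2 * pi) ^ CARD('n)))
        has_real_derivative - (x \<bullet> v) * ?p x) (at 0)"
      unfolding gdens_std by simp
    moreover have "(\<lambda>t. exp (- ((x \<bullet> x + 2 * t * (x \<bullet> v) + t\<^sup>2 * (v \<bullet> v)) / 2)) / sqrt ((2 * pi) ^ CARD('n)))
        = (\<lambda>t. ?p (x + t *\<^sub>R v))"
      unfolding gdens_std power2_norm_eq_inner
      by (simp add: fun_eq_iff inner_add_left inner_add_right inner_commute power2_eq_square algebra_simps)
    ultimately have nd': "((\<lambda>t. ?p (x + t *\<^sub>R v)) has_real_derivative - (x \<bullet> v) * ?p x) (at 0)"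
      by simp
    show "((\<lambda>t. F (x + t *\<^sub>R v)) has_real_derivative F' x) (at 0)"
      unfolding F_def F'_def using DERIV_mult[OF nd' fd] by (simp add: algebra_simps)
  qed
  moreover have "(\<integral>x. F' x \<partial>lborel) = (\<integral>x. G x \<bullet> v - f x * (x \<bullet> v) \<partial>stdgauss)"
    unfolding F'_def gauss_def by (subst integral_density) (auto simp: p0)
  ultimately show "(\<integral>x. f x * (x \<bullet> v) \<partial>stdgauss) = (\<integral>x. G x \<bullet> v \<partial>stdgauss)"
    using I2 I3 by simp
qed

lemma norm_matrix_vector_le:
  fixes A :: "real^'n^'m"
  shows "norm (A *v x) \<le> norm A * norm x"
proof (rule power2_le_imp_le)
  have "(norm (A *v x))\<^sup>2 = (\<Sum>i\<in>UNIV. (A $ i \<bullet> x)\<^sup>2)"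
    by (simp add: norm_vec_sum matrix_vector_mul_component)
  also have "\<dots> \<le> (\<Sum>i\<in>UNIV. (A $ i \<bullet> A $ i) * (x \<bullet> x))"
    by (intro sum_mono Cauchy_Schwarz_ineq)
  also have "\<dots> = (A \<bullet> A) * (x \<bullet> x)"
    unfolding inner_vec_def[of A A] by (rule sum_distrib_right[symmetric])
  finally show "(norm (A *v x))\<^sup>2 \<le> (norm A * norm x)\<^sup>2"
    by (simp add: power_mult_distrib power2_norm_eq_inner)
qed simp

lemma norm_transpose: "norm (transpose A) = norm (A :: real^'n^'m)"
  using trace_mul_sym[of "transpose A" A] by (simp add: norm_eq_sqrt_inner inner_matrix_trace)

lemma inner_matrix_columns:
  fixes A C :: "real^'n^'m"
  shows "A \<bullet> C = (\<Sum>j\<in>UNIV. column j A \<bullet> column j C)"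
  unfolding inner_vec_def column_def by (simp add: inner_vec_def) (rule sum.swap)

text \<open>Expand \<open>C *v x\<close> by columns and apply the scalar identity to the product of
  \<open>F\<close> with the \<open>j\<close>-th column, in direction of the \<open>j\<close>-th
  axis.\<close>

theorem stein_identity:
  fixes F :: "real^'n \<Rightarrow> real^'n" and J :: "real^'n \<Rightarrow> real^'n^'n"
  assumes deriv: "\<And>x. (F has_derivative (\<lambda>h. J x *v h)) (at x)" and cont: "continuous_on UNIV J"
    and F: "\<And>x. norm (F x) \<le> K * (1 + norm x)" and J: "\<And>x. norm (J x) \<le> K"
  shows "(\<integral>x. F x \<bullet> (C *v x) \<partial>stdgauss) = (\<integral>x. J x \<bullet> C \<partial>stdgauss)"
    and "integrable stdgauss (\<lambda>x. F x \<bullet> (C *v x))" "integrable stdgauss (\<lambda>x. J x \<bullet> C)"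
proof -
  define f where "f j x = F x \<bullet> column j C" for j x
  define G where "G j x = transpose (J x) *v column j C" for j x
  have Fx: "F x \<bullet> (C *v x) = (\<Sum>j\<in>UNIV. f j x * (x \<bullet> axis j 1))" for x
    by (simp add: f_def matrix_mult_sum inner_sum_right inner_axis scalar_mult_eq_scaleR mult.commute)
  have Gx: "J x \<bullet> C = (\<Sum>j\<in>UNIV. G j x \<bullet> axis j 1)" for x
  proof -
    have "G j x \<bullet> axis j 1 = column j (J x) \<bullet> column j C" for j
      unfolding inner_axis G_def
      by (simp add: matrix_vector_mul_component transpose_def column_def inner_vec_def del: transpose_matrix_vector)
    then show ?thesis by (simp add: inner_matrix_columns)
  qed
  have s: "(\<integral>x. f j x * (x \<bullet> v) \<partial>stdgauss) = (\<integral>x. G j x \<bullet> v \<partial>stdgauss)"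
    "integrable stdgauss (\<lambda>x. f j x * (x \<bullet> v))" "integrable stdgauss (\<lambda>x. G j x \<bullet> v)" for j v
  proof -
    have 1: "(f j has_derivative (\<lambda>h. G j x \<bullet> h)) (at x)" for x
    proof -
      have "((\<lambda>x. F x \<bullet> column j C) has_derivative (\<lambda>h. (J x *v h) \<bullet> column j C)) (at x)"
        by (intro has_derivative_inner_left deriv)
      moreover have "(J x *v h) \<bullet> column j C = G j x \<bullet> h" for h
        unfolding G_def by (subst inner_commute) (rule inner_matrix_vector_transpose)
      ultimately show ?thesis by (simp add: f_def[abs_def])
    qed
    have 2: "continuous_on UNIV (G j)"
      unfolding G_def by (intro continuous_intros cont)
    have 3: "\<bar>f j x\<bar> \<le> K * norm (column j C) * (1 + norm x)" for x
    proof -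
      have "\<bar>f j x\<bar> \<le> norm (F x) * norm (column j C)"
        unfolding f_def by (rule Cauchy_Schwarz_ineq2)
      also have "\<dots> \<le> K * (1 + norm x) * norm (column j C)" by (intro mult_right_mono F) simp
      finally show ?thesis by (simp add: mult_ac)
    qed
    have 4: "norm (G j x) \<le> K * norm (column j C)" for x
    proof -
      have "norm (G j x) \<le> norm (J x) * norm (column j C)"
        unfolding G_def using norm_matrix_vector_le[of "transpose (J x)"] by (simp only: norm_transpose)
      also have "\<dots> \<le> K * norm (column j C)" by (intro mult_right_mono J) simp
      finally show ?thesis .
    qed
    show "(\<integral>x. f j x * (x \<bullet> v) \<partial>stdgauss) = (\<integral>x. G j x \<bullet> v \<partial>stdgauss)"
      "integrable stdgauss (\<lambda>x. f j x * (x \<bullet> v))" "integrable stdgauss (\<lambda>x. G j x \<bullet> v)"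
      by (rule stein_identity_scalar[OF 1 2 3 4])+
  qed
  show "integrable stdgauss (\<lambda>x. F x \<bullet> (C *v x))" "integrable stdgauss (\<lambda>x. J x \<bullet> C)"
    unfolding Fx Gx using s by auto
  show "(\<integral>x. F x \<bullet> (C *v x) \<partial>stdgauss) = (\<integral>x. J x \<bullet> C \<partial>stdgauss)"
    unfolding Fx Gx using s by simp
qed

text \<open>Stein's identity for a constant field and for the linear field
  \<open>A *v x\<close>.\<close>

lemma stdgauss_moments:
  fixes A C :: "real^'n^'n" and a :: "real^'n"
  shows "(\<integral>x. a \<bullet> (C *v x) \<partial>stdgauss) = 0" "integrable stdgauss (\<lambda>x. a \<bullet> (C *v x))"
    and "(\<integral>x. (A *v x) \<bullet> (C *v x) \<partial>stdgauss) = A \<bullet> C" "integrable stdgauss (\<lambda>x. (A *v x) \<bullet> (C *v x))"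
proof -
  interpret prob_space "stdgauss :: (real^'n) measure" by (rule prob_space_stdgauss)
  have 1: "((\<lambda>_. a) has_derivative (\<lambda>h. (0::real^'n^'n) *v h)) (at x)" for x :: "real^'n"
    by simp
  have 2: "norm a \<le> norm a * (1 + norm x)" "norm (0::real^'n^'n) \<le> norm a" for x :: "real^'n"
    by (auto simp: mult_le_cancel_left1)
  show "(\<integral>x. a \<bullet> (C *v x) \<partial>stdgauss) = 0" "integrable stdgauss (\<lambda>x. a \<bullet> (C *v x))"
    using stein_identity(1,2)[OF 1 continuous_on_const 2, of C] by simp_all
  have 3: "((\<lambda>x. A *v x) has_derivative (\<lambda>h. A *v h)) (at x)" for x
    by (rule bounded_linear_imp_has_derivative) (simp add: matrix_vector_mul_bounded_linear)
  have 4: "norm (A *v x) \<le> norm A * (1 + norm x)" for x :: "real^'n"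
    using norm_matrix_vector_le[of A x] by (simp add: distrib_left add_increasing)
  show "(\<integral>x. (A *v x) \<bullet> (C *v x) \<partial>stdgauss) = A \<bullet> C" "integrable stdgauss (\<lambda>x. (A *v x) \<bullet> (C *v x))"
    using stein_identity(1,2)[OF 3 continuous_on_const 4, of C] by (simp_all add: prob_space[simplified])
qed

lemma stdgauss_affine_moments:
  fixes A C :: "real^'n^'n" and a b :: "real^'n"
  shows "(\<integral>x. (a + A *v x) \<bullet> (b + C *v x) \<partial>stdgauss) = a \<bullet> b + A \<bullet> C"
    and "integrable stdgauss (\<lambda>x. (a + A *v x) \<bullet> (b + C *v x))"
proof -
  interpret prob_space "stdgauss :: (real^'n) measure" by (rule prob_space_stdgauss)
  have eq: "(a + A *v x) \<bullet> (b + C *v x) = a \<bullet> b + a \<bullet> (C *v x) + b \<bullet> (A *v x) + (A *v x) \<bullet> (C *v x)" for x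
    by (simp add: inner_add_left inner_add_right inner_commute)
  note i = stdgauss_moments(2)[of a C] stdgauss_moments(2)[of b A] stdgauss_moments(4)[of A C]
  show "integrable stdgauss (\<lambda>x. (a + A *v x) \<bullet> (b + C *v x))"
    unfolding eq using i by simp
  show "(\<integral>x. (a + A *v x) \<bullet> (b + C *v x) \<partial>stdgauss) = a \<bullet> b + A \<bullet> C"
    unfolding eq using i by (simp add: stdgauss_moments prob_space[simplified])
qed

lemma stdgauss_norm_affine:
  fixes A :: "real^'n^'n" and a :: "real^'n"
  shows "(\<integral>x. (norm (a + A *v x))\<^sup>2 \<partial>stdgauss) = (norm a)\<^sup>2 + (norm A)\<^sup>2"
    and "integrable stdgauss (\<lambda>x. (norm (a + A *v x))\<^sup>2)"
  using stdgauss_affine_moments[of a A a A] by (simp_all add: power2_norm_eq_inner)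

section \<open>Entropy, quadratic expectations and transport cost of Gaussian measures\<close>

lemma integral_gauss_affine:
  fixes f :: "real^'n \<Rightarrow> 'b::{banach, second_countable_topology}"
  assumes "det B \<noteq> 0" and [measurable]: "f \<in> borel_measurable borel"
  shows "(\<integral>x. f x \<partial>gauss m (B ** transpose B)) = (\<integral>x. f (m + B *v x) \<partial>stdgauss)"
    and "integrable (gauss m (B ** transpose B)) f \<longleftrightarrow> integrable stdgauss (\<lambda>x. f (m + B *v x))"
  unfolding gauss_affine[OF assms(1)] by (auto simp: integral_distr integrable_distr_eq)

lemma entropy_gauss:
  fixes B :: "real^'n^'n"
  assumes B: "det B \<noteq> 0"
  shows "entropy_dens (gdens m (B ** transpose B))
       = - (1/2) * ln (det (B ** transpose B)) - (1/2) * ln ((2 * pi) ^ CARD('n)) - real CARD('n) / 2"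
proof -
  interpret prob_space "stdgauss :: (real^'n) measure" by (rule prob_space_stdgauss)
  let ?p = "gdens m (B ** transpose B)"
  have p0: "0 \<le> ?p x" for x
    by (simp add: gdens_def det_mul)
  have lnp: "ln (?p (m + B *v x)) = - (norm x)\<^sup>2 / 2 - (1/2) * ln ((2 * pi) ^ CARD('n)) - ln \<bar>det B\<bar>" for x
    using B by (simp add: gdens_affine gdens_std ln_div ln_mult ln_sqrt)
  have "entropy_dens ?p = (\<integral>x. ?p x *\<^sub>R ln (?p x) \<partial>lborel)"
    by (simp add: entropy_dens_def)
  also have "\<dots> = (\<integral>x. ln (?p x) \<partial>gauss m (B ** transpose B))"
    unfolding gauss_def by (rule integral_density[symmetric]) (auto simp: p0)
  also have "\<dots> = (\<integral>x. ln (?p (m + B *v x)) \<partial>stdgauss)"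
    by (rule integral_gauss_affine(1)[OF B]) simp
  also have "\<dots> = - real CARD('n) / 2 - (1/2) * ln ((2 * pi) ^ CARD('n)) - ln \<bar>det B\<bar>"
  proof -
    have 1: "integrable stdgauss (\<lambda>x::real^'n. (norm x)\<^sup>2)" "(\<integral>(x::real^'n). (norm x)\<^sup>2 \<partial>stdgauss) = CARD('n)"
      using stdgauss_norm_affine[of 0 "mat 1 :: real^'n^'n"]
      by (simp_all add: power2_norm_eq_inner inner_matrix_trace trace_I)
    show ?thesis
      unfolding lnp using 1 by (simp add: prob_space[simplified])
  qed
  also have "ln \<bar>det B\<bar> = (1/2) * ln (det (B ** transpose B))"
  proof -
    have "det (B ** transpose B) = \<bar>det B\<bar> * \<bar>det B\<bar>" by (simp add: det_mul)
    moreover have "ln (\<bar>det B\<bar> * \<bar>det B\<bar>) = ln \<bar>det B\<bar> + ln \<bar>det B\<bar>"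
      using B ln_mult_pos[of "\<bar>det B\<bar>" "\<bar>det B\<bar>"] by simp
    ultimately have "ln (det (B ** transpose B)) = 2 * ln \<bar>det B\<bar>"
      by (simp only: mult_2)
    then show ?thesis by simp
  qed
  finally show ?thesis by simp
qed

lemma gauss_quadratic_expectation:
  fixes A S :: "real^'n^'n"
  assumes S: "spd S" and A: "transpose A = A"
  shows "(\<integral>x. (x - m) \<bullet> (A *v (x - m)) + a \<bullet> (x - m) \<partial>gauss m S) = trace (A ** S)"
    and "integrable (gauss m S) (\<lambda>x. (x - m) \<bullet> (A *v (x - m)) + a \<bullet> (x - m))"
proof -
  let ?B = "psd_sqrt S"
  have B: "?B ** transpose ?B = S" "det ?B \<noteq> 0"
    using spd_sqrt[OF S] det_spd[of ?B] by (auto simp: spd_def)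
  have eq: "(\<lambda>x. (?B *v x) \<bullet> (A *v (?B *v x)) + a \<bullet> (?B *v x)) = (\<lambda>x. (?B *v x) \<bullet> ((A ** ?B) *v x) + a \<bullet> (?B *v x))"
    by (simp add: matrix_vector_mul_assoc)
  note m = stdgauss_moments(3,4)[of ?B "A ** ?B"] stdgauss_moments(1,2)[of a ?B]
  show "(\<integral>x. (x - m) \<bullet> (A *v (x - m)) + a \<bullet> (x - m) \<partial>gauss m S) = trace (A ** S)"
    using integral_gauss_affine(1)[OF B(2), of "\<lambda>x. (x - m) \<bullet> (A *v (x - m)) + a \<bullet> (x - m)" m] m
    by (simp add: B(1) eq inner_matrix_mult_self[OF A])
  show "integrable (gauss m S) (\<lambda>x. (x - m) \<bullet> (A *v (x - m)) + a \<bullet> (x - m))"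
    using integral_gauss_affine(2)[OF B(2), of "\<lambda>x. (x - m) \<bullet> (A *v (x - m)) + a \<bullet> (x - m)" m] m
    by (simp add: B(1) eq)
qed

text \<open>Kantorovich duality with the quadratic potentials given by the transport matrix.\<close>
lemma bures_le_W2sq:
  fixes m mh :: "real^'n"
  assumes S: "spd S" and C: "spd C"
  shows "ennreal ((norm (m - mh))\<^sup>2 + bures C S) \<le> W2sq (gauss m S) (gauss mh C)"
  unfolding W2sq_def
proof (rule INF_greatest)
  fix \<gamma> assume "\<gamma> \<in> couplings (gauss m S) (gauss mh C)"
  then have sets[measurable_cong]: "sets \<gamma> = sets borel"
    and d1: "distr \<gamma> borel fst = gauss m S" and d2: "distr \<gamma> borel snd = gauss mh C"
    by (auto simp: couplings_def)
  obtain T where T: "spd T" "T ** S ** T = C" "bures C S = trace S + trace C - 2 * trace (T ** S)"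
    using transport_matrix[OF C S] .
  define d where "d = m - mh"
  \<comment> \<open>The quadratic parts of \<open>f\<close> and \<open>g\<close> form a dual pair by
    Young's inequality for \<open>T\<close>; the linear parts have mean zero and account for the
    difference \<open>d\<close> of the means.\<close>
  define f where "f x = (x - m) \<bullet> ((mat 1 - T) *v (x - m)) + (2 *\<^sub>R d) \<bullet> (x - m)" for x
  define g where "g y = (y - mh) \<bullet> ((mat 1 - matrix_inv T) *v (y - mh)) + (- 2 *\<^sub>R d) \<bullet> (y - mh)" for y
  have sub: "(mat 1 - A) ** B = B - A ** B" for A B :: "real^'n^'n"
    using bounded_bilinear.diff_left[OF bilinear_matrix_matrix_mult, of "mat 1" A B] by simp
  have sym: "transpose (mat 1 - T) = mat 1 - T" "transpose (mat 1 - matrix_inv T) = mat 1 - matrix_inv T"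
    using T(1) spd_matrix_inv(1)[OF T(1)] by (auto simp: spd_def transpose_def vec_eq_iff mat_def)
  note qf = gauss_quadratic_expectation[OF S sym(1), of m "2 *\<^sub>R d", folded f_def]
  note qg = gauss_quadratic_expectation[OF C sym(2), of mh "- 2 *\<^sub>R d", folded g_def]
  have [measurable]: "f \<in> borel_measurable borel" "g \<in> borel_measurable borel"
    unfolding f_def g_def by measurable
  have [measurable]: "fst \<in> measurable \<gamma> borel" "snd \<in> measurable \<gamma> borel"
    unfolding measurable_cong_sets[OF sets refl] borel_prod[symmetric] by auto
  \<comment> \<open>\<open>couplings\<close> does not mention total mass; that
    \<open>\<gamma>\<close> is a probability measure is inherited from its first marginal.\<close>
  have "prob_space (distr \<gamma> borel fst)"
    unfolding d1 by (rule prob_space_gauss[OF S])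
  then interpret prob_space \<gamma>
    by (rule prob_space_distrD[rotated]) simp
  have i: "integrable \<gamma> (\<lambda>p. f (fst p))" "integrable \<gamma> (\<lambda>p. g (snd p))"
    using qf(2) qg(2) unfolding d1[symmetric] d2[symmetric] by (auto simp: integrable_distr_eq)
  have e: "(\<integral>p. f (fst p) \<partial>\<gamma>) = trace S - trace (T ** S)" "(\<integral>p. g (snd p) \<partial>\<gamma>) = trace C - trace (T ** S)"
    using qf(1) qg(1) transport_matrix_inverse_trace[OF T(1,2)] unfolding d1[symmetric] d2[symmetric]
    by (auto simp: integral_distr sub trace_sub)
  define h where "h p = (norm d)\<^sup>2 + f (fst p) + g (snd p)" for p
  have ih: "integrable \<gamma> h" unfolding h_def using i by auto
  have eh: "(\<integral>p. h p \<partial>\<gamma>) = (norm (m - mh))\<^sup>2 + bures C S"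
    unfolding h_def using i e T(3) by (simp add: prob_space d_def)
  have hle: "h p \<le> (norm (fst p - snd p))\<^sup>2" for p
  proof -
    define x y where "x = fst p - m" and "y = snd p - mh"
    have "fst p - snd p = d + x - y" by (simp add: d_def x_def y_def)
    then have "(norm (fst p - snd p))\<^sup>2 = (norm d)\<^sup>2 + x \<bullet> x + y \<bullet> y + 2 * (d \<bullet> x) - 2 * (d \<bullet> y) - 2 * (x \<bullet> y)"
      unfolding power2_norm_eq_inner by (simp add: inner_add_left inner_add_right inner_diff_left inner_diff_right inner_commute)
    moreover have "h p = (norm d)\<^sup>2 + x \<bullet> x + y \<bullet> y + 2 * (d \<bullet> x) - 2 * (d \<bullet> y) - (x \<bullet> (T *v x) + y \<bullet> (matrix_inv T *v y))"
      unfolding h_def f_def g_def x_def[symmetric] y_def[symmetric]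
      by (simp add: matrix_vector_mult_diff_rdistrib inner_diff_right)
    ultimately show ?thesis
      using young_spd(1)[OF T(1), of x y] by linarith
  qed
  \<comment> \<open>The dual function \<open>h\<close> may be negative at some points, where
    \<open>ennreal\<close> would cut it off, so its positive part is integrated.\<close>
  have "ennreal ((norm (m - mh))\<^sup>2 + bures C S) \<le> ennreal (\<integral>p. max 0 (h p) \<partial>\<gamma>)"
    unfolding eh[symmetric] using ih by (intro ennreal_leI integral_mono integrable_max) auto
  also have "\<dots> = (\<integral>\<^sup>+p. ennreal (max 0 (h p)) \<partial>\<gamma>)"
    using ih by (intro nn_integral_eq_integral[symmetric] integrable_max) auto
  also have "\<dots> \<le> (\<integral>\<^sup>+p. ennreal ((norm (fst p - snd p))\<^sup>2) \<partial>\<gamma>)"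
    using hle by (intro nn_integral_mono ennreal_leI) auto
  finally show "ennreal ((norm (m - mh))\<^sup>2 + bures C S) \<le> (\<integral>\<^sup>+p. ennreal ((norm (fst p - snd p))\<^sup>2) \<partial>\<gamma>)" .
qed

section \<open>Convex smooth potentials\<close>

text \<open>The Loewner bounds appear as quadratic forms, which see only the symmetric part of
  \<open>hessV\<close>. Symmetry itself is derived below from continuity.\<close>

locale convex_smooth_potential =
  fixes V :: "real^'n \<Rightarrow> real" and gradV :: "real^'n \<Rightarrow> real^'n" and hessV :: "real^'n \<Rightarrow> real^'n^'n"
    and \<beta> :: real
  assumes grad: "\<And>x. (V has_derivative (\<lambda>h. gradV x \<bullet> h)) (at x)"
    and hess: "\<And>x. (gradV has_derivative (\<lambda>h. hessV x *v h)) (at x)"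
    and hess_cont: "continuous_on UNIV hessV"
    and hess_ge: "\<And>x h. 0 \<le> h \<bullet> (hessV x *v h)"
    and hess_le: "\<And>x h. h \<bullet> (hessV x *v h) \<le> \<beta> * (h \<bullet> h)"
    and beta_pos: "0 < \<beta>"
begin

lemma continuous_V: "continuous_on UNIV V" and continuous_gradV: "continuous_on UNIV gradV"
  using grad hess by (auto simp: continuous_on_eq_continuous_at intro: has_derivative_continuous)

lemma measurable_V [measurable]: "V \<in> borel_measurable borel"
  and measurable_gradV [measurable]: "gradV \<in> borel_measurable borel"
  and measurable_hessV [measurable]: "hessV \<in> borel_measurable borel"
  using continuous_V continuous_gradV hess_cont by (auto intro: borel_measurable_continuous_onI)

lemma V_line: "((\<lambda>t. V (x + t *\<^sub>R d)) has_real_derivative gradV (x + t *\<^sub>R d) \<bullet> d) (at t)"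
proof -
  have "((\<lambda>t. x + t *\<^sub>R d) has_derivative (\<lambda>t. t *\<^sub>R d)) (at t)"
    by (auto intro!: derivative_eq_intros)
  from has_derivative_compose[OF this, of V "\<lambda>h. gradV (x + t *\<^sub>R d) \<bullet> h"] grad[of "x + t *\<^sub>R d"]
  show ?thesis by (simp add: has_field_derivative_def mult.commute[of _ "_ \<bullet> _"])
qed

lemma gradV_line:
  "((\<lambda>t. gradV (x + t *\<^sub>R d) \<bullet> e) has_real_derivative e \<bullet> (hessV (x + t *\<^sub>R d) *v d)) (at t)"
proof -
  have "((\<lambda>t. x + t *\<^sub>R d) has_derivative (\<lambda>t. t *\<^sub>R d)) (at t)"
    by (auto intro!: derivative_eq_intros)
  from has_derivative_compose[OF this hess[of "x + t *\<^sub>R d"]]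
  have "((\<lambda>t. gradV (x + t *\<^sub>R d)) has_derivative (\<lambda>s. hessV (x + t *\<^sub>R d) *v (s *\<^sub>R d))) (at t)" .
  from has_derivative_inner_left[OF this, of e] show ?thesis
    by (simp add: has_field_derivative_def matrix_vector_mult_scaleR mult.commute[of _ "_ \<bullet> _"] inner_commute)
qed

text \<open>The mean value theorem is used twice, along \<open>a\<close> and then along
  \<open>b\<close>. The left side is symmetric in \<open>a\<close> and \<open>b\<close>, which is
  what the symmetry of the Hessian rests on.\<close>

lemma second_difference:
  assumes "0 < s"
  obtains \<sigma> \<tau> where "0 < \<sigma>" "\<sigma> < s" "0 < \<tau>" "\<tau> < s"
    "V (x + s *\<^sub>R a + s *\<^sub>R b) - V (x + s *\<^sub>R a) - V (x + s *\<^sub>R b) + V x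
      = s * s * (a \<bullet> (hessV (x + \<sigma> *\<^sub>R a + \<tau> *\<^sub>R b) *v b))"
proof -
  have "((\<lambda>r. V (x + s *\<^sub>R b + r *\<^sub>R a) - V (x + r *\<^sub>R a)) has_real_derivative
      gradV (x + s *\<^sub>R b + r *\<^sub>R a) \<bullet> a - gradV (x + r *\<^sub>R a) \<bullet> a) (at r)" for r
    by (intro DERIV_diff V_line)
  from MVT2[OF assms this] obtain \<sigma> where \<sigma>: "0 < \<sigma>" "\<sigma> < s"
    "V (x + s *\<^sub>R b + s *\<^sub>R a) - V (x + s *\<^sub>R a) - (V (x + s *\<^sub>R b) - V x)
      = s * (gradV (x + s *\<^sub>R b + \<sigma> *\<^sub>R a) \<bullet> a - gradV (x + \<sigma> *\<^sub>R a) \<bullet> a)"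
    by auto
  from MVT2[OF assms gradV_line[of "x + \<sigma> *\<^sub>R a" b a]] obtain \<tau> where \<tau>: "0 < \<tau>" "\<tau> < s"
    "gradV (x + \<sigma> *\<^sub>R a + s *\<^sub>R b) \<bullet> a - gradV (x + \<sigma> *\<^sub>R a) \<bullet> a
      = s * (a \<bullet> (hessV (x + \<sigma> *\<^sub>R a + \<tau> *\<^sub>R b) *v b))"
    by auto
  have "V (x + s *\<^sub>R a + s *\<^sub>R b) - V (x + s *\<^sub>R a) - V (x + s *\<^sub>R b) + V x
      = s * (gradV (x + \<sigma> *\<^sub>R a + s *\<^sub>R b) \<bullet> a - gradV (x + \<sigma> *\<^sub>R a) \<bullet> a)"
    using \<sigma>(3) by (simp add: add.assoc add.commute[of "s *\<^sub>R b"])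
  with \<sigma> \<tau> show thesis
    using that by (simp add: mult.assoc)
qed

text \<open>Schwarz's theorem: evaluate the same second difference in both orders, divide by
  \<open>s n * s n\<close>, and let the intermediate points tend to \<open>x\<close>.\<close>

lemma hessV_swap: "a \<bullet> (hessV x *v b) = b \<bullet> (hessV x *v a)"
proof -
  define s where "s n = 1 / real (Suc n)" for n
  have s0: "0 < s n" for n by (simp add: s_def)
  have slim: "s \<longlonglongrightarrow> 0" unfolding s_def by (rule LIMSEQ_Suc[OF lim_1_over_n])
  have "\<exists>\<sigma> \<tau> \<sigma>' \<tau>'. 0 < \<sigma> \<and> \<sigma> < s n \<and> 0 < \<tau> \<and> \<tau> < s n \<and> 0 < \<sigma>' \<and> \<sigma>' < s n \<and> 0 < \<tau>' \<and> \<tau>' < s n \<and>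
      a \<bullet> (hessV (x + \<sigma> *\<^sub>R a + \<tau> *\<^sub>R b) *v b) = b \<bullet> (hessV (x + \<sigma>' *\<^sub>R b + \<tau>' *\<^sub>R a) *v a)" for n
  proof -
    obtain \<sigma> \<tau> where 1: "0 < \<sigma>" "\<sigma> < s n" "0 < \<tau>" "\<tau> < s n"
      "V (x + s n *\<^sub>R a + s n *\<^sub>R b) - V (x + s n *\<^sub>R a) - V (x + s n *\<^sub>R b) + V x
        = s n * s n * (a \<bullet> (hessV (x + \<sigma> *\<^sub>R a + \<tau> *\<^sub>R b) *v b))"
      using second_difference[OF s0] .
    obtain \<sigma>' \<tau>' where 2: "0 < \<sigma>'" "\<sigma>' < s n" "0 < \<tau>'" "\<tau>' < s n"
      "V (x + s n *\<^sub>R b + s n *\<^sub>R a) - V (x + s n *\<^sub>R b) - V (x + s n *\<^sub>R a) + V x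
        = s n * s n * (b \<bullet> (hessV (x + \<sigma>' *\<^sub>R b + \<tau>' *\<^sub>R a) *v a))"
      using second_difference[OF s0] .
    have "V (x + s n *\<^sub>R b + s n *\<^sub>R a) = V (x + s n *\<^sub>R a + s n *\<^sub>R b)"
      by (simp only: add.assoc add.commute[of "s n *\<^sub>R b"])
    then have "s n * s n * (a \<bullet> (hessV (x + \<sigma> *\<^sub>R a + \<tau> *\<^sub>R b) *v b))
        = s n * s n * (b \<bullet> (hessV (x + \<sigma>' *\<^sub>R b + \<tau>' *\<^sub>R a) *v a))"
      using 1(5) 2(5) by linarith
    then have "a \<bullet> (hessV (x + \<sigma> *\<^sub>R a + \<tau> *\<^sub>R b) *v b) = b \<bullet> (hessV (x + \<sigma>' *\<^sub>R b + \<tau>' *\<^sub>R a) *v a)"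
      using s0[of n] by simp
    with 1 2 show ?thesis by blast
  qed
  then obtain \<sigma> \<tau> \<sigma>' \<tau>' where
    b: "\<And>n. 0 < \<sigma> n \<and> \<sigma> n < s n \<and> 0 < \<tau> n \<and> \<tau> n < s n \<and> 0 < \<sigma>' n \<and> \<sigma>' n < s n \<and> 0 < \<tau>' n \<and> \<tau>' n < s n"
    and eq: "\<And>n. a \<bullet> (hessV (x + \<sigma> n *\<^sub>R a + \<tau> n *\<^sub>R b) *v b) = b \<bullet> (hessV (x + \<sigma>' n *\<^sub>R b + \<tau>' n *\<^sub>R a) *v a)"
    by metis
  have z: "f \<longlonglongrightarrow> 0" if "\<And>n. 0 < f n \<and> f n < s n" for f :: "nat \<Rightarrow> real"
    by (rule tendsto_sandwich[OF _ _ tendsto_const slim]) (intro always_eventually allI less_imp_le; use that in blast)+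
  have lim: "(\<lambda>n. d \<bullet> (hessV (x + f n *\<^sub>R d + g n *\<^sub>R e) *v e)) \<longlonglongrightarrow> d \<bullet> (hessV x *v e)"
    if "f \<longlonglongrightarrow> 0" "g \<longlonglongrightarrow> 0" for f g d e
  proof -
    have "(\<lambda>n. x + f n *\<^sub>R d + g n *\<^sub>R e) \<longlonglongrightarrow> x + 0 *\<^sub>R d + 0 *\<^sub>R e"
      by (intro tendsto_intros that)
    moreover have "continuous_on UNIV (\<lambda>y. d \<bullet> (hessV y *v e))"
      by (intro continuous_intros hess_cont)
    then have "isCont (\<lambda>y. d \<bullet> (hessV y *v e)) x"
      by (simp add: continuous_on_eq_continuous_at)
    ultimately show ?thesis
      using isCont_tendsto_compose[of x "\<lambda>y. d \<bullet> (hessV y *v e)"] by simp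
  qed
  have "(\<lambda>n. a \<bullet> (hessV (x + \<sigma> n *\<^sub>R a + \<tau> n *\<^sub>R b) *v b)) \<longlonglongrightarrow> a \<bullet> (hessV x *v b)"
    "(\<lambda>n. b \<bullet> (hessV (x + \<sigma>' n *\<^sub>R b + \<tau>' n *\<^sub>R a) *v a)) \<longlonglongrightarrow> b \<bullet> (hessV x *v a)"
    by (intro lim z; use b in blast)+
  then show ?thesis
    unfolding eq by (rule LIMSEQ_unique)
qed

lemma hessV_symmetric: "transpose (hessV x) = hessV x"
proof -
  have "transpose (hessV x) *v h = hessV x *v h" for h
  proof (rule vector_eq_ldot[THEN iffD1], intro allI)
    fix y
    show "y \<bullet> (transpose (hessV x) *v h) = y \<bullet> (hessV x *v h)"
      using hessV_swap[of y x h] inner_matrix_vector_transpose[of h "hessV x" y] by (metis inner_commute)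
  qed
  then show ?thesis by (simp add: matrix_eq del: transpose_matrix_vector)
qed

lemma taylor2: obtains t where "V (x + d) = V x + gradV x \<bullet> d + (d \<bullet> (hessV (x + t *\<^sub>R d) *v d)) / 2"
proof -
  define D where "D m t = (if m = 0 then V (x + t *\<^sub>R d)
    else if m = 1 then gradV (x + t *\<^sub>R d) \<bullet> d else d \<bullet> (hessV (x + t *\<^sub>R d) *v d))" for m :: nat and t
  have "\<forall>m t. m < 2 \<and> 0 \<le> t \<and> t \<le> 1 \<longrightarrow> DERIV (D m) t :> D (Suc m) t"
    using V_line[of x d] gradV_line[of x d d] by (auto simp: D_def[abs_def] less_2_cases_iff)
  from Maclaurin[of 1 2 D "D 0", OF _ _ _ this] obtain t
    where "D 0 1 = (\<Sum>m<2. D m 0 / fact m * 1 ^ m) + D 2 t / fact 2 * 1\<^sup>2"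
    by auto
  then have "V (x + d) = V x + gradV x \<bullet> d + (d \<bullet> (hessV (x + t *\<^sub>R d) *v d)) / 2"
    by (simp add: D_def numeral_2_eq_2)
  then show thesis using that by blast
qed

lemma V_first_order: "V x + gradV x \<bullet> (y - x) \<le> V y"
proof -
  obtain t where "V (x + (y - x)) = V x + gradV x \<bullet> (y - x) + ((y - x) \<bullet> (hessV (x + t *\<^sub>R (y - x)) *v (y - x))) / 2"
    using taylor2 .
  then show ?thesis
    using hess_ge[of "y - x" "x + t *\<^sub>R (y - x)"] by simp
qed

lemma V_descent: "V y \<le> V x + gradV x \<bullet> (y - x) + \<beta> / 2 * (norm (y - x))\<^sup>2"
proof -
  obtain t where "V (x + (y - x)) = V x + gradV x \<bullet> (y - x) + ((y - x) \<bullet> (hessV (x + t *\<^sub>R (y - x)) *v (y - x))) / 2"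
    using taylor2 .
  then show ?thesis
    using hess_le[of "y - x" "x + t *\<^sub>R (y - x)"] by (simp add: power2_norm_eq_inner)
qed

text \<open>Compare the linear lower bound from \<open>x\<close> with the quadratic upper bound from
  \<open>y\<close> at the point \<open>z\<close> where their difference is extremal.\<close>

lemma V_first_order_improved: "V x + gradV x \<bullet> (y - x) + (norm (gradV y - gradV x))\<^sup>2 / (2 * \<beta>) \<le> V y"
proof -
  define g where "g = gradV y - gradV x"
  define z where "z = y - (1 / \<beta>) *\<^sub>R g"
  have "V x + gradV x \<bullet> (z - x) \<le> V z" by (rule V_first_order)
  also have "V z \<le> V y + gradV y \<bullet> (z - y) + \<beta> / 2 * (norm (z - y))\<^sup>2" by (rule V_descent)
  also have "\<beta> / 2 * (norm (z - y))\<^sup>2 = (norm g)\<^sup>2 / (2 * \<beta>)"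
    using beta_pos by (simp add: z_def power_mult_distrib power_divide power2_eq_square)
  finally have "V x + gradV x \<bullet> (y - x) + (gradV y - gradV x) \<bullet> g / \<beta> \<le> V y + (norm g)\<^sup>2 / (2 * \<beta>)"
    by (simp add: z_def inner_diff_right inner_diff_left diff_divide_distrib)
  moreover have "(gradV y - gradV x) \<bullet> g / \<beta> = (norm g)\<^sup>2 / (2 * \<beta>) + (norm g)\<^sup>2 / (2 * \<beta>)"
    using beta_pos by (simp add: g_def power2_norm_eq_inner)
  ultimately show ?thesis unfolding g_def[symmetric] by linarith
qed

text \<open>The Baillon-Haddad inequality: add the improved first-order bound to itself with
  \<open>x\<close> and \<open>y\<close> exchanged.\<close>

lemma gradV_cocoercive: "(norm (gradV y - gradV x))\<^sup>2 \<le> \<beta> * ((gradV y - gradV x) \<bullet> (y - x))"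
proof -
  have "(norm (gradV y - gradV x))\<^sup>2 / (2 * \<beta>) + (norm (gradV x - gradV y))\<^sup>2 / (2 * \<beta>)
      \<le> (gradV y - gradV x) \<bullet> (y - x)"
    using V_first_order_improved[of x y] V_first_order_improved[of y x]
    by (simp add: inner_diff_left inner_diff_right)
  then have "(norm (gradV y - gradV x))\<^sup>2 / \<beta> \<le> (gradV y - gradV x) \<bullet> (y - x)"
    by (simp add: norm_minus_commute)
  then show ?thesis
    using beta_pos by (simp add: field_simps)
qed

lemma gradV_lipschitz: "norm (gradV y - gradV x) \<le> \<beta> * norm (y - x)"
proof (cases "gradV y = gradV x")
  case False
  have "norm (gradV y - gradV x) * norm (gradV y - gradV x) \<le> \<beta> * (norm (gradV y - gradV x) * norm (y - x))"
    using gradV_cocoercive[of y x] mult_left_mono[OF norm_cauchy_schwarz[of "gradV y - gradV x" "y - x"] less_imp_le[OF beta_pos]]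
    unfolding power2_eq_square by (rule order_trans)
  then have "norm (gradV y - gradV x) * norm (gradV y - gradV x) \<le> norm (gradV y - gradV x) * (\<beta> * norm (y - x))"
    by (simp add: mult_ac)
  then show ?thesis
    using False by (simp add: mult_le_cancel_left_pos)
qed (use beta_pos in simp)

text \<open>Infinitesimal co-coercivity, obtained from nonnegativity of the Hessian form at
  \<open>\<beta> *\<^sub>R v - u\<close> and the upper bound at \<open>u\<close>.\<close>

lemma hessV_square_le: "(norm (hessV x *v v))\<^sup>2 \<le> \<beta> * (v \<bullet> (hessV x *v v))"
proof -
  define u where "u = hessV x *v v"
  have sw: "v \<bullet> (hessV x *v u) = u \<bullet> u"
    using hessV_swap[of v x u] by (simp add: u_def)
  have "0 \<le> (\<beta> *\<^sub>R v - u) \<bullet> (hessV x *v (\<beta> *\<^sub>R v - u))" by (rule hess_ge)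
  also have "\<dots> = \<beta>\<^sup>2 * (v \<bullet> u) - 2 * \<beta> * (u \<bullet> u) + u \<bullet> (hessV x *v u)"
    using sw by (simp add: matrix_vector_mult_diff_distrib matrix_vector_mult_scaleR inner_diff_left inner_diff_right
        power2_eq_square u_def[symmetric] algebra_simps)
  also have "\<dots> \<le> \<beta>\<^sup>2 * (v \<bullet> u) - \<beta> * (u \<bullet> u)"
    using hess_le[of u x] by simp
  finally have "\<beta> * (u \<bullet> u) \<le> \<beta> * (\<beta> * (v \<bullet> u))"
    by (simp add: power2_eq_square)
  then show ?thesis
    using beta_pos by (simp add: u_def power2_norm_eq_inner)
qed

lemma hessV_mult_square_le: "(norm (hessV x ** B))\<^sup>2 \<le> \<beta> * ((hessV x ** B) \<bullet> B)"
proof -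
  have col: "column j (hessV x ** B) = hessV x *v column j B" for j
    by (simp add: vec_eq_iff column_def matrix_matrix_mult_def matrix_vector_mult_def)
  have "(norm (hessV x ** B))\<^sup>2 = (\<Sum>j\<in>UNIV. (norm (hessV x *v column j B))\<^sup>2)"
    unfolding power2_norm_eq_inner inner_matrix_columns col ..
  also have "\<dots> \<le> (\<Sum>j\<in>UNIV. \<beta> * (column j B \<bullet> (hessV x *v column j B)))"
    by (intro sum_mono hessV_square_le)
  also have "\<dots> = \<beta> * ((hessV x ** B) \<bullet> B)"
    unfolding inner_matrix_columns col sum_distrib_left by (simp add: inner_commute)
  finally show ?thesis .
qed

lemma norm_hessV_mult_le: "norm (hessV x ** B) \<le> \<beta> * norm B"
proof (cases "hessV x ** B = 0")
  case False
  have "norm (hessV x ** B) * norm (hessV x ** B) \<le> \<beta> * (norm (hessV x ** B) * norm B)"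
    using hessV_mult_square_le[of x B] mult_left_mono[OF norm_cauchy_schwarz[of "hessV x ** B" B] less_imp_le[OF beta_pos]]
    unfolding power2_eq_square by (rule order_trans)
  then have "norm (hessV x ** B) * norm (hessV x ** B) \<le> norm (hessV x ** B) * (\<beta> * norm B)"
    by (simp add: mult_ac)
  then show ?thesis
    using False by (simp add: mult_le_cancel_left_pos)
qed (use beta_pos in simp)

lemma abs_V_le: "\<bar>V x\<bar> \<le> (\<bar>V 0\<bar> + norm (gradV 0) + \<beta>) * (1 + (norm x)\<^sup>2)"
proof -
  have "\<bar>V x\<bar> \<le> \<bar>V 0\<bar> + \<bar>gradV 0 \<bullet> x\<bar> + \<beta> / 2 * (norm x)\<^sup>2"
    using V_first_order[of 0 x] V_descent[of x 0] beta_pos mult_nonneg_nonneg[of "\<beta> / 2" "(norm x)\<^sup>2"] by simp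
  also have "\<bar>gradV 0 \<bullet> x\<bar> \<le> norm (gradV 0) * norm x" by (rule Cauchy_Schwarz_ineq2)
  also have "\<dots> \<le> norm (gradV 0) * (1 + (norm x)\<^sup>2)"
  proof (rule mult_left_mono)
    have "2 * norm x \<le> 1 + (norm x)\<^sup>2"
      using zero_le_power2[of "norm x - 1"] by (simp add: power2_diff)
    then show "norm x \<le> 1 + (norm x)\<^sup>2" using norm_ge_zero[of x] by linarith
  qed simp
  finally have 1: "\<bar>V x\<bar> \<le> \<bar>V 0\<bar> + norm (gradV 0) * (1 + (norm x)\<^sup>2) + \<beta> / 2 * (norm x)\<^sup>2" by simp
  have 2: "\<beta> / 2 * (norm x)\<^sup>2 \<le> \<beta> * (1 + (norm x)\<^sup>2)"
    using beta_pos by (simp add: distrib_left)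
  have 3: "\<bar>V 0\<bar> \<le> \<bar>V 0\<bar> * (1 + (norm x)\<^sup>2)" by (simp add: distrib_left)
  show ?thesis
    unfolding distrib_right using 1 2 3 by linarith
qed

end

section \<open>The lifted potential and one step of the algorithm\<close>

lemma integrable_stdgauss_affine:
  fixes f :: "real^'n \<Rightarrow> 'b::{banach, second_countable_topology}" and B :: "real^'n^'n"
  assumes [measurable]: "f \<in> borel_measurable borel" and le: "\<And>x. norm (f x) \<le> K * (1 + (norm x)\<^sup>2)"
  shows "integrable stdgauss (\<lambda>x. f (m + B *v x))"
proof (rule integrable_stdgauss)
  fix x :: "real^'n"
  have K: "0 \<le> K" using order_trans[OF norm_ge_zero le[of 0]] by simp
  have "norm (m + B *v x) \<le> norm m + norm B * norm x"
    using norm_triangle_ineq[of m "B *v x"] norm_matrix_vector_le[of B x] by linarith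
  then have "(norm (m + B *v x))\<^sup>2 \<le> (norm m + norm B * norm x)\<^sup>2"
    by (rule power_mono) simp
  also have "\<dots> \<le> 2 * (norm m)\<^sup>2 + 2 * ((norm B)\<^sup>2 * (norm x)\<^sup>2)"
    using zero_le_power2[of "norm m - norm B * norm x"]
    unfolding power2_sum power2_diff power_mult_distrib by (simp add: mult.commute)
  also have "\<dots> \<le> (2 * (norm m)\<^sup>2 + 2 * (norm B)\<^sup>2) * (1 + (norm x)\<^sup>2)"
    by (simp add: algebra_simps)
  finally have "1 + (norm (m + B *v x))\<^sup>2 \<le> (1 + (norm x)\<^sup>2) + (2 * (norm m)\<^sup>2 + 2 * (norm B)\<^sup>2) * (1 + (norm x)\<^sup>2)"
    using zero_le_power2[of "norm x"] by linarith
  then have "1 + (norm (m + B *v x))\<^sup>2 \<le> (1 + 2 * (norm m)\<^sup>2 + 2 * (norm B)\<^sup>2) * (1 + (norm x)\<^sup>2)"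
    by (simp add: algebra_simps)
  then have "K * (1 + (norm (m + B *v x))\<^sup>2) \<le> K * ((1 + 2 * (norm m)\<^sup>2 + 2 * (norm B)\<^sup>2) * (1 + (norm x)\<^sup>2))"
    using K by (rule mult_left_mono)
  then show "norm (f (m + B *v x)) \<le> K * (1 + 2 * (norm m)\<^sup>2 + 2 * (norm B)\<^sup>2) * (1 + (norm x)\<^sup>2)"
    using le[of "m + B *v x"] by (simp add: mult.assoc)
qed simp

lemma norm_diff_square:
  fixes a b :: "'a::real_inner"
  shows "(norm (a - b))\<^sup>2 = (norm a)\<^sup>2 - 2 * (a \<bullet> b) + (norm b)\<^sup>2"
  unfolding power2_norm_eq_inner by (simp add: inner_diff_left inner_diff_right inner_commute)

lemma det_factor_nonzero:
  fixes B :: "real^'n^'n"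
  assumes "spd S" "B ** transpose B = S"
  shows "det B \<noteq> 0"
  using det_spd[OF assms(1)] unfolding assms(2)[symmetric] det_mul by auto

lemma (in prob_space) variance_le_second_moment:
  fixes X :: "'a \<Rightarrow> 'b::euclidean_space"
  assumes X: "integrable M X" and X2: "integrable M (\<lambda>x. (norm (X x - c))\<^sup>2)"
  shows "integrable M (\<lambda>x. (norm (X x - expectation X))\<^sup>2)"
    and "expectation (\<lambda>x. (norm (X x - expectation X))\<^sup>2) \<le> expectation (\<lambda>x. (norm (X x - c))\<^sup>2)"
proof -
  define \<mu> where "\<mu> = expectation X"
  have eq: "(norm (X x - \<mu>))\<^sup>2 = (norm (X x - c))\<^sup>2 - 2 * ((X x - c) \<bullet> (\<mu> - c)) + (norm (\<mu> - c))\<^sup>2" for x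
    using norm_diff_square[of "X x - c" "\<mu> - c"] by simp
  have i: "integrable M (\<lambda>x. (X x - c) \<bullet> (\<mu> - c))" using X by auto
  show "integrable M (\<lambda>x. (norm (X x - expectation X))\<^sup>2)"
    unfolding \<mu>_def[symmetric] eq using i X2 by auto
  have "expectation (\<lambda>x. (X x - c) \<bullet> (\<mu> - c)) = (\<mu> - c) \<bullet> (\<mu> - c)"
    using X by (simp add: \<mu>_def prob_space)
  then have "expectation (\<lambda>x. (norm (X x - \<mu>))\<^sup>2) = expectation (\<lambda>x. (norm (X x - c))\<^sup>2) - (norm (\<mu> - c))\<^sup>2"
    unfolding eq using i X2 by (simp add: prob_space power2_norm_eq_inner)
  then show "expectation (\<lambda>x. (norm (X x - expectation X))\<^sup>2) \<le> expectation (\<lambda>x. (norm (X x - c))\<^sup>2)"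
    by (simp add: \<mu>_def)
qed

section \<open>The lifted potential and its stochastic gradient\<close>

context convex_smooth_potential
begin

definition pot :: "real^'n \<Rightarrow> real^'n^'n \<Rightarrow> real" where
  "pot m B = (\<integral>x. V (m + B *v x) \<partial>stdgauss)"

text \<open>The direction in which the forward step moves the pair \<open>(m, B)\<close> for the
  sample \<open>x\<close>. Differentiating \<open>V (m + B \<xi>)\<close> in \<open>B\<close> gives
  the outer product of \<open>gradV\<close> and \<open>\<xi>\<close> instead; the two agree only in
  mean.\<close>

definition ghat :: "real^'n^'n \<Rightarrow> real^'n \<Rightarrow> (real^'n) \<times> (real^'n^'n)" where
  "ghat B x = (gradV x, hessV x ** B)"

definition gmean :: "real^'n \<Rightarrow> real^'n^'n \<Rightarrow> (real^'n) \<times> (real^'n^'n)" where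
  "gmean m B = (\<integral>x. ghat B (m + B *v x) \<partial>stdgauss)"

lemma measurable_ghat [measurable]: "ghat B \<in> borel_measurable borel"
  unfolding ghat_def[abs_def] borel_prod[symmetric] by measurable

lemma integrable_V:
  fixes B :: "real^'n^'n"
  shows "integrable stdgauss (\<lambda>x. V (m + B *v x))"
  by (rule integrable_stdgauss_affine[OF measurable_V]) (use abs_V_le in auto)

lemma norm_gradV_affine:
  fixes B :: "real^'n^'n"
  shows "norm (gradV (m + B *v x)) \<le> (norm (gradV m) + \<beta> * norm B) * (1 + norm x)"
proof -
  have "norm (gradV (m + B *v x)) \<le> norm (gradV m) + \<beta> * norm (B *v x)"
    using gradV_lipschitz[of "m + B *v x" m] norm_triangle_ineq2[of "gradV (m + B *v x)" "gradV m"] by simp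
  also have "\<beta> * norm (B *v x) \<le> \<beta> * (norm B * norm x)"
    using beta_pos by (intro mult_left_mono norm_matrix_vector_le) simp
  also have "norm (gradV m) + \<beta> * (norm B * norm x) \<le> (norm (gradV m) + \<beta> * norm B) * (1 + norm x)"
    using beta_pos by (simp add: algebra_simps)
  finally show ?thesis by simp
qed

lemma grad_stein:
  fixes B C :: "real^'n^'n"
  shows "(\<integral>x. gradV (m + B *v x) \<bullet> (C *v x) \<partial>stdgauss) = (\<integral>x. (hessV (m + B *v x) ** B) \<bullet> C \<partial>stdgauss)"
    and "integrable stdgauss (\<lambda>x. gradV (m + B *v x) \<bullet> (C *v x))"
    and "integrable stdgauss (\<lambda>x. (hessV (m + B *v x) ** B) \<bullet> C)"
proof -
  let ?K = "norm (gradV m) + \<beta> * norm B"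
  have d: "((\<lambda>x. gradV (m + B *v x)) has_derivative (\<lambda>h. (hessV (m + B *v x) ** B) *v h)) (at x)" for x
  proof -
    have "((\<lambda>x. m + B *v x) has_derivative (\<lambda>h. B *v h)) (at x)"
      by (auto intro!: derivative_eq_intros bounded_linear_imp_has_derivative simp: matrix_vector_mul_bounded_linear)
    from has_derivative_compose[OF this hess[of "m + B *v x"]] show ?thesis
      by (simp add: matrix_vector_mul_assoc)
  qed
  have c: "continuous_on UNIV (\<lambda>x. hessV (m + B *v x) ** B)"
    by (intro continuous_intros continuous_on_compose2[OF hess_cont]) auto
  have n: "norm (hessV (m + B *v x) ** B) \<le> ?K" for x
    using norm_hessV_mult_le[of "m + B *v x" B] norm_ge_zero[of "gradV m"] by linarith
  show "(\<integral>x. gradV (m + B *v x) \<bullet> (C *v x) \<partial>stdgauss) = (\<integral>x. (hessV (m + B *v x) ** B) \<bullet> C \<partial>stdgauss)"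
    "integrable stdgauss (\<lambda>x. gradV (m + B *v x) \<bullet> (C *v x))"
    "integrable stdgauss (\<lambda>x. (hessV (m + B *v x) ** B) \<bullet> C)"
    by (rule stein_identity[OF d c norm_gradV_affine n])+
qed

lemma norm_ghat_affine:
  "norm (ghat B (m + B *v x)) \<le> (norm (gradV m) + 2 * \<beta> * norm B) * (1 + norm x)"
proof -
  have "norm (ghat B (m + B *v x)) \<le> norm (gradV (m + B *v x)) + norm (hessV (m + B *v x) ** B)"
    unfolding ghat_def by (rule norm_Pair_le)
  also have "\<dots> \<le> (norm (gradV m) + \<beta> * norm B) * (1 + norm x) + \<beta> * norm B"
    by (intro add_mono norm_gradV_affine norm_hessV_mult_le)
  also have "\<dots> \<le> (norm (gradV m) + 2 * \<beta> * norm B) * (1 + norm x)"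
    using beta_pos by (simp add: algebra_simps)
  finally show ?thesis .
qed

lemma ghat_integrable:
  shows "integrable stdgauss (\<lambda>x. ghat B (m + B *v x))"
    and "integrable stdgauss (\<lambda>x. (norm (ghat B (m + B *v x) - c))\<^sup>2)"
proof -
  define K where "K = norm (gradV m) + 2 * \<beta> * norm B"
  have K: "0 \<le> K" using beta_pos by (simp add: K_def)
  have r: "2 * r \<le> 1 + r\<^sup>2" for r :: real
    using zero_le_power2[of "r - 1"] by (simp add: power2_diff)
  show "integrable stdgauss (\<lambda>x. ghat B (m + B *v x))"
  proof (rule integrable_stdgauss)
    fix x :: "real^'n"
    have "norm (ghat B (m + B *v x)) \<le> K * (1 + norm x)"
      unfolding K_def by (rule norm_ghat_affine)
    also have "\<dots> \<le> K * (2 * (1 + (norm x)\<^sup>2))"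
    proof (rule mult_left_mono[OF _ K])
      show "1 + norm x \<le> 2 * (1 + (norm x)\<^sup>2)"
        using r[of "norm x"] zero_le_power2[of "norm x"] norm_ge_zero[of x] unfolding distrib_left by linarith
    qed
    finally show "norm (ghat B (m + B *v x)) \<le> 2 * K * (1 + (norm x)\<^sup>2)" by (simp add: algebra_simps)
  qed simp
  show "integrable stdgauss (\<lambda>x. (norm (ghat B (m + B *v x) - c))\<^sup>2)"
  proof (rule integrable_stdgauss)
    fix x :: "real^'n"
    have "norm (ghat B (m + B *v x) - c) \<le> K * (1 + norm x) + norm c"
      using norm_ghat_affine[of B m x] norm_triangle_ineq4[of "ghat B (m + B *v x)" c] by (simp add: K_def)
    also have "\<dots> \<le> (K + norm c) * (1 + norm x)"
      by (simp add: algebra_simps)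
    finally have "(norm (ghat B (m + B *v x) - c))\<^sup>2 \<le> ((K + norm c) * (1 + norm x))\<^sup>2"
      by (rule power_mono) simp
    also have "\<dots> = (K + norm c)\<^sup>2 * (1 + norm x)\<^sup>2" by (rule power_mult_distrib)
    also have "\<dots> \<le> (K + norm c)\<^sup>2 * (2 * (1 + (norm x)\<^sup>2))"
      using r[of "norm x"] by (intro mult_left_mono zero_le_power2) (simp add: power2_sum)
    finally show "norm ((norm (ghat B (m + B *v x) - c))\<^sup>2) \<le> 2 * (K + norm c)\<^sup>2 * (1 + (norm x)\<^sup>2)"
      by (simp add: algebra_simps)
  qed simp
qed

text \<open>The right side is the derivative of \<open>V (m + B x)\<close> in direction
  \<open>(a, C)\<close>, averaged. Thus \<open>gmean\<close> plays the part of the gradient of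
  \<open>pot\<close> without any differentiation under the integral.\<close>

lemma gmean_inner:
  fixes B C :: "real^'n^'n"
  shows "gmean m B \<bullet> (a, C) = (\<integral>x. gradV (m + B *v x) \<bullet> (a + C *v x) \<partial>stdgauss)"
  and integrable_grad_affine: "integrable stdgauss (\<lambda>x. gradV (m + B *v x) \<bullet> (a + C *v x))"
proof -
  have i: "integrable stdgauss (\<lambda>x. gradV (m + B *v x) \<bullet> a)"
    using integrable_inner_left[of "(a, 0 :: real^'n^'n)" stdgauss, OF ghat_integrable(1)[of B m]]
    by (simp add: ghat_def)
  show "integrable stdgauss (\<lambda>x. gradV (m + B *v x) \<bullet> (a + C *v x))"
    unfolding inner_add_right using i grad_stein(2) by auto
  have "gmean m B \<bullet> (a, C) = (\<integral>x. ghat B (m + B *v x) \<bullet> (a, C) \<partial>stdgauss)"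
    unfolding gmean_def using ghat_integrable(1)[of B m] by simp
  also have "\<dots> = (\<integral>x. gradV (m + B *v x) \<bullet> (a + C *v x) \<partial>stdgauss)"
    using i grad_stein[of m B C] by (simp add: ghat_def inner_add_right)
  finally show "gmean m B \<bullet> (a, C) = (\<integral>x. gradV (m + B *v x) \<bullet> (a + C *v x) \<partial>stdgauss)" .
qed

lemma affine_diff:
  fixes B B' :: "real^'n^'n"
  shows "(m' + B' *v x) - (m + B *v x) = (m' - m) + (B' - B) *v x"
  by (simp add: matrix_vector_mult_diff_rdistrib)

lemma pot_convex: "pot m B + gmean m B \<bullet> ((m', B') - (m, B)) \<le> pot m' B'"
proof -
  have "pot m B + gmean m B \<bullet> ((m', B') - (m, B))
      = (\<integral>x. V (m + B *v x) + gradV (m + B *v x) \<bullet> ((m' - m) + (B' - B) *v x) \<partial>stdgauss)"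
    using integrable_V[of m B] integrable_grad_affine[of m B "m' - m" "B' - B"]
    by (simp add: gmean_inner pot_def)
  also have "\<dots> \<le> pot m' B'"
    unfolding pot_def
  proof (rule integral_mono)
    show "V (m + B *v x) + gradV (m + B *v x) \<bullet> ((m' - m) + (B' - B) *v x) \<le> V (m' + B' *v x)" for x
      using V_first_order[of "m + B *v x" "m' + B' *v x"] unfolding affine_diff .
  qed (use integrable_V integrable_grad_affine in auto)
  finally show ?thesis .
qed

lemma pot_descent:
  "pot m' B' \<le> pot m B + gmean m B \<bullet> ((m', B') - (m, B)) + \<beta> / 2 * (norm ((m', B') - (m, B)))\<^sup>2"
proof -
  note n = stdgauss_norm_affine[of "m' - m" "B' - B"]
  have "pot m' B' \<le> (\<integral>x. V (m + B *v x) + gradV (m + B *v x) \<bullet> ((m' - m) + (B' - B) *v x)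
      + \<beta> / 2 * (norm ((m' - m) + (B' - B) *v x))\<^sup>2 \<partial>stdgauss)"
    unfolding pot_def
  proof (rule integral_mono)
    show "V (m' + B' *v x) \<le> V (m + B *v x) + gradV (m + B *v x) \<bullet> ((m' - m) + (B' - B) *v x)
      + \<beta> / 2 * (norm ((m' - m) + (B' - B) *v x))\<^sup>2" for x
      using V_descent[of "m' + B' *v x" "m + B *v x"] unfolding affine_diff .
  qed (use integrable_V integrable_grad_affine n in auto)
  also have "\<dots> = pot m B + gmean m B \<bullet> ((m', B') - (m, B)) + \<beta> / 2 * (norm ((m', B') - (m, B)))\<^sup>2"
    using integrable_V[of m B] integrable_grad_affine[of m B "m' - m" "B' - B"] n
    by (simp add: gmean_inner pot_def norm_Pair)
  finally show ?thesis .
qed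

text \<open>The variance is at most the second moment about \<open>(gradV m, 0)\<close>.
  Co-coercivity bounds the first component and \<open>hessV_mult_square_le\<close> the second. The
  term with \<open>gradV m\<close> has mean zero, and by Stein's identity the two remaining means
  are both \<open>gmean m B \<bullet> (0, B)\<close>, whence the factor \<open>2\<close>.\<close>

lemma ghat_variance:
  "(\<integral>x. (norm (ghat B (m + B *v x) - gmean m B))\<^sup>2 \<partial>stdgauss) \<le> 2 * \<beta> * (gmean m B \<bullet> (0, B))"
proof -
  interpret prob_space "stdgauss :: (real^'n) measure" by (rule prob_space_stdgauss)
  let ?c = "(gradV m, 0 :: real^'n^'n)"
  note q = gmean_inner[of m B 0 B] grad_stein[of m B B]
  note s = stdgauss_moments(1,2)[of "gradV m" B]
  have "(\<integral>x. (norm (ghat B (m + B *v x) - gmean m B))\<^sup>2 \<partial>stdgauss) \<le> (\<integral>x. (norm (ghat B (m + B *v x) - ?c))\<^sup>2 \<partial>stdgauss)"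
    unfolding gmean_def by (rule variance_le_second_moment[OF ghat_integrable])
  also have "\<dots> \<le> (\<integral>x. \<beta> * ((gradV (m + B *v x) - gradV m) \<bullet> (B *v x)) + \<beta> * ((hessV (m + B *v x) ** B) \<bullet> B) \<partial>stdgauss)"
  proof (rule integral_mono)
    show "integrable stdgauss (\<lambda>x. \<beta> * ((gradV (m + B *v x) - gradV m) \<bullet> (B *v x)) + \<beta> * ((hessV (m + B *v x) ** B) \<bullet> B))"
      unfolding inner_diff_left using q s by auto
    show "(norm (ghat B (m + B *v x) - ?c))\<^sup>2 \<le> \<beta> * ((gradV (m + B *v x) - gradV m) \<bullet> (B *v x)) + \<beta> * ((hessV (m + B *v x) ** B) \<bullet> B)" for x
      using gradV_cocoercive[of "m + B *v x" m] hessV_mult_square_le[of "m + B *v x" B]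
      by (simp add: ghat_def norm_Pair)
  qed (rule ghat_integrable)
  also have "\<dots> = 2 * \<beta> * (gmean m B \<bullet> (0, B))"
    unfolding inner_diff_left using q s by simp
  finally show ?thesis .
qed

lemma FG_eq_pot:
  assumes B: "det B \<noteq> 0"
  shows "FG V m (B ** transpose B) = pot m B - (1/2) * ln (det (B ** transpose B))
    - (1/2) * ln ((2 * pi) ^ CARD('n)) - real CARD('n) / 2"
  unfolding FG_def potential_def entropy_gauss[OF B] integral_gauss_affine(1)[OF B measurable_V] pot_def by simp

end

section \<open>Stationarity of the minimizer and the one-step inequality\<close>

locale fbgvi = convex_smooth_potential V gradV hessV \<beta>
  for V :: "real^'n \<Rightarrow> real" and gradV hessV \<beta> +
  fixes \<eta> :: real and mh :: "real^'n" and Sh :: "real^'n^'n"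
  assumes eta_pos: "0 < \<eta>" and eta_le: "\<eta> \<le> 1 / (2 * \<beta>)"
    and min_spd: "spd Sh" and minimizer: "\<And>m S. spd S \<Longrightarrow> FG V mh Sh \<le> FG V m S"
begin

lemma eta_beta: "\<eta> * \<beta> \<le> 1 / 2"
  using eta_le beta_pos by (simp add: field_simps)

text \<open>The first-order condition along the dilations \<open>s *\<^sub>R D\<close> with fixed
  mean: the logarithm of the determinant contributes \<open>CARD('n) * ln s\<close> and the
  potential the derivative \<open>?A\<close> at \<open>s = 1\<close>.\<close>

lemma gmean_minimizer:
  assumes D: "D ** transpose D = Sh"
  shows "gmean mh D \<bullet> (0, D) = CARD('n)"
proof -
  let ?d = "real CARD('n)" and ?A = "gmean mh D \<bullet> (0, D)"
  have detD: "det D \<noteq> 0"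
    by (rule det_factor_nonzero[OF min_spd D])
  \<comment> \<open>An upper bound for the change of the functional under dilation by
    \<open>s\<close>. It vanishes at \<open>1\<close> and inherits nonnegativity from minimality, so
    only this explicit function has to be differentiated.\<close>
  define f where "f s = (s - 1) * ?A + \<beta> / 2 * (norm D)\<^sup>2 * (s - 1)\<^sup>2 - ?d * ln s" for s
  have f0: "0 \<le> f s" if s: "0 < s" for s
  proof -
    have sD: "(s *\<^sub>R D) ** transpose (s *\<^sub>R D) = (s * s) *\<^sub>R Sh"
      by (simp add: transpose_scalar matrix_scalar_ac scalar_matrix_assoc[symmetric] D)
    have det_s: "det (s *\<^sub>R D) = s ^ CARD('n) * det D"
    proof -
      have "s *\<^sub>R D = mat s ** D"
        by (simp add: vec_eq_iff matrix_matrix_mult_def mat_def if_distrib if_distribR cong: if_cong)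
      moreover have "det (mat s :: real^'n^'n) = s ^ CARD('n)"
        using det_matrix_scaleR[of s, where ?'n = 'n] by (simp add: matrix_scaleR)
      ultimately show ?thesis by (simp add: det_mul)
    qed
    have dets: "det (s *\<^sub>R D) \<noteq> 0"
      using det_s detD s by simp
    have "ln (det ((s * s) *\<^sub>R Sh)) = 2 * ?d * ln s + ln (det Sh)"
    proof -
      have "det ((s * s) *\<^sub>R Sh) = det (s *\<^sub>R D) * det (s *\<^sub>R D)" "det Sh = det D * det D"
        using arg_cong[OF sD, of det] arg_cong[OF D, of det] by (simp_all add: det_mul)
      then have "det ((s * s) *\<^sub>R Sh) = s ^ CARD('n) * (s ^ CARD('n) * det Sh)"
        by (simp add: det_s mult_ac)
      then show ?thesis
        using s det_spd[OF min_spd] by (simp add: ln_mult_pos ln_realpow)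
    qed
    moreover have "spd ((s * s) *\<^sub>R Sh)"
      unfolding sD[symmetric] by (rule spd_mult_transpose[OF dets])
    from minimizer[OF this, of mh] have "pot mh D - (1/2) * ln (det Sh) \<le> pot mh (s *\<^sub>R D) - (1/2) * ln (det ((s * s) *\<^sub>R Sh))"
      using FG_eq_pot[OF detD, of mh] FG_eq_pot[OF dets, of mh] by (simp add: D sD)
    moreover have "pot mh (s *\<^sub>R D) \<le> pot mh D + (s - 1) * ?A + \<beta> / 2 * ((s - 1)\<^sup>2 * (norm D)\<^sup>2)"
    proof -
      have eq: "(mh, s *\<^sub>R D) - (mh, D) = (s - 1) *\<^sub>R (0, D)"
        by (simp add: scaleR_diff_left)
      show ?thesis
        using pot_descent[of mh "s *\<^sub>R D" mh D] unfolding eq inner_scaleR_right norm_scaleR power_mult_distrib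
        by (simp add: norm_Pair)
    qed
    ultimately show ?thesis by (simp add: f_def algebra_simps)
  qed
  have "DERIV f 1 :> ?A - ?d"
    unfolding f_def by (auto intro!: derivative_eq_intros)
  moreover have "\<forall>s. \<bar>1 - s\<bar> < 1 \<longrightarrow> f 1 \<le> f s"
    using f0 by (auto simp: f_def[of 1])
  ultimately have "?A - ?d = 0"
    using DERIV_local_min[of f "?A - ?d" 1 1] by simp
  then show ?thesis by simp
qed

text \<open>The energy is split around the coupled point \<open>mh + D x\<close>, where stationarity
  makes the mean of \<open>G x \<bullet> (D *v x)\<close> equal to the dimension. What remains is
  controlled by the Lipschitz bound on \<open>gradV\<close>. The largest eigenvalue enters as the
  Young weight that turns the trace of \<open>Sh\<close> into a multiple of the dimension.\<close>

lemma gradient_energy_le: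
  assumes D: "D ** transpose D = Sh"
  shows "gmean m B \<bullet> (0, B) \<le> 2 * real CARD('n) + 2 * \<beta>\<^sup>2 * lambda_max Sh * (norm ((m, B) - (mh, D)))\<^sup>2"
proof -
  define l where "l = lambda_max Sh"
  define d where "d = real CARD('n)"
  define L where "L = (norm ((m, B) - (mh, D)))\<^sup>2"
  have l: "0 < l" "trace Sh \<le> d * l"
    using trace_le_lambda_max[OF min_spd] by (auto simp: l_def d_def)
  have trD: "(norm D)\<^sup>2 = trace Sh"
    by (simp add: power2_norm_eq_inner inner_matrix_trace D)
  define G where "G x = gradV (mh + D *v x) - gradV mh" for x
  note mom = stdgauss_moments(1,2)[of "gradV mh" B] stdgauss_moments(1,2)[of "gradV mh" D]
    stdgauss_norm_affine[of 0 D, simplified] stdgauss_norm_affine[of 0 "B - D", simplified]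
    stdgauss_norm_affine[of "m - mh" "B - D"]
  have G: "integrable stdgauss (\<lambda>x. G x \<bullet> (D *v x))" "(\<integral>x. G x \<bullet> (D *v x) \<partial>stdgauss) = d"
    using gmean_minimizer[OF D] gmean_inner[of mh D 0 D] grad_stein(2)[of mh D D] mom
    by (simp_all add: G_def inner_diff_left d_def)
  \<comment> \<open>Stationarity and the Lipschitz bound give
    \<open>d \<le> \<beta> * trace Sh\<close>. This allows terms of order \<open>\<beta> * L\<close>
    to be absorbed into \<open>\<beta>\<^sup>2 * l * L\<close> at the end.\<close>
  have bl: "1 \<le> \<beta> * l"
  proof -
    have "d \<le> (\<integral>x. \<beta> * (norm (D *v x))\<^sup>2 \<partial>stdgauss)"
      unfolding G(2)[symmetric]
    proof (rule integral_mono)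
      fix x
      have "G x \<bullet> (D *v x) \<le> norm (G x) * norm (D *v x)" by (rule norm_cauchy_schwarz)
      also have "\<dots> \<le> (\<beta> * norm (D *v x)) * norm (D *v x)"
        using gradV_lipschitz[of "mh + D *v x" mh] by (intro mult_right_mono) (simp_all add: G_def)
      finally show "G x \<bullet> (D *v x) \<le> \<beta> * (norm (D *v x))\<^sup>2" by (simp add: power2_eq_square)
    qed (use G mom in auto)
    also have "\<dots> = \<beta> * trace Sh" using mom by (simp add: trD)
    also have "\<dots> \<le> \<beta> * (d * l)" using l beta_pos by simp
    finally have "d * 1 \<le> d * (\<beta> * l)" by (simp add: mult_ac)
    then show ?thesis by (simp add: d_def)
  qed
  \<comment> \<open>The left side is \<open>gradV mh \<bullet> X' + E \<bullet> Y' + E \<bullet> (X'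
    - Y') + G x \<bullet> Y' + G x \<bullet> (X' - Y')\<close>. The last product costs another half
    of \<open>G x \<bullet> Y'\<close> by co-coercivity, which explains \<open>3 / 2\<close>; the
    first has mean zero.\<close>
  have pw: "gradV (m + B *v x) \<bullet> (0 + B *v x) \<le> gradV mh \<bullet> (B *v x)
      + (\<beta>\<^sup>2 * l / 2 + \<beta> / 2) * (norm ((m - mh) + (B - D) *v x))\<^sup>2
      + (norm (D *v x))\<^sup>2 / (2 * l) + \<beta> * (norm ((B - D) *v x))\<^sup>2 + 3 / 2 * (G x \<bullet> (D *v x))" for x
  proof -
    define X' Y' where "X' = B *v x" and "Y' = D *v x"
    define E where "E = gradV (m + X') - gradV (mh + Y')"
    define r where "r = norm ((m - mh) + (B - D) *v x)"
    define u where "u = norm (X' - Y')"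
    have u: "(B - D) *v x = X' - Y'" by (simp add: X'_def Y'_def matrix_vector_mult_diff_rdistrib)
    have E: "norm E \<le> \<beta> * r"
      using gradV_lipschitz[of "m + X'" "mh + Y'"] unfolding E_def r_def u by (simp add: algebra_simps)
    have 1: "E \<bullet> Y' \<le> \<beta>\<^sup>2 * l / 2 * r\<^sup>2 + (norm Y')\<^sup>2 / (2 * l)"
    proof -
      have "E \<bullet> Y' \<le> norm E * norm Y'" by (rule norm_cauchy_schwarz)
      also have "\<dots> \<le> (\<beta> * r) * norm Y'" by (intro mult_right_mono E) simp
      also have "\<dots> \<le> \<beta>\<^sup>2 * l / 2 * r\<^sup>2 + (norm Y')\<^sup>2 / (2 * l)"
      proof -
        have "0 \<le> (\<beta> * l * r - norm Y')\<^sup>2 / (2 * l)" using l by simp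
        also have "\<dots> = \<beta>\<^sup>2 * l / 2 * r\<^sup>2 + (norm Y')\<^sup>2 / (2 * l) - \<beta> * r * norm Y'"
          using l by (simp add: field_simps power2_eq_square)
        finally show ?thesis by simp
      qed
      finally show ?thesis .
    qed
    have 2: "E \<bullet> (X' - Y') \<le> \<beta> / 2 * r\<^sup>2 + \<beta> / 2 * u\<^sup>2"
    proof -
      have "E \<bullet> (X' - Y') \<le> norm E * norm (X' - Y')" by (rule norm_cauchy_schwarz)
      also have "\<dots> \<le> (\<beta> * r) * u" unfolding u_def by (intro mult_right_mono E) simp
      also have "\<dots> = \<beta> / 2 * (2 * r * u)" by simp
      also have "\<dots> \<le> \<beta> / 2 * (r\<^sup>2 + u\<^sup>2)"
        using sum_squares_bound[of r u] beta_pos by (intro mult_left_mono) auto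
      finally show ?thesis by (simp add: distrib_left)
    qed
    have 3: "G x \<bullet> (X' - Y') \<le> (G x \<bullet> Y') / 2 + \<beta> / 2 * u\<^sup>2"
    proof -
      have "(norm (G x))\<^sup>2 \<le> \<beta> * (G x \<bullet> Y')"
        using gradV_cocoercive[of "mh + D *v x" mh] by (simp add: G_def Y'_def)
      then have "(norm (G x))\<^sup>2 / (2 * \<beta>) \<le> (G x \<bullet> Y') / 2"
        using beta_pos by (simp add: field_simps)
      moreover have "G x \<bullet> (X' - Y') \<le> norm (G x) * u"
        unfolding u_def by (rule norm_cauchy_schwarz)
      moreover have "norm (G x) * u \<le> (norm (G x))\<^sup>2 / (2 * \<beta>) + \<beta> / 2 * u\<^sup>2"
      proof -
        have "0 \<le> (norm (G x) - \<beta> * u)\<^sup>2 / (2 * \<beta>)" using beta_pos by simp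
        also have "\<dots> = (norm (G x))\<^sup>2 / (2 * \<beta>) + \<beta> / 2 * u\<^sup>2 - norm (G x) * u"
          using beta_pos by (simp add: field_simps power2_eq_square)
        finally show ?thesis by simp
      qed
      ultimately show ?thesis by linarith
    qed
    have "gradV (m + X') \<bullet> X' = gradV mh \<bullet> X' + E \<bullet> Y' + E \<bullet> (X' - Y') + G x \<bullet> Y' + G x \<bullet> (X' - Y')"
      by (simp add: E_def G_def Y'_def inner_diff_left inner_diff_right)
    then have "gradV (m + X') \<bullet> X' \<le> gradV mh \<bullet> X' + (\<beta>\<^sup>2 * l / 2 * r\<^sup>2 + \<beta> / 2 * r\<^sup>2)
        + (norm Y')\<^sup>2 / (2 * l) + \<beta> * u\<^sup>2 + 3 / 2 * (G x \<bullet> Y')"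
      using 1 2 3 by (simp add: algebra_simps)
    then show ?thesis
      unfolding u unfolding X'_def[symmetric] Y'_def[symmetric] r_def[symmetric] u_def[symmetric]
      using r_def[unfolded u] by (simp add: distrib_right u_def)
  qed
  have "gmean m B \<bullet> (0, B) \<le> (\<integral>x. gradV mh \<bullet> (B *v x)
      + (\<beta>\<^sup>2 * l / 2 + \<beta> / 2) * (norm ((m - mh) + (B - D) *v x))\<^sup>2
      + (norm (D *v x))\<^sup>2 / (2 * l) + \<beta> * (norm ((B - D) *v x))\<^sup>2 + 3 / 2 * (G x \<bullet> (D *v x)) \<partial>stdgauss)"
    unfolding gmean_inner by (rule integral_mono[OF integrable_grad_affine _ pw]) (use G mom in auto)
  also have "\<dots> = (\<beta>\<^sup>2 * l / 2 + \<beta> / 2) * L + trace Sh / (2 * l) + \<beta> * (norm (B - D))\<^sup>2 + 3 / 2 * d"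
    using G mom by (simp add: L_def norm_Pair trD)
  also have "\<dots> \<le> (\<beta>\<^sup>2 * l / 2 + \<beta> / 2) * L + d / 2 + \<beta> * L + 3 / 2 * d"
  proof -
    have "trace Sh / (2 * l) \<le> d / 2" using l by (simp add: field_simps)
    moreover have "\<beta> * (norm (B - D))\<^sup>2 \<le> \<beta> * L"
      using beta_pos by (intro mult_left_mono) (simp_all add: L_def norm_Pair)
    ultimately show ?thesis by linarith
  qed
  also have "\<dots> \<le> 2 * d + 2 * \<beta>\<^sup>2 * l * L"
  proof -
    have "\<beta> * 1 * L \<le> \<beta> * (\<beta> * l) * L"
      using bl beta_pos by (intro mult_right_mono mult_left_mono) (auto simp: L_def)
    then have "\<beta> * L \<le> \<beta>\<^sup>2 * l * L" by (simp add: power2_eq_square mult_ac)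
    moreover have "(\<beta>\<^sup>2 * l / 2 + \<beta> / 2) * L = (\<beta>\<^sup>2 * l * L) / 2 + (\<beta> * L) / 2"
      by (simp add: algebra_simps)
    moreover have "2 * \<beta>\<^sup>2 * l * L = 2 * (\<beta>\<^sup>2 * l * L)" by simp
    ultimately show ?thesis by linarith
  qed
  finally show ?thesis by (simp add: d_def l_def L_def)
qed

text \<open>The squared Wasserstein distance to the minimizer by the Gaussian formula. The link to
  \<open>W2sq\<close> is the inequality \<open>bures_le_W2sq\<close>, applied at the initial
  state.\<close>

definition lyap :: "(real^'n) \<times> (real^'n^'n) \<Rightarrow> real" where
  "lyap s = (norm (fst s - mh))\<^sup>2 + bures Sh (snd s)"

lemma fbgvi_step_eq:
  "fbgvi_step \<eta> gradV hessV (m, S) x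
    = (m - \<eta> *\<^sub>R gradV x, entropy_prox \<eta> ((mat 1 - \<eta> *\<^sub>R hessV x) ** S ** (mat 1 - \<eta> *\<^sub>R hessV x)))"
  by (simp add: fbgvi_step_def entropy_prox_def Let_def)

text \<open>Since \<open>\<eta> * \<beta> \<le> 1 / 2\<close>, this matrix is at least half the
  identity. Hence the forward step keeps the covariance nondegenerate for every sample.\<close>

lemma spd_forward_factor: "spd (mat 1 - \<eta> *\<^sub>R hessV x)"
  unfolding spd_def
proof safe
  show "transpose (mat 1 - \<eta> *\<^sub>R hessV x) = mat 1 - \<eta> *\<^sub>R hessV x"
    using hessV_symmetric[of x] by (simp add: transpose_def vec_eq_iff mat_def)
  fix h :: "real^'n" assume h: "h \<noteq> 0"
  have "\<eta> * (h \<bullet> (hessV x *v h)) \<le> \<eta> * (\<beta> * (h \<bullet> h))"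
    using hess_le eta_pos by (intro mult_left_mono) auto
  also have "\<dots> = (\<eta> * \<beta>) * (h \<bullet> h)" by simp
  also have "\<dots> \<le> 1 / 2 * (h \<bullet> h)" by (intro mult_right_mono eta_beta) simp
  finally show "0 < h \<bullet> ((mat 1 - \<eta> *\<^sub>R hessV x) *v h)"
    using h inner_gt_zero_iff[of h]
    by (simp add: matrix_vector_mult_diff_rdistrib inner_diff_right scaleR_matrix_vector_assoc[symmetric] del: inner_gt_zero_iff)
qed

lemma spd_half_step:
  assumes "spd S"
  shows "spd ((mat 1 - \<eta> *\<^sub>R hessV x) ** S ** (mat 1 - \<eta> *\<^sub>R hessV x))"
  using spd_congruence[OF assms, of "mat 1 - \<eta> *\<^sub>R hessV x"] spd_forward_factor[of x]
    det_spd[OF spd_forward_factor[of x]] by (simp add: spd_def)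

lemma spd_step:
  assumes "spd S"
  shows "spd (snd (fbgvi_step \<eta> gradV hessV (m, S) x))"
  unfolding fbgvi_step_eq using entropy_prox(1)[OF spd_half_step[OF assms] eta_pos] by simp

text \<open>Valid for each single sample. The term \<open>e \<bullet> (z - y)\<close> has mean zero,
  since \<open>z\<close> and \<open>y\<close> do not depend on \<open>x\<close>. The term
  \<open>e \<bullet> u\<close> is correlated with the noise and is removed by Young's inequality,
  which produces \<open>2 * \<eta>\<^sup>2 * (norm e)\<^sup>2\<close>.\<close>

lemma one_step_pointwise:
  fixes m x :: "real^'n" and S B D :: "real^'n^'n"
  assumes S: "spd S" and B: "B ** transpose B = S" and D: "D ** transpose D = Sh"
    and opt: "bures Sh S = (norm (B - D))\<^sup>2"
  defines "s1 \<equiv> fbgvi_step \<eta> gradV hessV (m, S) x"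
  defines "z \<equiv> (m, B)" and "y \<equiv> (mh, D)" and "e \<equiv> ghat B x - gmean m B"
  shows "lyap s1 + 2 * \<eta> * (FG V (fst s1) (snd s1) - FG V mh Sh)
    \<le> lyap (m, S) - 2 * \<eta> * (e \<bullet> (z - y)) + 2 * \<eta>\<^sup>2 * (norm e)\<^sup>2"
proof -
  define P where "P = mat 1 - \<eta> *\<^sub>R hessV x"
  have sP: "transpose P = P" using spd_forward_factor[of x] by (simp add: P_def spd_def)
  define m1 where "m1 = m - \<eta> *\<^sub>R gradV x"
  define Bh where "Bh = P ** B"
  define S2 where "S2 = P ** S ** P"
  define S1 where "S1 = entropy_prox \<eta> S2"
  have s1: "s1 = (m1, S1)"
    unfolding s1_def fbgvi_step_eq m1_def S1_def S2_def P_def ..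
  have S2: "spd S2" unfolding S2_def P_def by (rule spd_half_step[OF S])
  have Bh: "Bh ** transpose Bh = S2"
    by (simp add: Bh_def S2_def B[symmetric] matrix_transpose_mul sP matrix_mul_assoc)
  obtain B1 where B1: "B1 ** transpose B1 = S1"
    and le: "bures Sh S1 \<le> bures Sh S2 + \<eta> * (ln (det S1) - ln (det Sh)) - (norm (B1 - Bh))\<^sup>2"
    using bures_entropy_prox_le[OF min_spd S2 eta_pos Bh] unfolding S1_def by blast
  have S1: "spd S1" unfolding S1_def by (rule entropy_prox(1)[OF S2 eta_pos])
  have detB1: "det B1 \<noteq> 0" and detD: "det D \<noteq> 0"
    using det_factor_nonzero[OF S1 B1] det_factor_nonzero[OF min_spd D] by auto
  \<comment> \<open>\<open>D\<close> is optimal for \<open>B\<close> but merely admissible for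
    \<open>Bh\<close>, so only an inequality remains. The bound \<open>le\<close> used an optimal
    factor of its own.\<close>
  have le2: "bures Sh S2 \<le> (norm (Bh - D))\<^sup>2"
    by (rule bures_le_norm_diff[OF min_spd S2 Bh D])
  \<comment> \<open>The logarithms cancel against those in \<open>le\<close>, where they came from
    another factor of \<open>Sh\<close>; the potential is still expressed through
    \<open>D\<close>.\<close>
  have FG1: "FG V m1 S1 - FG V mh Sh = pot m1 B1 - pot mh D - (1/2) * (ln (det S1) - ln (det Sh))"
    using FG_eq_pot[OF detB1, of m1] FG_eq_pot[OF detD, of mh] by (simp add: B1 D algebra_simps)
  define z1 where "z1 = (m1, B1)"
  define u where "u = z1 - z"
  have zh: "(m1, Bh) = z - \<eta> *\<^sub>R ghat B x"
    unfolding z_def ghat_def m1_def Bh_def P_def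
    using bounded_bilinear.diff_left[OF bilinear_matrix_matrix_mult, of "mat 1" "\<eta> *\<^sub>R hessV x" B]
    by (simp add: scalar_matrix_assoc)
  have "lyap s1 + 2 * \<eta> * (FG V (fst s1) (snd s1) - FG V mh Sh)
      \<le> (norm ((m1, Bh) - y))\<^sup>2 - (norm (z1 - (m1, Bh)))\<^sup>2 + 2 * \<eta> * (pot m1 B1 - pot mh D)"
  proof -
    have "2 * \<eta> * (FG V m1 S1 - FG V mh Sh) = 2 * \<eta> * (pot m1 B1 - pot mh D) - \<eta> * (ln (det S1) - ln (det Sh))"
      unfolding FG1 by (simp add: algebra_simps)
    then show ?thesis
      using le le2 by (simp add: s1 lyap_def y_def z1_def norm_Pair)
  qed
  also have "(norm ((m1, Bh) - y))\<^sup>2 = (norm (z - y))\<^sup>2 - 2 * \<eta> * (ghat B x \<bullet> (z - y)) + \<eta>\<^sup>2 * (norm (ghat B x))\<^sup>2"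
  proof -
    have eq: "(m1, Bh) - y = (z - y) - \<eta> *\<^sub>R ghat B x" unfolding zh by simp
    show ?thesis
      unfolding eq norm_diff_square by (simp add: power_mult_distrib inner_commute)
  qed
  also have "(norm (z1 - (m1, Bh)))\<^sup>2 = (norm u)\<^sup>2 + 2 * \<eta> * (ghat B x \<bullet> u) + \<eta>\<^sup>2 * (norm (ghat B x))\<^sup>2"
  proof -
    have "z1 - (m1, Bh) = u + \<eta> *\<^sub>R ghat B x" unfolding zh u_def by simp
    then show ?thesis
      unfolding power2_norm_eq_inner
      by (simp add: inner_add_left inner_add_right inner_commute power2_eq_square)
  qed
  \<comment> \<open>The two occurrences of \<open>\<eta>\<^sup>2 * (norm (ghat B x))\<^sup>2\<close>
    cancel, so the fluctuation \<open>e\<close> will have to be estimated and never the full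
    stochastic gradient.\<close>
  finally have main: "lyap s1 + 2 * \<eta> * (FG V (fst s1) (snd s1) - FG V mh Sh)
      \<le> (norm (z - y))\<^sup>2 - 2 * \<eta> * (ghat B x \<bullet> (z - y)) - (norm u)\<^sup>2 - 2 * \<eta> * (ghat B x \<bullet> u)
        + 2 * \<eta> * (pot m1 B1 - pot mh D)"
    by simp
  have lyap0: "lyap (m, S) = (norm (z - y))\<^sup>2"
    by (simp add: lyap_def opt z_def y_def norm_Pair)
  have "pot m1 B1 \<le> pot m B + gmean m B \<bullet> u + \<beta> / 2 * (norm u)\<^sup>2"
    unfolding u_def z1_def z_def by (rule pot_descent)
  moreover have "pot m B - gmean m B \<bullet> (z - y) \<le> pot mh D"
    using pot_convex[of m B mh D] unfolding z_def[symmetric] y_def[symmetric] inner_diff_right by simp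
  ultimately have "pot m1 B1 - pot mh D \<le> gmean m B \<bullet> u + gmean m B \<bullet> (z - y) + \<beta> / 2 * (norm u)\<^sup>2"
    by linarith
  then have "2 * \<eta> * (pot m1 B1 - pot mh D) \<le> 2 * \<eta> * (gmean m B \<bullet> u + gmean m B \<bullet> (z - y) + \<beta> / 2 * (norm u)\<^sup>2)"
    using eta_pos by (intro mult_left_mono) auto
  also have "\<dots> = 2 * \<eta> * (gmean m B \<bullet> u) + 2 * \<eta> * (gmean m B \<bullet> (z - y)) + (\<eta> * \<beta>) * (norm u)\<^sup>2"
    by (simp add: algebra_simps)
  also have "(\<eta> * \<beta>) * (norm u)\<^sup>2 \<le> 1 / 2 * (norm u)\<^sup>2"
    by (intro mult_right_mono eta_beta) simp
  finally have 1: "2 * \<eta> * (pot m1 B1 - pot mh D) \<le> 2 * \<eta> * (gmean m B \<bullet> u) + 2 * \<eta> * (gmean m B \<bullet> (z - y)) + 1 / 2 * (norm u)\<^sup>2"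
    by simp
  have 2: "0 \<le> 1 / 2 * (norm u)\<^sup>2 + 2 * \<eta> * (e \<bullet> u) + 2 * \<eta>\<^sup>2 * (norm e)\<^sup>2"
  proof -
    have "0 \<le> 1 / 2 * (norm (u + (2 * \<eta>) *\<^sub>R e))\<^sup>2" by simp
    also have "\<dots> = 1 / 2 * (norm u)\<^sup>2 + 2 * \<eta> * (e \<bullet> u) + 2 * \<eta>\<^sup>2 * (norm e)\<^sup>2"
      unfolding power2_norm_eq_inner by (simp add: inner_add_left inner_add_right inner_commute power2_eq_square algebra_simps)
    finally show ?thesis .
  qed
  have e: "e \<bullet> w = ghat B x \<bullet> w - gmean m B \<bullet> w" for w
    by (simp add: e_def inner_diff_left)
  show ?thesis
    using main 1 2 unfolding lyap0 e by (simp add: algebra_simps)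
qed

text \<open>The two parts of \<open>2 * \<eta>\<^sup>2 * (2 * \<beta>) * (2 * d + 2 *
  \<beta>\<^sup>2 * \<lambda> * L)\<close>: the factors come from \<open>one_step_pointwise\<close>,
  \<open>ghat_variance\<close> and \<open>gradient_energy_le\<close>. \<open>drift\<close> collects
  the coefficient of the squared distance \<open>L\<close>, \<open>noise\<close> the
  constant.\<close>

definition drift :: real where "drift = 8 * \<eta>\<^sup>2 * \<beta> ^ 3 * lambda_max Sh"
definition noise :: real where "noise = 8 * \<eta>\<^sup>2 * \<beta> * real CARD('n)"

lemma drift_nonneg: "0 \<le> drift" and noise_nonneg: "0 \<le> noise"
  using beta_pos trace_le_lambda_max(2)[OF min_spd] by (auto simp: drift_def noise_def)

lemma lyap_nonneg: "spd S \<Longrightarrow> 0 \<le> lyap (m, S)"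
proof -
  assume S: "spd S"
  obtain T where T: "spd T" "T ** S ** T = Sh" "bures Sh S = trace S + trace Sh - 2 * trace (T ** S)"
    using transport_matrix[OF min_spd S] .
  show ?thesis
    using bures_attained(2)[OF T, of "psd_sqrt S"] spd_sqrt[OF S] by (simp add: lyap_def spd_def)
qed

text \<open>The term linear in \<open>e\<close> integrates to zero and the quadratic one is the
  variance. The pointwise majorant \<open>R\<close> is measurable and integrable, so monotonicity of
  the nonnegative integral suffices on the side where \<open>FG\<close> occurs.\<close>

theorem one_step_expectation:
  assumes S: "spd S"
  shows "(\<integral>\<^sup>+x. ennreal (lyap (fbgvi_step \<eta> gradV hessV (m, S) x)
        + 2 * \<eta> * (FG V (fst (fbgvi_step \<eta> gradV hessV (m, S) x)) (snd (fbgvi_step \<eta> gradV hessV (m, S) x)) - FG V mh Sh)) \<partial>gauss m S)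
    \<le> ennreal ((1 + drift) * lyap (m, S) + noise)"
proof -
  interpret prob_space "stdgauss :: (real^'n) measure" by (rule prob_space_stdgauss)
  define B where "B = psd_sqrt S"
  have B: "B ** transpose B = S" and detB: "det B \<noteq> 0"
    using spd_sqrt[OF S] det_spd[of B] by (auto simp: B_def spd_def)
  obtain T where T: "spd T" "T ** S ** T = Sh" "bures Sh S = trace S + trace Sh - 2 * trace (T ** S)"
    using transport_matrix[OF min_spd S] .
  define D where "D = T ** B"
  have D: "D ** transpose D = Sh" and opt: "bures Sh S = (norm (B - D))\<^sup>2"
    using bures_attained[OF T B] by (auto simp: D_def)
  define w where "w = (m, B) - (mh, D)"
  define e where "e x = ghat B x - gmean m B" for x
  define R where "R x = lyap (m, S) - 2 * \<eta> * (e x \<bullet> w) + 2 * \<eta>\<^sup>2 * (norm (e x))\<^sup>2" for x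
  have [measurable]: "e \<in> borel_measurable borel" "R \<in> borel_measurable borel"
    unfolding R_def e_def by measurable
  define F where "F x = lyap (fbgvi_step \<eta> gradV hessV (m, S) x)
        + 2 * \<eta> * (FG V (fst (fbgvi_step \<eta> gradV hessV (m, S) x)) (snd (fbgvi_step \<eta> gradV hessV (m, S) x)) - FG V mh Sh)" for x
  have FR: "F x \<le> R x" for x
    unfolding F_def R_def e_def w_def by (rule one_step_pointwise[OF S B D opt])
  \<comment> \<open>Nonnegativity passes from \<open>F\<close> to \<open>R\<close>, so
    \<open>ennreal\<close> cuts nothing off when the integral of \<open>R\<close> is
    evaluated.\<close>
  have F0: "0 \<le> F x" for x
    unfolding F_def using lyap_nonneg[OF spd_step[OF S], of _ m x] minimizer[OF spd_step[OF S]] eta_pos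
    by (metis (no_types, lifting) add_nonneg_nonneg diff_ge_0_iff_ge less_imp_le mult_nonneg_nonneg prod.collapse zero_le_numeral)
  have ie: "integrable stdgauss (\<lambda>x. e (m + B *v x) \<bullet> w)" "(\<integral>x. e (m + B *v x) \<bullet> w \<partial>stdgauss) = 0"
    unfolding e_def using ghat_integrable(1)[of B m]
    by (auto simp: gmean_def prob_space[simplified] inner_diff_left)
  have ie2: "integrable stdgauss (\<lambda>x. (norm (e (m + B *v x)))\<^sup>2)"
    unfolding e_def by (rule ghat_integrable)
  have iR: "integrable stdgauss (\<lambda>x. R (m + B *v x))"
    unfolding R_def using ie ie2 by auto
  have lyap0: "lyap (m, S) = (norm w)\<^sup>2"
    by (simp add: lyap_def opt w_def norm_Pair)
  have "(\<integral>x. R (m + B *v x) \<partial>stdgauss) = lyap (m, S) + 2 * \<eta>\<^sup>2 * (\<integral>x. (norm (e (m + B *v x)))\<^sup>2 \<partial>stdgauss)"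
    unfolding R_def using ie ie2 by (simp add: prob_space[simplified])
  also have "\<dots> \<le> lyap (m, S) + 2 * \<eta>\<^sup>2 * (2 * \<beta> * (2 * real CARD('n) + 2 * \<beta>\<^sup>2 * lambda_max Sh * lyap (m, S)))"
  proof -
    have "(\<integral>x. (norm (e (m + B *v x)))\<^sup>2 \<partial>stdgauss) \<le> 2 * \<beta> * (gmean m B \<bullet> (0, B))"
      unfolding e_def by (rule ghat_variance)
    also have "\<dots> \<le> 2 * \<beta> * (2 * real CARD('n) + 2 * \<beta>\<^sup>2 * lambda_max Sh * lyap (m, S))"
      unfolding lyap0 w_def using beta_pos by (intro mult_left_mono gradient_energy_le D) auto
    finally show ?thesis by (intro add_left_mono mult_left_mono) auto
  qed
  also have "\<dots> = (1 + drift) * lyap (m, S) + noise"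
    by (simp add: drift_def noise_def algebra_simps power2_eq_square power3_eq_cube)
  finally have ER: "(\<integral>x. R (m + B *v x) \<partial>stdgauss) \<le> (1 + drift) * lyap (m, S) + noise" .
  have "(\<integral>\<^sup>+x. ennreal (F x) \<partial>gauss m S) \<le> (\<integral>\<^sup>+x. ennreal (R x) \<partial>gauss m S)"
    by (intro nn_integral_mono ennreal_leI FR)
  also have "\<dots> = (\<integral>\<^sup>+x. ennreal (R (m + B *v x)) \<partial>stdgauss)"
    unfolding B[symmetric] gauss_affine[OF detB] by (subst nn_integral_distr) simp_all
  also have "\<dots> = ennreal (\<integral>x. R (m + B *v x) \<partial>stdgauss)"
    using order_trans[OF F0 FR] by (intro nn_integral_eq_integral iR) auto
  also have "\<dots> \<le> ennreal ((1 + drift) * lyap (m, S) + noise)"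
    by (intro ennreal_leI ER)
  finally show ?thesis unfolding F_def .
qed

end

section \<open>The trajectory measure\<close>

text \<open>A kernel that is sub-Markov only almost everywhere: outside a null set it need not take values
  in the space of the Giry monad, so the library's rules for \<open>bind\<close> do not apply directly.\<close>
lemma
  fixes K :: "'a \<Rightarrow> 'b measure"
  assumes M: "space M \<noteq> {}" and N: "space N \<noteq> {}"
    and sets_K: "\<And>\<omega>. \<omega> \<in> space M \<Longrightarrow> sets (K \<omega>) = sets N"
    and meas_K: "\<And>A. A \<in> sets N \<Longrightarrow> (\<lambda>\<omega>. emeasure (K \<omega>) A) \<in> borel_measurable M"
    and AE_K: "AE \<omega> in M. emeasure (K \<omega>) (space N) \<le> 1"
  shows sets_bind_AE: "sets (M \<bind> K) = sets N"
    and nn_integral_bind_AE: "f \<in> borel_measurable N \<Longrightarrow>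
      (\<integral>\<^sup>+x. f x \<partial>(M \<bind> K)) = (\<integral>\<^sup>+\<omega>. \<integral>\<^sup>+x. f x \<partial>K \<omega> \<partial>M)"
proof -
  define G where "G = {\<omega> \<in> space M. emeasure (K \<omega>) (space N) \<le> 1}"
  define K' where "K' \<omega> = (if \<omega> \<in> G then K \<omega> else null_measure N)" for \<omega>
  have [measurable]: "G \<in> sets M"
    unfolding G_def using meas_K[OF sets.top] by measurable
  have AE_G: "AE \<omega> in M. \<omega> \<in> G"
    using AE_K AE_space by eventually_elim (simp add: G_def)
  have K': "K' \<in> measurable M (subprob_algebra N)"
  proof (rule measurable_subprob_algebra)
    fix \<omega> assume \<omega>: "\<omega> \<in> space M"
    show "sets (K' \<omega>) = sets N"
      using sets_K[OF \<omega>] by (simp add: K'_def)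
    show "subprob_space (K' \<omega>)"
    proof (cases "\<omega> \<in> G")
      case True
      then show ?thesis
        using N sets_eq_imp_space_eq[OF sets_K[OF \<omega>]] by (intro subprob_spaceI) (auto simp: K'_def G_def)
    qed (simp add: K'_def subprob_space_null_measure N)
  next
    fix A assume "A \<in> sets N"
    then have [measurable]: "(\<lambda>\<omega>. emeasure (K \<omega>) A) \<in> borel_measurable M" by (rule meas_K)
    have "(\<lambda>\<omega>. emeasure (K' \<omega>) A) = (\<lambda>\<omega>. if \<omega> \<in> G then emeasure (K \<omega>) A else 0)"
      by (auto simp: K'_def)
    then show "(\<lambda>\<omega>. emeasure (K' \<omega>) A) \<in> borel_measurable M" by simp
  qed
  \<comment> \<open>\<open>bind\<close> sees the kernel only through this image measure. Outside
    \<open>G\<close> the value of \<open>K\<close> has mass above one and lies in no set of the Giry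
    space, while \<open>K'\<close> takes the null measure there; since almost every point is in
    \<open>G\<close>, the preimages agree up to a null set.\<close>
  have "distr M (subprob_algebra N) K = distr M (subprob_algebra N) K'"
    unfolding distr_def
  proof (rule measure_of_eq)
    show "sets (subprob_algebra N) \<subseteq> Pow (space (subprob_algebra N))" by (rule sets.space_closed)
    fix A assume "A \<in> sigma_sets (space (subprob_algebra N)) (sets (subprob_algebra N))"
    then have A: "A \<in> sets (subprob_algebra N)" by (simp add: sets.sigma_sets_eq)
    have "K -` A \<inter> space M = K' -` A \<inter> space M \<inter> G"
    proof -
      have "\<omega> \<in> G" if "\<omega> \<in> space M" "K \<omega> \<in> A" for \<omega>
      proof -
        have "subprob_space (K \<omega>)"
          using that sets.sets_into_space[OF A] by (auto simp: space_subprob_algebra)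
        then show ?thesis
          using that subprob_space.emeasure_space_le_1[of "K \<omega>"] sets_eq_imp_space_eq[OF sets_K[of \<omega>]]
          by (simp add: G_def)
      qed
      then show ?thesis by (auto simp: K'_def)
    qed
    moreover have m: "K' -` A \<inter> space M \<in> sets M"
      by (rule measurable_sets[OF K' A])
    ultimately show "emeasure M (K -` A \<inter> space M) = emeasure M (K' -` A \<inter> space M)"
      using AE_G by (intro emeasure_eq_AE) auto
  qed
  moreover have "subprob_algebra (K (SOME x. x \<in> space M)) = subprob_algebra N"
    using M by (intro subprob_algebra_cong sets_K) (simp add: some_in_eq)
  ultimately have eq: "M \<bind> K = M \<bind> K'"
    using M bind_nonempty''[OF K' M] by (simp add: bind_def)
  show "sets (M \<bind> K) = sets N"
    by (rule sets_bind[OF sets_K M])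
  assume f: "f \<in> borel_measurable N"
  show "(\<integral>\<^sup>+x. f x \<partial>(M \<bind> K)) = (\<integral>\<^sup>+\<omega>. \<integral>\<^sup>+x. f x \<partial>K \<omega> \<partial>M)"
    unfolding eq nn_integral_bind[OF f K']
    using AE_G by (intro nn_integral_cong_AE) (auto simp: K'_def)
qed

section \<open>Joint measurability of the Gaussian density and of trajectory updates\<close>

lemma measurable_fst_snd_borel [measurable (raw)]:
  fixes f :: "'a \<Rightarrow> 'b::second_countable_topology \<times> 'c::second_countable_topology"
  assumes "f \<in> borel_measurable M"
  shows "(\<lambda>x. fst (f x)) \<in> borel_measurable M" "(\<lambda>x. snd (f x)) \<in> borel_measurable M"
  using borel_measurable_continuous_on[OF _ assms, of fst] borel_measurable_continuous_on[OF _ assms, of snd]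
  by (simp_all add: continuous_on_fst continuous_on_snd)

text \<open>Cramer's rule makes the exponent a quotient of polynomials in the entries, hence jointly
  Borel in mean, covariance and point. For a determinant that is not positive the density is at most
  zero, because \<open>sqrt\<close> is odd and division by zero gives zero; \<open>ennreal\<close>
  then removes the arbitrary value of \<open>matrix_inv\<close>.\<close>

lemma ennreal_gdens:
  fixes S :: "real^'n^'n"
  shows "ennreal (gdens m S x) = (if 0 < det S then
    ennreal (exp (- (1/2) * ((x - m) \<bullet> (\<chi> k. det (\<chi> i j. if j = k then (x - m) $ i else S $ i $ j) / det S)))
      / sqrt ((2 * pi) ^ CARD('n) * det S)) else 0)"
proof (cases "0 < det S")
  case True
  then obtain A where A: "S ** A = mat 1"
    using invertible_det_nz[of S] by (auto simp: invertible_def)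
  then have "S *v (matrix_inv S *v (x - m)) = x - m"
    by (simp add: matrix_inv_unique matrix_vector_mul_assoc)
  then show ?thesis
    using True cramer[of S "matrix_inv S *v (x - m)" "x - m"] by (simp add: gdens_def)
next
  case False
  then have "gdens m S x \<le> 0"
    unfolding gdens_def by (intro divide_nonneg_nonpos) (auto simp: mult_nonneg_nonpos)
  then show ?thesis using False by (simp add: ennreal_neg)
qed

lemma measurable_gdens_joint [measurable (raw)]:
  fixes m x :: "'a \<Rightarrow> real^'n" and S :: "'a \<Rightarrow> real^'n^'n"
  assumes [measurable]: "m \<in> borel_measurable M" "S \<in> borel_measurable M" "x \<in> borel_measurable M"
  shows "(\<lambda>w. ennreal (gdens (m w) (S w) (x w))) \<in> borel_measurable M"
proof -
  let ?c = "\<lambda>(u::real^'n) (S::real^'n^'n). \<chi> k. det (\<chi> i j. if j = k then u $ i else S $ i $ j)"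
  have "continuous_on UNIV (\<lambda>p. if j = k then fst p $ i else snd p $ i $ j)" for i j k :: 'n
    by (cases "j = k") (auto intro!: continuous_intros)
  then have "continuous_on UNIV (\<lambda>p. ?c (fst p) (snd p))"
    by (intro continuous_intros)
  then have [measurable]: "(\<lambda>w. ?c (x w - m w) (S w)) \<in> borel_measurable M"
    by (intro borel_measurable_continuous_Pair[of _ _ _ ?c]) auto
  have eq: "u \<bullet> (\<chi> k. det (\<chi> i j. if j = k then u $ i else S $ i $ j) / det S) = (u \<bullet> ?c u S) / det S"
    for u :: "real^'n" and S :: "real^'n^'n"
    by (simp add: inner_vec_def sum_divide_distrib)
  show ?thesis
    unfolding ennreal_gdens eq by measurable
qed

lemma space_traj_space [simp]: "space traj_space = UNIV"
  by (simp add: traj_space_def space_PiM)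

lemma measurable_traj_component [measurable]: "(\<lambda>\<omega>. \<omega> k) \<in> borel_measurable traj_space"
  unfolding traj_space_def by (rule measurable_component_singleton) simp

lemma measurable_traj_upd [measurable (raw)]:
  assumes [measurable]: "f \<in> measurable M traj_space" "h \<in> borel_measurable M"
  shows "(\<lambda>w. fun_upd (f w) k (h w)) \<in> measurable M traj_space"
  unfolding traj_space_def
proof (rule measurable_PiM_single')
  fix i
  have "(\<lambda>w. f w i) \<in> borel_measurable M"
    using measurable_compose[OF assms(1) measurable_traj_component[of i]] .
  then show "(\<lambda>w. (fun_upd (f w) k (h w)) i) \<in> borel_measurable M"
    by (cases "i = k") auto
qed auto

section \<open>The transition kernel and invariance of positive definiteness\<close>

context fbgvi
begin

lemma measurable_step [measurable (raw)]:
  assumes [measurable]: "f \<in> borel_measurable M" "g \<in> borel_measurable M"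
  shows "(\<lambda>w. fbgvi_step \<eta> gradV hessV (f w) (g w)) \<in> borel_measurable M"
  unfolding fbgvi_step_def Let_def by measurable

definition step_kernel :: "nat \<Rightarrow> (nat \<Rightarrow> 'n state) \<Rightarrow> (nat \<Rightarrow> 'n state) measure" where
  "step_kernel k \<omega> = distr (gauss (fst (\<omega> k)) (snd (\<omega> k))) traj_space
     (\<lambda>x. (fun_upd \<omega> (Suc k) (fbgvi_step \<eta> gradV hessV (\<omega> k) x)))"

lemma measurable_step_upd [measurable]:
  "(\<lambda>x. (fun_upd \<omega> (Suc k) (fbgvi_step \<eta> gradV hessV (\<omega> k) x))) \<in> measurable borel traj_space"
  by measurable

lemma nn_integral_step_kernel:
  assumes "f \<in> borel_measurable traj_space"
  shows "(\<integral>\<^sup>+x. f x \<partial>step_kernel k \<omega>)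
    = (\<integral>\<^sup>+x. f (fun_upd \<omega> (Suc k) (fbgvi_step \<eta> gradV hessV (\<omega> k) x)) \<partial>gauss (fst (\<omega> k)) (snd (\<omega> k)))"
  unfolding step_kernel_def using assms by (subst nn_integral_distr) simp_all

lemma measurable_step_kernel:
  assumes [measurable]: "A \<in> sets traj_space"
  shows "(\<lambda>\<omega>. emeasure (step_kernel k \<omega>) A) \<in> borel_measurable traj_space"
proof -
  have "emeasure (step_kernel k \<omega>) A = (\<integral>\<^sup>+x. ennreal (gdens (fst (\<omega> k)) (snd (\<omega> k)) x)
      * indicator A (fun_upd \<omega> (Suc k) (fbgvi_step \<eta> gradV hessV (\<omega> k) x)) \<partial>lborel)" for \<omega>
  proof -
    have "emeasure (step_kernel k \<omega>) A = (\<integral>\<^sup>+x. indicator A x \<partial>step_kernel k \<omega>)"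
      by (simp add: step_kernel_def)
    also have "\<dots> = (\<integral>\<^sup>+x. indicator A (fun_upd \<omega> (Suc k) (fbgvi_step \<eta> gradV hessV (\<omega> k) x)) \<partial>gauss (fst (\<omega> k)) (snd (\<omega> k)))"
      by (rule nn_integral_step_kernel) simp
    finally show ?thesis
      unfolding gauss_def by (subst (asm) nn_integral_density) auto
  qed
  then show ?thesis
    by simp
qed

abbreviation traj :: "'n state \<Rightarrow> nat \<Rightarrow> (nat \<Rightarrow> 'n state) measure" where
  "traj s0 k \<equiv> fbgvi_traj \<eta> gradV hessV s0 k"

lemma traj_Suc: "traj s0 (Suc k) = traj s0 k \<bind> step_kernel k"
  by (simp add: step_kernel_def[abs_def])

text \<open>The condition runs over all indices, also those after the current time: such entries are
  still copies of the initial state. On this set \<open>step_kernel\<close> is a probability kernel;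
  elsewhere \<open>gauss\<close> may have any mass.\<close>

definition good :: "(nat \<Rightarrow> 'n state) set" where
  "good = {\<omega>. \<forall>j. spd (snd (\<omega> j))}"

lemma measurable_good [measurable]: "good \<in> sets traj_space"
proof -
  have "{\<omega> \<in> space traj_space. \<forall>j. spd (snd (\<omega> j))} \<in> sets traj_space" by measurable
  then show ?thesis by (simp add: good_def)
qed

lemma good_step:
  assumes "\<omega> \<in> good"
  shows "(fun_upd \<omega> (Suc k) (fbgvi_step \<eta> gradV hessV (\<omega> k) x)) \<in> good"
proof -
  have "spd (snd (fbgvi_step \<eta> gradV hessV (\<omega> k) x))"
    using spd_step[of "snd (\<omega> k)" "fst (\<omega> k)" x] assms by (simp add: good_def)
  then show ?thesis using assms by (simp add: good_def)
qed

lemma emeasure_step_kernel: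
  assumes "\<omega> \<in> good"
  shows "emeasure (step_kernel k \<omega>) UNIV = 1"
proof -
  interpret prob_space "gauss (fst (\<omega> k)) (snd (\<omega> k))"
    using assms by (intro prob_space_gauss) (simp add: good_def)
  show ?thesis
    unfolding step_kernel_def using emeasure_space_1 by (subst emeasure_distr) (auto simp: sets.top[of traj_space, simplified])
qed

context
  fixes s0 :: "'n state"
  assumes init: "spd (snd s0)"
begin

lemma traj_step:
  assumes sets: "sets (traj s0 k) = sets traj_space" and good: "AE \<omega> in traj s0 k. \<omega> \<in> good"
  shows "sets (traj s0 (Suc k)) = sets traj_space"
    and "f \<in> borel_measurable traj_space \<Longrightarrow> (\<integral>\<^sup>+\<omega>. f \<omega> \<partial>traj s0 (Suc k))
      = (\<integral>\<^sup>+\<omega>. (\<integral>\<^sup>+x. f (fun_upd \<omega> (Suc k) (fbgvi_step \<eta> gradV hessV (\<omega> k) x)) \<partial>gauss (fst (\<omega> k)) (snd (\<omega> k))) \<partial>traj s0 k)"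
proof -
  have sp: "space (traj s0 k) = UNIV"
    using sets_eq_imp_space_eq[OF sets] by simp
  have AE1: "AE \<omega> in traj s0 k. emeasure (step_kernel k \<omega>) (space traj_space) \<le> 1"
    using good by eventually_elim (simp add: emeasure_step_kernel)
  have mk: "(\<lambda>\<omega>. emeasure (step_kernel k \<omega>) A) \<in> borel_measurable (traj s0 k)" if "A \<in> sets traj_space" for A
    using measurable_step_kernel[OF that] by (simp add: measurable_cong_sets[OF sets refl])
  have sk: "sets (step_kernel k \<omega>) = sets traj_space" for \<omega>
    by (simp add: step_kernel_def)
  have ne: "space (traj s0 k) \<noteq> {}" "space (traj_space :: (nat \<Rightarrow> 'n state) measure) \<noteq> {}"
    by (simp_all add: sp)
  show "sets (traj s0 (Suc k)) = sets traj_space"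
    unfolding traj_Suc by (rule sets_bind_AE[OF ne sk mk AE1])
  assume f: "f \<in> borel_measurable traj_space"
  show "(\<integral>\<^sup>+\<omega>. f \<omega> \<partial>traj s0 (Suc k))
      = (\<integral>\<^sup>+\<omega>. (\<integral>\<^sup>+x. f (fun_upd \<omega> (Suc k) (fbgvi_step \<eta> gradV hessV (\<omega> k) x)) \<partial>gauss (fst (\<omega> k)) (snd (\<omega> k))) \<partial>traj s0 k)"
    using nn_integral_bind_AE[OF ne sk mk AE1 f] nn_integral_step_kernel[OF f, of k] unfolding traj_Suc by simp
qed

text \<open>The claims are proved together because each \<open>bind\<close> makes sense only for a
  kernel that is sub-Markov almost everywhere, which is what membership in \<open>good\<close>
  provides at the previous stage.\<close>

lemma traj_invariant:
  "sets (traj s0 k) = sets traj_space \<and> (AE \<omega> in traj s0 k. \<omega> \<in> good) \<and> emeasure (traj s0 k) UNIV \<le> 1"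
proof (induction k)
  case 0
  have g: "(\<lambda>_. s0) \<in> good" using init by (simp add: good_def)
  have "AE \<omega> in return traj_space (\<lambda>_. s0). \<omega> \<in> good"
    using g by (subst AE_return) auto
  then show ?case
    unfolding fbgvi_traj.simps by (simp add: emeasure_return sets.top[of traj_space, simplified])
next
  case (Suc k)
  then have sets: "sets (traj s0 k) = sets traj_space" and good: "AE \<omega> in traj s0 k. \<omega> \<in> good"
    and mass: "emeasure (traj s0 k) UNIV \<le> 1" by auto
  note st = traj_step[OF sets good]
  have sp: "space (traj s0 k) = UNIV" "space (traj s0 (Suc k)) = UNIV"
    using sets_eq_imp_space_eq[OF sets] sets_eq_imp_space_eq[OF st(1)] by simp_all
  have "emeasure (traj s0 (Suc k)) UNIV = (\<integral>\<^sup>+\<omega>. 1 \<partial>traj s0 (Suc k))"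
    by (simp add: sp)
  also have "\<dots> = (\<integral>\<^sup>+\<omega>. (\<integral>\<^sup>+x. 1 \<partial>gauss (fst (\<omega> k)) (snd (\<omega> k))) \<partial>traj s0 k)"
    by (rule st(2)) simp
  also have "\<dots> = (\<integral>\<^sup>+\<omega>. 1 \<partial>traj s0 k)"
  proof (rule nn_integral_cong_AE)
    show "AE \<omega> in traj s0 k. (\<integral>\<^sup>+x. 1 \<partial>gauss (fst (\<omega> k)) (snd (\<omega> k))) = 1"
      using good
    proof eventually_elim
      case (elim \<omega>)
      then interpret prob_space "gauss (fst (\<omega> k)) (snd (\<omega> k))"
        by (intro prob_space_gauss) (simp add: good_def)
      show ?case using emeasure_space_1 by simp
    qed
  qed
  finally have m: "emeasure (traj s0 (Suc k)) UNIV \<le> 1"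
    using mass by (simp add: sp)
  \<comment> \<open>From a good trajectory every sample, not only almost every one, leads to a good
    trajectory, so the inner integral vanishes.\<close>
  have "(\<integral>\<^sup>+\<omega>. indicator (- good) \<omega> \<partial>traj s0 (Suc k))
      = (\<integral>\<^sup>+\<omega>. (\<integral>\<^sup>+x. indicator (- good) (fun_upd \<omega> (Suc k) (fbgvi_step \<eta> gradV hessV (\<omega> k) x)) \<partial>gauss (fst (\<omega> k)) (snd (\<omega> k))) \<partial>traj s0 k)"
    by (rule st(2)) (use measurable_good sets.compl_sets[OF measurable_good] in \<open>simp add: Compl_eq_Diff_UNIV\<close>)
  also have "\<dots> = (\<integral>\<^sup>+\<omega>. 0 \<partial>traj s0 k)"
    using good by (intro nn_integral_cong_AE, eventually_elim) (simp add: good_step)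
  finally have "emeasure (traj s0 (Suc k)) (- good) = 0"
    using st(1) measurable_good sets.compl_sets[OF measurable_good]
    by (subst (asm) nn_integral_indicator) (simp_all add: Compl_eq_Diff_UNIV)
  then have "AE \<omega> in traj s0 (Suc k). \<omega> \<in> good"
    using st(1) measurable_good sets.compl_sets[OF measurable_good]
    by (intro AE_I[of _ _ "- good"]) (auto simp: Compl_eq_Diff_UNIV)
  with st(1) m show ?case by auto
qed

end

end

text \<open>In other words \<open>1 / W \<le> 1 / N + \<delta>\<close>. With
  \<open>r = 1 / (1 + \<delta>)\<close> the geometric sum gives
  \<open>\<delta> * W = 1 - r ^ N\<close>, and \<open>N * r ^ N \<le> W\<close> since the powers
  decrease.\<close>

lemma geometric_weights:
  fixes \<delta> :: real and N :: nat
  assumes \<delta>: "0 \<le> \<delta>"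
  defines "W \<equiv> (\<Sum>j = 1..N. (1 / (1 + \<delta>)) ^ j)"
  shows "real N \<le> (1 + real N * \<delta>) * W"
proof -
  define r where "r = 1 / (1 + \<delta>)"
  have r: "0 \<le> r" "r \<le> 1" "(1 + \<delta>) * r = 1"
    using \<delta> by (auto simp: r_def)
  have "\<delta> * (\<Sum>j = 1..N. r ^ j) = 1 - r ^ N"
  proof (induction N)
    case (Suc n)
    have "\<delta> * r ^ Suc n = r ^ n - r ^ Suc n"
    proof -
      have "r ^ n = ((1 + \<delta>) * r) * r ^ n" using r(3) by simp
      then show ?thesis by (simp add: algebra_simps)
    qed
    then show ?case using Suc by (simp add: distrib_left)
  qed simp
  then have *: "\<delta> * W = 1 - r ^ N" by (simp add: W_def r_def)
  have "real N * r ^ N = (\<Sum>j = 1..N. r ^ N)" by simp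
  also have "\<dots> \<le> W"
    unfolding W_def r_def[symmetric] by (intro sum_mono power_decreasing r) auto
  finally have "real N * r ^ N \<le> W" .
  moreover have "(1 + real N * \<delta>) * W = W + real N * (\<delta> * W)" by (simp add: algebra_simps)
  ultimately show ?thesis unfolding * by (simp add: algebra_simps)
qed

section \<open>Discounted energy and the expected minimum\<close>

context fbgvi
begin

definition gap :: "'n state \<Rightarrow> real" where
  "gap s = FG V (fst s) (snd s) - FG V mh Sh"

text \<open>A Borel function that agrees with \<open>gap\<close> on the positive definite states; off them \<open>FG\<close> takes
  junk values whose measurability is not needed.\<close>
definition gap' :: "'n state \<Rightarrow> real" where
  "gap' s = pot (fst s) (psd_sqrt (snd s)) - (1/2) * ln (det (snd s))
    - (1/2) * ln ((2 * pi) ^ CARD('n)) - real CARD('n) / 2 - FG V mh Sh"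

lemma gap_eq: "spd (snd s) \<Longrightarrow> gap s = gap' s"
  using FG_eq_pot[OF det_factor_nonzero, of "snd s" "psd_sqrt (snd s)" "fst s"] spd_sqrt[of "snd s"]
  by (simp add: gap_def gap'_def spd_def)

lemma gap_nonneg: "spd (snd s) \<Longrightarrow> 0 \<le> gap s"
  using minimizer by (simp add: gap_def)

lemma measurable_lyap [measurable]: "lyap \<in> borel_measurable borel"
  unfolding lyap_def[abs_def] bures_def by measurable

lemma measurable_gap' [measurable]: "gap' \<in> borel_measurable borel"
proof -
  interpret prob_space "stdgauss :: (real^'n) measure" by (rule prob_space_stdgauss)
  have [measurable]: "(\<lambda>s. pot (fst s) (psd_sqrt (snd s))) \<in> borel_measurable borel"
    unfolding pot_def by measurable
  show ?thesis unfolding gap'_def[abs_def] by measurable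
qed

definition disc :: real where "disc = 1 / (1 + drift)"

lemma disc: "0 < disc" "(1 + drift) * disc = 1"
  using drift_nonneg by (auto simp: disc_def)

text \<open>Discounting by \<open>1 / (1 + drift)\<close> turns the one-step bound into a supermartingale property.\<close>
definition energy :: "nat \<Rightarrow> (nat \<Rightarrow> 'n state) \<Rightarrow> ennreal" where
  "energy k \<omega> = ennreal (disc ^ k) * ennreal (lyap (\<omega> k))
    + (\<Sum>j = 1..k. ennreal (2 * \<eta> * disc ^ j) * ennreal (gap' (\<omega> j)))"

lemma measurable_energy [measurable]: "energy k \<in> borel_measurable traj_space"
  unfolding energy_def[abs_def] by measurable

text \<open>The update touches only the distance term and the summand with index
  \<open>Suc k\<close>; the older summands form the constant \<open>rest\<close>. One discount
  factor cancels \<open>1 + drift\<close> exactly.\<close>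

lemma energy_step:
  assumes \<omega>: "\<omega> \<in> good"
  shows "(\<integral>\<^sup>+x. energy (Suc k) (fun_upd \<omega> (Suc k) (fbgvi_step \<eta> gradV hessV (\<omega> k) x)) \<partial>gauss (fst (\<omega> k)) (snd (\<omega> k)))
    \<le> energy k \<omega> + ennreal (disc ^ Suc k * noise)"
proof -
  define s where "s x = fbgvi_step \<eta> gradV hessV (\<omega> k) x" for x
  define rest where "rest = (\<Sum>j = 1..k. ennreal (2 * \<eta> * disc ^ j) * ennreal (gap' (\<omega> j)))"
  have S: "spd (snd (\<omega> k))" using \<omega> by (simp add: good_def)
  interpret prob_space "gauss (fst (\<omega> k)) (snd (\<omega> k))" by (rule prob_space_gauss[OF S])
  have spd_s: "spd (snd (s x))" for x
    using spd_step[OF S, of "fst (\<omega> k)" x] by (simp add: s_def)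
  have [measurable]: "s \<in> borel_measurable borel" unfolding s_def by measurable
  have "energy (Suc k) (fun_upd \<omega> (Suc k) (s x)) = ennreal (disc ^ Suc k) * ennreal (lyap (s x) + 2 * \<eta> * gap (s x)) + rest" for x
  proof -
    have "0 \<le> lyap (s x)" using lyap_nonneg[OF spd_s, of "fst (s x)" x] by simp
    moreover have "0 \<le> 2 * \<eta> * gap (s x)" using gap_nonneg[OF spd_s] eta_pos by simp
    ultimately have "ennreal (lyap (s x) + 2 * \<eta> * gap (s x)) = ennreal (lyap (s x)) + ennreal (2 * \<eta> * gap (s x))"
      by (rule ennreal_plus)
    moreover have "ennreal (2 * \<eta> * disc ^ Suc k) * ennreal (gap' (s x)) = ennreal (disc ^ Suc k) * ennreal (2 * \<eta> * gap (s x))"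
      using eta_pos disc(1) gap_nonneg[OF spd_s, of x] gap_eq[OF spd_s, of x]
      by (simp add: ennreal_mult[symmetric] mult_ac)
    moreover have "(\<Sum>j = 1..k. ennreal (2 * \<eta> * disc ^ j) * ennreal (gap' ((fun_upd \<omega> (Suc k) (s x)) j))) = rest"
      unfolding rest_def by (intro sum.cong) auto
    ultimately show ?thesis
      by (simp add: energy_def distrib_left ac_simps)
  qed
  then have "(\<integral>\<^sup>+x. energy (Suc k) (fun_upd \<omega> (Suc k) (s x)) \<partial>gauss (fst (\<omega> k)) (snd (\<omega> k)))
      = (\<integral>\<^sup>+x. ennreal (disc ^ Suc k) * ennreal (lyap (s x) + 2 * \<eta> * gap' (s x)) + rest \<partial>gauss (fst (\<omega> k)) (snd (\<omega> k)))"
    by (simp add: gap_eq[OF spd_s])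
  also have "\<dots> = ennreal (disc ^ Suc k) * (\<integral>\<^sup>+x. ennreal (lyap (s x) + 2 * \<eta> * gap' (s x)) \<partial>gauss (fst (\<omega> k)) (snd (\<omega> k))) + rest"
    using emeasure_space_1 by (simp add: nn_integral_add nn_integral_cmult)
  also have "\<dots> \<le> ennreal (disc ^ Suc k) * ennreal ((1 + drift) * lyap (\<omega> k) + noise) + rest"
    using one_step_expectation[OF S, of "fst (\<omega> k)"]
    by (intro add_right_mono mult_left_mono) (simp_all add: gap_eq[OF spd_s, symmetric], simp_all add: gap_def s_def)
  also have "\<dots> = energy k \<omega> + ennreal (disc ^ Suc k * noise)"
  proof -
    have l: "0 \<le> lyap (\<omega> k)" using lyap_nonneg[OF S, of "fst (\<omega> k)"] by simp
    have "disc ^ Suc k * ((1 + drift) * lyap (\<omega> k) + noise) = disc ^ k * (((1 + drift) * disc) * lyap (\<omega> k)) + disc ^ Suc k * noise"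
      by (simp add: algebra_simps)
    then have "ennreal (disc ^ Suc k) * ennreal ((1 + drift) * lyap (\<omega> k) + noise) = ennreal (disc ^ k * lyap (\<omega> k)) + ennreal (disc ^ Suc k * noise)"
      unfolding disc(2) using l disc(1) noise_nonneg drift_nonneg by (simp add: ennreal_mult[symmetric] ennreal_plus[symmetric] del: ennreal_plus)
    then show ?thesis
      using l disc(1) by (simp add: energy_def rest_def ennreal_mult ac_simps)
  qed
  finally show ?thesis unfolding s_def .
qed

theorem expected_energy:
  assumes init: "spd (snd s0)"
  shows "(\<integral>\<^sup>+\<omega>. energy k \<omega> \<partial>traj s0 k) \<le> ennreal (lyap s0 + noise * (\<Sum>j = 1..k. disc ^ j))"
proof (induction k)
  case 0
  have "(\<integral>\<^sup>+\<omega>. energy 0 \<omega> \<partial>return traj_space (\<lambda>_. s0)) = energy 0 (\<lambda>_. s0)"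
    by (rule nn_integral_return) auto
  then show ?case by (simp add: energy_def)
next
  case (Suc k)
  have sets: "sets (traj s0 k) = sets traj_space" and good: "AE \<omega> in traj s0 k. \<omega> \<in> good"
    and mass: "emeasure (traj s0 k) UNIV \<le> 1"
    using traj_invariant[OF init, of k] by auto
  have sp: "space (traj s0 k) = UNIV" using sets_eq_imp_space_eq[OF sets] by simp
  have me: "energy k \<in> borel_measurable (traj s0 k)"
    using measurable_energy by (simp add: measurable_cong_sets[OF sets refl])
  have nn: "0 \<le> lyap s0 + noise * (\<Sum>j = 1..k. disc ^ j)"
    using lyap_nonneg[OF init, of "fst s0"] noise_nonneg disc(1) by (auto intro!: add_nonneg_nonneg mult_nonneg_nonneg sum_nonneg)
  have "(\<integral>\<^sup>+\<omega>. energy (Suc k) \<omega> \<partial>traj s0 (Suc k))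
      = (\<integral>\<^sup>+\<omega>. (\<integral>\<^sup>+x. energy (Suc k) (fun_upd \<omega> (Suc k) (fbgvi_step \<eta> gradV hessV (\<omega> k) x)) \<partial>gauss (fst (\<omega> k)) (snd (\<omega> k))) \<partial>traj s0 k)"
    by (rule traj_step(2)[OF init sets good]) simp
  also have "\<dots> \<le> (\<integral>\<^sup>+\<omega>. energy k \<omega> + ennreal (disc ^ Suc k * noise) \<partial>traj s0 k)"
    using good by (intro nn_integral_mono_AE, eventually_elim) (rule energy_step)
  also have "\<dots> = (\<integral>\<^sup>+\<omega>. energy k \<omega> \<partial>traj s0 k) + ennreal (disc ^ Suc k * noise) * emeasure (traj s0 k) UNIV"
    using me by (simp add: nn_integral_add sp)
  also have "\<dots> \<le> ennreal (lyap s0 + noise * (\<Sum>j = 1..k. disc ^ j)) + ennreal (disc ^ Suc k * noise)"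
    using Suc mass mult_left_mono[OF mass, of "ennreal (disc ^ Suc k * noise)"] by (intro add_mono) auto
  also have "\<dots> = ennreal (lyap s0 + noise * (\<Sum>j = 1..Suc k. disc ^ j))"
    using nn noise_nonneg disc(1) by (subst ennreal_plus[symmetric]) (auto simp: algebra_simps)
  finally show ?case .
qed

text \<open>The minimum is at most the average of the gaps with weights proportional to
  \<open>disc ^ j\<close>. The normalization \<open>c\<close> and the nonnegative distance term of
  \<open>energy\<close> turn this into a pointwise bound on \<open>good\<close>. The integral of the
  minimum is then compared by monotonicity with that of the measurable
  \<open>energy N\<close>.\<close>

theorem expected_min_gap:
  assumes init: "spd (snd s0)" and N: "N \<ge> 1"
  shows "(\<integral>\<^sup>+\<omega>. ennreal ((MIN k\<in>{1..N}. FG V (fst (\<omega> k)) (snd (\<omega> k))) - FG V mh Sh) \<partial>traj s0 N)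
    \<le> ennreal ((1 / real N + drift) * lyap s0 / (2 * \<eta>) + noise / (2 * \<eta>))"
proof -
  define W where "W = (\<Sum>j = 1..N. disc ^ j)"
  have W: "0 < W" unfolding W_def using disc(1) N by (intro sum_pos) auto
  define c where "c = 2 * \<eta> * W"
  have c: "0 < c" using W eta_pos by (simp add: c_def)
  have sets: "sets (traj s0 N) = sets traj_space" and good: "AE \<omega> in traj s0 N. \<omega> \<in> good"
    using traj_invariant[OF init, of N] by auto
  have me: "energy N \<in> borel_measurable (traj s0 N)"
    using measurable_energy by (simp add: measurable_cong_sets[OF sets refl])
  have pw: "ennreal ((MIN k\<in>{1..N}. FG V (fst (\<omega> k)) (snd (\<omega> k))) - FG V mh Sh) \<le> ennreal (1 / c) * energy N \<omega>"
    if \<omega>: "\<omega> \<in> good" for \<omega>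
  proof -
    define g where "g = (MIN k\<in>{1..N}. FG V (fst (\<omega> k)) (snd (\<omega> k))) - FG V mh Sh"
    have g: "g \<le> gap' (\<omega> j)" if "j \<in> {1..N}" for j
    proof -
      have "(MIN k\<in>{1..N}. FG V (fst (\<omega> k)) (snd (\<omega> k))) \<le> FG V (fst (\<omega> j)) (snd (\<omega> j))"
        using that by (intro Min_le) auto
      moreover have "gap (\<omega> j) = gap' (\<omega> j)" using \<omega> by (intro gap_eq) (simp add: good_def)
      ultimately show ?thesis by (simp add: g_def gap_def)
    qed
    have "(\<Sum>j = 1..N. 2 * \<eta> * disc ^ j * g) = c * g"
      unfolding c_def W_def sum_distrib_left sum_distrib_right ..
    then have "g = 1 / c * (\<Sum>j = 1..N. 2 * \<eta> * disc ^ j * g)"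
      using c by simp
    then have "ennreal g = ennreal (1 / c) * ennreal (\<Sum>j = 1..N. 2 * \<eta> * disc ^ j * g)"
      using c ennreal_mult'[of "1 / c" "\<Sum>j = 1..N. 2 * \<eta> * disc ^ j * g"] by simp
    also have "\<dots> \<le> ennreal (1 / c) * ennreal (\<Sum>j = 1..N. 2 * \<eta> * disc ^ j * gap' (\<omega> j))"
      using g eta_pos disc(1) by (intro mult_left_mono ennreal_leI sum_mono) auto
    also have "ennreal (\<Sum>j = 1..N. 2 * \<eta> * disc ^ j * gap' (\<omega> j)) = (\<Sum>j = 1..N. ennreal (2 * \<eta> * disc ^ j * gap' (\<omega> j)))"
    proof (rule sum_ennreal[symmetric])
      fix j
      have "0 \<le> gap' (\<omega> j)"
        using gap_nonneg[of "\<omega> j"] gap_eq[of "\<omega> j"] \<omega> by (simp add: good_def)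
      then show "0 \<le> 2 * \<eta> * disc ^ j * gap' (\<omega> j)" using eta_pos disc(1) by simp
    qed
    also have "\<dots> = (\<Sum>j = 1..N. ennreal (2 * \<eta> * disc ^ j) * ennreal (gap' (\<omega> j)))"
      using eta_pos disc(1) by (intro sum.cong ennreal_mult') auto
    \<comment> \<open>Here the discounted distance at time \<open>N\<close> is dropped.\<close>
    also have "\<dots> \<le> energy N \<omega>" by (simp add: energy_def)
    finally show ?thesis by (simp add: g_def mult_left_mono)
  qed
  have "(\<integral>\<^sup>+\<omega>. ennreal ((MIN k\<in>{1..N}. FG V (fst (\<omega> k)) (snd (\<omega> k))) - FG V mh Sh) \<partial>traj s0 N)
      \<le> (\<integral>\<^sup>+\<omega>. ennreal (1 / c) * energy N \<omega> \<partial>traj s0 N)"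
    using good by (intro nn_integral_mono_AE, eventually_elim) (rule pw)
  also have "\<dots> = ennreal (1 / c) * (\<integral>\<^sup>+\<omega>. energy N \<omega> \<partial>traj s0 N)"
    by (rule nn_integral_cmult[OF me])
  also have "\<dots> \<le> ennreal (1 / c) * ennreal (lyap s0 + noise * W)"
    unfolding W_def by (intro mult_left_mono expected_energy init) simp
  also have "\<dots> = ennreal (lyap s0 * (1 / W) / (2 * \<eta>) + noise / (2 * \<eta>))"
  proof -
    have "1 / c * (lyap s0 + noise * W) = lyap s0 * (1 / W) / (2 * \<eta>) + noise / (2 * \<eta>)"
      using W eta_pos by (simp add: c_def field_simps)
    then show ?thesis using c by (simp add: ennreal_mult'[symmetric])
  qed
  also have "\<dots> \<le> ennreal ((1 / real N + drift) * lyap s0 / (2 * \<eta>) + noise / (2 * \<eta>))"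
  proof -
    have "real N \<le> (1 + real N * drift) * W"
      using geometric_weights[OF drift_nonneg, of N] by (simp add: W_def disc_def)
    then have "1 / W \<le> 1 / real N + drift"
      using W N by (simp add: field_simps)
    then have "lyap s0 * (1 / W) \<le> lyap s0 * (1 / real N + drift)"
      using lyap_nonneg[OF init, of "fst s0"] by (intro mult_left_mono) auto
    then show ?thesis
      using eta_pos by (intro ennreal_leI add_right_mono divide_right_mono) (simp_all add: mult.commute)
  qed
  finally show ?thesis .
qed

end

theorem mainTheorem5:
  fixes V :: "real^'n \<Rightarrow> real"
    and gradV :: "real^'n \<Rightarrow> real^'n"
    and hessV :: "real^'n \<Rightarrow> real^'n^'n"
    and \<beta> \<eta> :: real and m0 mh :: "real^'n" and S0 Sh :: "real^'n^'n" and N :: nat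
  assumes grad: "\<And>x. (V has_derivative (\<lambda>h. gradV x \<bullet> h)) (at x)"
    and hess: "\<And>x. (gradV has_derivative (\<lambda>h. hessV x *v h)) (at x)"
    and hess_cont: "continuous_on UNIV hessV"
    and convex: "\<And>x. loewner_le 0 (hessV x)"
    and smooth: "\<And>x. loewner_le (- (\<beta> *\<^sub>R mat 1)) (hessV x) \<and> loewner_le (hessV x) (\<beta> *\<^sub>R mat 1)"
    and beta_pos: "\<beta> > 0"
    and min_spd: "spd Sh"
    and minimizer: "\<And>m S. spd S \<Longrightarrow> FG V mh Sh \<le> FG V m S"
    and eta_pos: "\<eta> > 0" and eta_le: "\<eta> \<le> 1 / (2 * \<beta>)"
    and init: "spd S0"
    and N: "N \<ge> 1"
  shows "(\<integral>\<^sup>+ \<omega>. ennreal ((MIN k\<in>{1..N}. FG V (fst (\<omega> k)) (snd (\<omega> k))) - FG V mh Sh)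
             \<partial>fbgvi_traj \<eta> gradV hessV (m0, S0) N)
         \<le> ennreal (2 / (real N * \<eta>)) * W2sq (gauss m0 S0) (gauss mh Sh)
           + ennreal (2 * (24 * \<beta> ^ 3 * lambda_max Sh) * \<eta>) * W2sq (gauss m0 S0) (gauss mh Sh)
           + ennreal (12 * \<beta> * \<eta> * real CARD('n))"
proof -
  interpret fbgvi V gradV hessV \<beta> \<eta> mh Sh
  proof unfold_locales
    show "0 \<le> h \<bullet> (hessV x *v h)" for x h
      using convex[of x] by (simp add: loewner_le_def psd_def)
    show "h \<bullet> (hessV x *v h) \<le> \<beta> * (h \<bullet> h)" for x h
      using smooth[of x] by (auto simp: loewner_le_def psd_def matrix_vector_mult_diff_rdistrib inner_diff_right
          scaleR_matrix_vector_assoc[symmetric])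
  qed (use assms in auto)
  define l where "l = lambda_max Sh"
  have l: "0 < l" using trace_le_lambda_max(2)[OF min_spd] by (simp add: l_def)
  define L where "L = lyap (m0, S0)"
  have L: "0 \<le> L" unfolding L_def by (rule lyap_nonneg[OF init])
  \<comment> \<open>The final bound is increasing in \<open>L\<close>, so this one direction of the
    Gaussian distance formula is enough.\<close>
  have W2: "ennreal L \<le> W2sq (gauss m0 S0) (gauss mh Sh)"
    using bures_le_W2sq[OF init min_spd, of m0 mh] by (simp add: L_def lyap_def)
  have "(1 / real N + drift) * L / (2 * \<eta>) + noise / (2 * \<eta>)
      \<le> 2 / (real N * \<eta>) * L + 2 * (24 * \<beta> ^ 3 * l) * \<eta> * L + 12 * \<beta> * \<eta> * real CARD('n)"
  proof -
    \<comment> \<open>In these quantities \<open>p / 2 + 4 * q + 4 * t\<close> has been proved and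
      \<open>2 * p + 48 * q + 12 * t\<close> is claimed, so nonnegativity finishes the
      comparison.\<close>
    define p q t where "p = 1 / (real N * \<eta>) * L" and "q = \<beta> ^ 3 * l * \<eta> * L" and "t = \<beta> * \<eta> * real CARD('n)"
    have e1: "(1 / real N + drift) * L / (2 * \<eta>) + noise / (2 * \<eta>) = p / 2 + 4 * q + 4 * t"
      using eta_pos N by (simp add: drift_def noise_def l_def p_def q_def t_def field_simps power2_eq_square)
    have "0 \<le> p" "0 \<le> q" "0 \<le> t"
      using eta_pos beta_pos l L by (auto simp: p_def q_def t_def)
    moreover have e2: "2 / (real N * \<eta>) * L + 2 * (24 * \<beta> ^ 3 * l) * \<eta> * L + 12 * \<beta> * \<eta> * real CARD('n) = 2 * p + 48 * q + 12 * t"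
      by (simp add: p_def q_def t_def)
    ultimately show ?thesis unfolding e1 e2 by linarith
  qed
  then have "ennreal ((1 / real N + drift) * L / (2 * \<eta>) + noise / (2 * \<eta>))
      \<le> ennreal (2 / (real N * \<eta>) * L + 2 * (24 * \<beta> ^ 3 * l) * \<eta> * L + 12 * \<beta> * \<eta> * real CARD('n))"
    by (rule ennreal_leI)
  also have "\<dots> = ennreal (2 / (real N * \<eta>)) * ennreal L + ennreal (2 * (24 * \<beta> ^ 3 * l) * \<eta>) * ennreal L
      + ennreal (12 * \<beta> * \<eta> * real CARD('n))"
    using eta_pos beta_pos l L by (simp add: ennreal_mult[symmetric])
  also have "\<dots> \<le> ennreal (2 / (real N * \<eta>)) * W2sq (gauss m0 S0) (gauss mh Sh)
      + ennreal (2 * (24 * \<beta> ^ 3 * l) * \<eta>) * W2sq (gauss m0 S0) (gauss mh Sh)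
      + ennreal (12 * \<beta> * \<eta> * real CARD('n))"
    by (intro add_mono mult_left_mono W2 order_refl) auto
  finally show ?thesis
    using expected_min_gap[of "(m0, S0)" N] init N unfolding L_def l_def by (auto intro: order_trans)
qed

end
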